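(* Let $\mathcal{C}\subset\mathbb{C}^3$, $\mathcal{C}^p$ and $f_3$ be as in the context, let $B_p=\{(z,r_2(z))\in\mathbb{C}^2 : z\in\mathbb{C},\ |z|>M\}$ be an infinity branch of $\mathcal{C}^p$ with $$r_2(z)=a_0z+a_1z^{(k-1)/k}+a_2z^{(k-2)/k}+\cdots+a_k+a_{k+1}z^{-1/k}+a_{k+2}z^{-2/k}+\cdots ,$$ and let $(t^k,q_2(t))$, with $q_2(t)=a_0t^k+a_1t^{k-1}+\cdots+a_k$, be the asymptote of $\mathcal{C}^p$ obtained from $B_p$. Let $n\ge n_0$ and let $\Lambda_0,\dots,\Lambda_k$ be the polynomials in the undetermined coefficients $b_0,\dots,b_k$ described in the context. Let $b_0,\ldots,b_k\in\mathbb{C}$ satisfy $$\Lambda_i(b_0,\ldots,b_i)=0,\qquad i=0,\ldots,k,$$ and put $q_3(t)=b_0t^k+b_1t^{k-1}+\cdots+b_k$. Then the curve defined by the parametrization $$\widetilde{\mathcal{Q}}(t)=(t^k,\ q_2(t),\ q_3(t))$$ is a g-asymptote of $\mathcal{C}$ (at the infinity branch $B=\{(z,r_2(z),r_3(z))\}$ of $\mathcal{C}$ corresponding to $B_p$, where $r_3(z)=h(z,r_2(z))$).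
   Context: **Curves.** $\mathcal{C}\subset\mathbb{C}^3$ is an irreducible algebraic space curve defined by two polynomials $f_1,f_2\in\mathbb{R}[x_1,x_2,x_3]$. It is assumed that all points at infinity of $\mathcal{C}$ (points of its projective closure in $\mathbb{P}^3(\mathbb{C})$ with $x_4=0$) have the form $(1:m_2:m_3:0)$ with $m_2,m_3\in\mathbb{C}$. It is also assumed that the $x_3$-axis is a valid projection direction: the projection $(x_1,x_2,x_3)\mapsto(x_1,x_2)$ is birational from $\mathcal{C}$ onto an irreducible plane curve $\mathcal{C}^p$, with implicit polynomial $f^p(x_1,x_2)\in\mathbb{R}[x_1,x_2]$. The lift function $h=h_1/h_2$ ($h_1,h_2$ polynomials in $x_1,x_2$, with $h_2$ not vanishing identically on $\mathcal{C}^p$) gives the inverse birational correspondence: $(x_1,x_2,x_3)\in\mathcal{C}$ iff $(x_1,x_2)\in\mathcal{C}^p$ and $x_3=h(x_1,x_2)$ (as a birational correspondence, i.e. up to finitely many points). Put $f_3(x_1,x_2,x_3)=x_3h_2(x_1,x_2)-h_1(x_1,x_2)$, and let $F_3(x_1,x_2,x_3,x_4)=x_3H_2(x_1,x_2,x_4)-H_1(x_1,x_2,x_4)$ be its homogenization (so $H_1,H_2$ are homogeneous, including any power of $x_4$ needed to make $F_3$ homogeneous). **Infinity branches.** An infinity branch of $\mathcal{C}$ associated with $(1:m_2:m_3:0)$ is a set $B=\{(z,r_2(z),r_3(z)) : z\in\mathbb{C},\ |z|>M\}$, $M>0$, where $r_j(z)=z\varphi_j(z^{-1})$, each $\varphi_j(t)$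 is a (convergent) Puiseux series in $t$ without negative exponents, $\varphi_j(0)=m_j$, and $f_i(z,r_2(z),r_3(z))=0$ for $i=1,2$ and $|z|>M$. Thus $r_j(z)=m_jz+{}$ terms with exponents $<1$. Infinity branches $\{(z,r_2(z))\}$ of the plane curve $\mathcal{C}^p$ are defined in the same way using $f^p(z,r_2(z))=0$. Here $k\ge1$ is an integer such that $r_2$ is a series in $z^{1/k}$; some $a_i$ may be $0$. **Approaching curves and g-asymptotes.** Let $d$ be the usual unitary distance. A curve $\overline{\mathcal{C}}$ approaches $\mathcal{C}$ at its infinity branch $B=\{(z,r_2(z),r_3(z)) : |z|>M\}$ if $\lim_{z\to\infty}d((z,r_2(z),r_3(z)),\overline{\mathcal{C}})=0$, where $d(p,\overline{\mathcal{C}})=\min\{d(p,q):q\in\overline{\mathcal{C}}\}$. A curve of degree $d_0$ is perfect if it cannot be approached (at any of its infinity branches) by any curve of degree less than $d_0$. A g-asymptote of $\mathcal{C}$ at $B$ is a perfect curve that approaches $\mathcal{C}$ at $B$. The parametrization of a g-asymptote is not required to be proper (injective for almost all parameter values). The same definitions apply to plane curves. **The polynomials $\Lambda_j$.** There is $n_0\in\mathbb{N}$ such that for every integer $n\ge n_0$, with $b_0,\dots,b_k$ undetermined coefficients, $$F_3\bigl(t^{n+k},\,a_0t^{n+k}+a_1t^{n+k-1}+\cdots+a_{n+k},\,t^n(b_0t^k+b_1t^{k-1}+\cdots+b_k),\,t^n\bigr)=\sum_{j=0}^{k}\Lambda_j(b_0,\ldots,b_j)t^{\mu-j}+\sum_{j=k+1}^{\mu}\Lambda_j(b_0,\ldots,b_k)t^{\mu-j},$$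 where $\mu\ge k$ and, for $j=0,\ldots,k$, $$\Lambda_j(b_0,\ldots,b_j)=b_j\,\rho(a_0,\ldots,a_r)-\rho_j(a_0,\ldots,a_{r+j},b_0,\ldots,b_{j-1}),\qquad \rho(a_0,\ldots,a_r)\neq0,$$ for some $r\in\mathbb{N}$ with $r\le n$. Here the listed arguments mean that the quantity depends only on those variables: replacing $a_i$ for the other indices $i\le n+k$ by arbitrary complex numbers does not change it. The number $n_0$, an integer $n\ge n_0$, and the resulting $\Lambda_j$ are those used in the claim. *)

theory Defs
  imports
    "HOL-Analysis.Analysis"
    "HOL-Computational_Algebra.Polynomial"
    "HOL-Library.Poly_Mapping"
    "HOL-Library.Extended_Nat"
begin

section \<open>Polynomials in several variables\<close>

text \<open>
  A polynomial over \<open>'a\<close> in variables indexed by the finite type \<open>'v\<close> is a finitely supported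
  map from exponent vectors to coefficients; sums and products are those of \<^type>\<open>poly_mapping\<close>.
\<close>

type_synonym ('a, 'v) mpoly = "('v \<Rightarrow>\<^sub>0 nat) \<Rightarrow>\<^sub>0 'a"

text \<open>
  Evaluation takes the coefficients to the target ring by \<open>\<kappa>\<close>: this is \<^term>\<open>id\<close> for
  complex polynomials, \<^term>\<open>complex_of_real\<close> for real polynomials at complex points,
  and \<open>\<lambda>c. [:c:]\<close> for the substitution of univariate polynomials for the variables.
\<close>

definition mpoly_eval ::
    "('a::zero \<Rightarrow> 'b::comm_semiring_1) \<Rightarrow> ('a, 'v::finite) mpoly \<Rightarrow> ('v \<Rightarrow> 'b) \<Rightarrow> 'b" where
  "mpoly_eval \<kappa> p x =
     (\<Sum>m\<in>Poly_Mapping.keys p.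
        \<kappa> (Poly_Mapping.lookup p m) * (\<Prod>i\<in>UNIV. x i ^ Poly_Mapping.lookup m i))"

abbreviation ceval :: "(complex, 'v::finite) mpoly \<Rightarrow> complex ^ 'v \<Rightarrow> complex" where
  "ceval p x \<equiv> mpoly_eval id p (\<lambda>i. x $ i)"

abbreviation reval :: "(real, 'v::finite) mpoly \<Rightarrow> complex ^ 'v \<Rightarrow> complex" where
  "reval p x \<equiv> mpoly_eval complex_of_real p (\<lambda>i. x $ i)"

definition complexify :: "(real, 'v) mpoly \<Rightarrow> (complex, 'v) mpoly" where
  "complexify p = Poly_Mapping.map complex_of_real p"

definition mvar :: "'v \<Rightarrow> (complex, 'v) mpoly" where
  "mvar i = Poly_Mapping.single (Poly_Mapping.single i 1) 1"

definition monom_deg :: "('v::finite \<Rightarrow>\<^sub>0 nat) \<Rightarrow> nat" where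
  "monom_deg m = (\<Sum>i\<in>UNIV. Poly_Mapping.lookup m i)"

definition total_deg :: "('a::zero, 'v::finite) mpoly \<Rightarrow> nat" where
  "total_deg p = Max (insert 0 (monom_deg ` Poly_Mapping.keys p))"

definition homogeneous :: "('a::zero, 'v::finite) mpoly \<Rightarrow> bool" where
  "homogeneous p \<longleftrightarrow> (\<exists>d. \<forall>m\<in>Poly_Mapping.keys p. monom_deg m = d)"

definition monom_rename :: "('v::finite \<Rightarrow> 'w) \<Rightarrow> ('v \<Rightarrow>\<^sub>0 nat) \<Rightarrow> ('w \<Rightarrow>\<^sub>0 nat)" where
  "monom_rename g m = (\<Sum>i\<in>UNIV. Poly_Mapping.single (g i) (Poly_Mapping.lookup m i))"

definition mpoly_rename ::
    "('v::finite \<Rightarrow> 'w) \<Rightarrow> ('a::comm_monoid_add, 'v) mpoly \<Rightarrow> ('a, 'w) mpoly" where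
  "mpoly_rename g p =
     (\<Sum>m\<in>Poly_Mapping.keys p.
        Poly_Mapping.single (monom_rename g m) (Poly_Mapping.lookup p m))"

text \<open>The homogenizing variable has index \<^term>\<open>None\<close>, the old variables have indices \<open>Some i\<close>.\<close>

definition homogenize :: "('a::comm_monoid_add, 'v::finite) mpoly \<Rightarrow> ('a, 'v option) mpoly" where
  "homogenize p =
     (\<Sum>m\<in>Poly_Mapping.keys p.
        Poly_Mapping.single
          (monom_rename Some m + Poly_Mapping.single None (total_deg p - monom_deg m))
          (Poly_Mapping.lookup p m))"


section \<open>Algebraic curves in affine space\<close>

definition algebraic_set :: "(complex ^ 'n) set \<Rightarrow> bool" where
  "algebraic_set X \<longleftrightarrow> (\<exists>S. X = {x. \<forall>p\<in>S. ceval p x = 0})"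

definition zariski_closure :: "(complex ^ 'n) set \<Rightarrow> (complex ^ 'n) set" where
  "zariski_closure X = {x. \<forall>p. (\<forall>y\<in>X. ceval p y = 0) \<longrightarrow> ceval p x = 0}"

definition irreducible_set :: "(complex ^ 'n) set \<Rightarrow> bool" where
  "irreducible_set X \<longleftrightarrow> algebraic_set X \<and> X \<noteq> {} \<and>
     (\<forall>Y Z. algebraic_set Y \<and> algebraic_set Z \<and> X = Y \<union> Z \<longrightarrow> X = Y \<or> X = Z)"

text \<open>Krull dimension: supremum of the lengths of chains of irreducible algebraic subsets.\<close>

definition alg_dim :: "(complex ^ 'n) set \<Rightarrow> enat" where
  "alg_dim X = Sup {enat d | d. \<exists>Z :: nat \<Rightarrow> (complex ^ 'n) set.
     (\<forall>i\<le>d. irreducible_set (Z i) \<and> Z i \<subseteq> X) \<and> (\<forall>i<d. Z i \<subset> Z (Suc i))}"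

definition irreducible_curve :: "(complex ^ 'n) set \<Rightarrow> bool" where
  "irreducible_curve X \<longleftrightarrow> irreducible_set X \<and> alg_dim X = 1"

definition algebraic_curve :: "(complex ^ 'n) set \<Rightarrow> bool" where
  "algebraic_curve X \<longleftrightarrow>
     (\<exists>\<A>. finite \<A> \<and> \<A> \<noteq> {} \<and> (\<forall>A\<in>\<A>. irreducible_curve A) \<and> X = \<Union>\<A>)"

definition hyperplane :: "complex ^ 'n \<Rightarrow> complex \<Rightarrow> (complex ^ 'n) set" where
  "hyperplane \<alpha> \<beta> = {x. (\<Sum>i\<in>UNIV. \<alpha> $ i * x $ i) = \<beta>}"

text \<open>
  The degree of a curve is the largest number of points in which a hyperplane meets it when
  this number is finite (the number attained by a generic hyperplane).
\<close>

definition has_degree :: "(complex ^ 'n) set \<Rightarrow> nat \<Rightarrow> bool" where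
  "has_degree X d \<longleftrightarrow>
     (\<exists>\<alpha> \<beta>. \<alpha> \<noteq> 0 \<and> finite (X \<inter> hyperplane \<alpha> \<beta>) \<and> card (X \<inter> hyperplane \<alpha> \<beta>) = d) \<and>
     (\<forall>\<alpha> \<beta>. \<alpha> \<noteq> 0 \<and> finite (X \<inter> hyperplane \<alpha> \<beta>) \<longrightarrow> card (X \<inter> hyperplane \<alpha> \<beta>) \<le> d)"

text \<open>
  The projective closure, as the set of vectors of homogeneous coordinates of its points;
  the affine point \<open>x\<close> has the coordinates \<open>x\<close> together with \<open>1\<close> at index \<^term>\<open>None\<close>.
\<close>

definition proj_closure :: "(complex ^ 'n) set \<Rightarrow> ('n option \<Rightarrow> complex) set" where
  "proj_closure X = {v. v \<noteq> (\<lambda>_. 0) \<and>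
     (\<forall>p :: (complex, 'n option) mpoly.
        homogeneous p \<and> (\<forall>x\<in>X. mpoly_eval id p (case_option 1 (\<lambda>i. x $ i)) = 0) \<longrightarrow>
        mpoly_eval id p v = 0)}"


section \<open>Infinity branches, approaching curves, asymptotes\<close>

text \<open>
  \<open>r(z) = z * \<phi>(1/z)\<close> for \<open>norm z > M\<close>, where \<open>\<phi>(t)\<close> is the convergent Puiseux series with
  coefficient \<open>c i\<close> at \<open>t powr (i/N)\<close>. Roots are principal; the other determinations of the
  root are obtained by replacing \<open>c i\<close> by \<open>c i * \<omega> ^ i\<close> with \<open>\<omega> ^ N = 1\<close>.
\<close>

definition puiseux_at_infinity ::
    "nat \<Rightarrow> (nat \<Rightarrow> complex) \<Rightarrow> real \<Rightarrow> (complex \<Rightarrow> complex) \<Rightarrow> bool" where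
  "puiseux_at_infinity N c M r \<longleftrightarrow> N \<ge> 1 \<and>
     (\<forall>z. norm z > M \<longrightarrow> (\<lambda>i. z * (c i * (inverse z powr (1 / of_nat N)) ^ i)) sums r z)"

text \<open>
  The branch \<open>{p z | z. norm z > M}\<close> is given by its parametrization by the first coordinate.
\<close>

definition infinity_branch ::
    "(complex ^ 'n::{finite,one}) set \<Rightarrow> real \<Rightarrow> (complex \<Rightarrow> complex ^ 'n::{finite,one}) \<Rightarrow> bool" where
  "infinity_branch X M p \<longleftrightarrow> M > 0 \<and>
     (\<forall>z. norm z > M \<longrightarrow> p z $ 1 = z \<and> p z \<in> X) \<and>
     (\<forall>i. \<exists>N c. puiseux_at_infinity N c M (\<lambda>z. p z $ i))"

definition approaches_at ::
    "(complex ^ 'n::{finite,one}) set \<Rightarrow> (complex ^ 'n::{finite,one}) set \<Rightarrow> real \<Rightarrow> (complex \<Rightarrow> complex ^ 'n::{finite,one}) \<Rightarrow> bool"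
  where
  "approaches_at D X M p \<longleftrightarrow>
     infinity_branch X M p \<and> ((\<lambda>z. infdist (p z) D) \<longlongrightarrow> 0) at_infinity"

definition perfect_curve :: "(complex ^ 'n::{finite,one}) set \<Rightarrow> bool" where
  "perfect_curve X \<longleftrightarrow> algebraic_curve X \<and>
     (\<exists>d0. has_degree X d0 \<and>
        \<not> (\<exists>D d M p. algebraic_curve D \<and> has_degree D d \<and> d < d0 \<and> approaches_at D X M p))"

definition g_asymptote ::
    "(complex ^ 'n::{finite,one}) set \<Rightarrow> (complex ^ 'n::{finite,one}) set \<Rightarrow> real \<Rightarrow> (complex \<Rightarrow> complex ^ 'n::{finite,one}) \<Rightarrow> bool"
  where
  "g_asymptote Q X M p \<longleftrightarrow> perfect_curve Q \<and> approaches_at Q X M p"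


section \<open>Projection, lift function, and the expansion of \<open>F\<^sub>3\<close>\<close>

definition proj12 :: "complex ^ 3 \<Rightarrow> complex ^ 2" where
  "proj12 x = vector [x $ 1, x $ 2]"

definition lift_function ::
    "(complex, 2) mpoly \<Rightarrow> (complex, 2) mpoly \<Rightarrow> complex ^ 2 \<Rightarrow> complex" where
  "lift_function h1 h2 u = ceval h1 u / ceval h2 u"

definition birational_projection ::
    "(complex ^ 3) set \<Rightarrow> (complex ^ 2) set \<Rightarrow> (complex, 2) mpoly \<Rightarrow> (complex, 2) mpoly \<Rightarrow> bool" where
  "birational_projection C Cp h1 h2 \<longleftrightarrow>
     zariski_closure (proj12 ` C) = Cp \<and>
     (\<exists>u\<in>Cp. ceval h2 u \<noteq> 0) \<and>
     finite (sym_diff C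
       {x. proj12 x \<in> Cp \<and> ceval h2 (proj12 x) \<noteq> 0 \<and> x $ 3 = lift_function h1 h2 (proj12 x)})"

definition emb23 :: "2 \<Rightarrow> 3" where
  "emb23 i = (if i = 1 then 1 else 2)"

definition f3_poly :: "(complex, 2) mpoly \<Rightarrow> (complex, 2) mpoly \<Rightarrow> (complex, 3) mpoly" where
  "f3_poly h1 h2 = mvar 3 * mpoly_rename emb23 h2 - mpoly_rename emb23 h1"

text \<open>
  \<open>F(t\<^sup>n\<^sup>+\<^sup>k, a\<^sub>0 t\<^sup>n\<^sup>+\<^sup>k + \<dots> + a\<^sub>n\<^sub>+\<^sub>k, t\<^sup>n (b\<^sub>0 t\<^sup>k + \<dots> + b\<^sub>k), t\<^sup>n)\<close> as a polynomial in \<open>t\<close>.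
\<close>

definition F_subst ::
    "(complex, 3 option) mpoly \<Rightarrow> nat \<Rightarrow> nat \<Rightarrow> (nat \<Rightarrow> complex) \<Rightarrow> (nat \<Rightarrow> complex) \<Rightarrow> complex poly"
  where
  "F_subst F k n a b =
     mpoly_eval (\<lambda>c. [:c:]) F
       (case_option (monom 1 n)
          (\<lambda>i. (vector
             [monom 1 (n + k),
              \<Sum>i\<le>n + k. monom (a i) (n + k - i),
              monom 1 n * (\<Sum>i\<le>k. monom (b i) (k - i))] :: complex poly ^ 3) $ i))"

definition Lambda ::
    "((nat \<Rightarrow> complex) \<Rightarrow> complex) \<Rightarrow> (nat \<Rightarrow> (nat \<Rightarrow> complex) \<Rightarrow> (nat \<Rightarrow> complex) \<Rightarrow> complex)
     \<Rightarrow> nat \<Rightarrow> (nat \<Rightarrow> complex) \<Rightarrow> (nat \<Rightarrow> complex) \<Rightarrow> complex" where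
  "Lambda \<rho> \<rho>s j a b = b j * \<rho> a - \<rho>s j a b"

text \<open>
  The first two quantified clauses say that \<open>\<rho>\<close> depends only on \<open>a\<^sub>0, \<dots>, a\<^sub>r\<close> and that \<open>\<rho>s j\<close>
  depends only on \<open>a\<^sub>0, \<dots>, a\<^sub>r\<^sub>+\<^sub>j, b\<^sub>0, \<dots>, b\<^sub>j\<^sub>-\<^sub>1\<close>. The last one is the expansion
  \<open>\<Sum>j. \<Lambda>\<^sub>j t\<^sup>\<mu>\<^sup>-\<^sup>j\<close> with \<open>b\<close> undetermined. It is required with every \<open>a'\<close> that agrees
  with \<open>a\<close> on the indices \<open>0, \<dots>, r\<close>: the exponent \<open>\<mu>\<close> and the leading quantity \<open>\<rho>\<close> are determined
  by \<open>a\<^sub>0, \<dots>, a\<^sub>r\<close>, and the other \<open>a\<^sub>i\<close> enter only through the \<open>\<Lambda>\<^sub>j\<close>. (Without this, terms with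
  exponent above \<open>\<mu>\<close> could cancel accidentally for the truncated series.)
\<close>

definition Lambda_expansion ::
    "(complex, 3 option) mpoly \<Rightarrow> nat \<Rightarrow> (nat \<Rightarrow> complex) \<Rightarrow> nat \<Rightarrow> nat \<Rightarrow> nat
     \<Rightarrow> ((nat \<Rightarrow> complex) \<Rightarrow> complex) \<Rightarrow> (nat \<Rightarrow> (nat \<Rightarrow> complex) \<Rightarrow> (nat \<Rightarrow> complex) \<Rightarrow> complex)
     \<Rightarrow> bool" where
  "Lambda_expansion F k a n \<mu> r \<rho> \<rho>s \<longleftrightarrow>
     k \<le> \<mu> \<and> r \<le> n \<and> \<rho> a \<noteq> 0 \<and>
     (\<forall>a' a''. (\<forall>i\<le>r. a' i = a'' i) \<longrightarrow> \<rho> a' = \<rho> a'') \<and>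
     (\<forall>j\<le>k. \<forall>a' a'' b b'. (\<forall>i\<le>r + j. a' i = a'' i) \<and> (\<forall>i<j. b i = b' i) \<longrightarrow>
        \<rho>s j a' b = \<rho>s j a'' b') \<and>
     (\<forall>a' b. (\<forall>i\<le>r. a' i = a i) \<longrightarrow>
        Polynomial.degree (F_subst F k n a' b) \<le> \<mu> \<and>
        (\<forall>j\<le>k. Polynomial.coeff (F_subst F k n a' b) (\<mu> - j) = Lambda \<rho> \<rho>s j a' b))"

end

theory Submission
  imports
    Defs
    "HOL-Computational_Algebra.Fundamental_Theorem_Algebra"
    "HOL-Complex_Analysis.Complex_Singularities"
    "HOL-Complex_Analysis.Great_Picard"
begin

text \<open>
  The asymptotics of the lift function come from comparing the expansion of \<open>F\<^sub>3\<close> at \<open>b\<close> with the one at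
  \<open>b\<close> with \<open>b\<^sub>k\<close> increased by 1: the difference isolates \<open>h\<^sub>2\<close>, whose leading coefficient along the branch
  is the nonzero \<open>\<rho>\<close>, while \<open>\<Lambda>\<^sub>0 = \<dots> = \<Lambda>\<^sub>k = 0\<close> makes the expansion at \<open>b\<close> of lower order. Hence
  \<open>r\<^sub>3 - q\<^sub>3\<close> tends to 0, and \<open>r\<^sub>3\<close> is a Puiseux series since its singularity in \<open>z powr (-1/k)\<close> is removable.

  For perfectness, let \<open>e\<close> be the number of distinct conjugates \<open>\<psi> (w u)\<close>, \<open>w ^ e = 1\<close>, of a parametrization
  \<open>\<psi> u = (u ^ e, s\<^sub>2 u, s\<^sub>3 u)\<close>; the degree of the curve is at most \<open>e\<close>. If a curve approaches it, then some
  component \<open>A\<close> comes close to points \<open>\<psi> u\<close> with \<open>u\<close> tending to infinity. A polynomial \<open>G\<close> that vanishes on a generic plane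
  projection of \<open>A\<close> then has, by Hurwitz's theorem, a root near each conjugate, so it has \<open>e\<close> distinct roots
  over almost every large first coordinate. These roots lift to \<open>A\<close>, because \<open>A\<close> has dimension 1, and
  a plane section with at least \<open>e\<close> points results.
\<close>

section \<open>Polynomial functions and algebraic sets\<close>

text \<open>The branch is an infinite series, while the expansion substitutes a truncation of it.
  The discarded tail amounts to a quantity tending to 0 that is added to the last coefficient
  \<open>a (n + k)\<close>. Since r \<le> n < n + k, the expansion remains valid for the modified
  coefficients and is then exact along the branch. Among \<Lambda>_0, ..., \<Lambda>_k only the last
  can depend on that coefficient, and it does so continuously.

  A curve approaching \<open>Q\<close> is studied through a sequence of its points, not through its
  own branches. Such a sequence follows one conjugate only. The remedy is that the existence of
  nearby roots hinges on one leading coefficient vanishing at 0, a condition that does not mention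
  the direction in which the parameter grows; hence it serves all rotated parameters at once.

  The number \<open>e\<close> need not be \<open>k\<close>: the given parametrization may trace
  \<open>Q\<close> several times, so \<open>k\<close> is divided by its common divisor with all
  exponents that occur. Perfectness then follows from two inequalities: degree of \<open>Q\<close>
  at most \<open>e\<close>, and a plane section of the approaching curve, finite on every component,
  with at least \<open>e\<close> points.\<close>

lemma mpoly_eval_superset:
  fixes \<kappa> :: "'a::zero \<Rightarrow> 'b::comm_semiring_1"
  assumes "\<kappa> 0 = 0" "finite S" "Poly_Mapping.keys p \<subseteq> S"
  shows "mpoly_eval \<kappa> p x =
    (\<Sum>m\<in>S. \<kappa> (Poly_Mapping.lookup p m) * (\<Prod>i\<in>UNIV. x i ^ Poly_Mapping.lookup m i))"
  unfolding mpoly_eval_def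
  by (rule sum.mono_neutral_left) (use assms in \<open>auto simp: in_keys_iff\<close>)

lemma poly_mapping_sum_single:
  "p = (\<Sum>m\<in>Poly_Mapping.keys p. Poly_Mapping.single m (Poly_Mapping.lookup p m))"
  by (rule poly_mapping_eqI)
     (auto simp: lookup_sum lookup_single when_def in_keys_iff sum.delta')

text \<open>Covers the coefficient maps \<open>id\<close> and \<open>\<lambda>c. [:c:]\<close>, and
  also evaluation of a univariate polynomial at a point, which is composed with the latter in
  \<open>poly_F_subst\<close>.\<close>

locale coeff_hom =
  fixes \<kappa> :: "'a::comm_ring_1 \<Rightarrow> 'b::comm_ring_1"
  assumes hom_zero: "\<kappa> 0 = 0" and hom_one: "\<kappa> 1 = 1"
    and hom_add: "\<kappa> (a + b) = \<kappa> a + \<kappa> b" and hom_mult: "\<kappa> (a * b) = \<kappa> a * \<kappa> b"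
begin

lemma eval_single:
  "mpoly_eval \<kappa> (Poly_Mapping.single m c) x = \<kappa> c * (\<Prod>i\<in>UNIV. x i ^ Poly_Mapping.lookup m i)"
  by (subst mpoly_eval_superset[of _ "{m}"]) (auto simp: hom_zero)

lemma eval_add: "mpoly_eval \<kappa> (p + q) x = mpoly_eval \<kappa> p x + mpoly_eval \<kappa> q x"
proof -
  let ?S = "Poly_Mapping.keys p \<union> Poly_Mapping.keys q"
  have "Poly_Mapping.keys (p + q) \<subseteq> ?S" by (rule keys_add)
  then show ?thesis
    by (subst (1 2 3) mpoly_eval_superset[of _ ?S])
       (auto simp: hom_zero lookup_add hom_add ring_distribs sum.distrib)
qed

lemma eval_zero: "mpoly_eval \<kappa> 0 x = 0"
  by (simp add: mpoly_eval_def)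

lemma eval_diff: "mpoly_eval \<kappa> (p - q) x = mpoly_eval \<kappa> p x - mpoly_eval \<kappa> q x"
  by (metis add_diff_cancel_right' diff_add_cancel eval_add)

lemma eval_sum: "mpoly_eval \<kappa> (sum f A) x = (\<Sum>a\<in>A. mpoly_eval \<kappa> (f a) x)"
  by (induction A rule: infinite_finite_induct) (auto simp: eval_zero eval_add)

lemma eval_single_mult_single:
  "mpoly_eval \<kappa> (Poly_Mapping.single m c * Poly_Mapping.single m' c') x =
   mpoly_eval \<kappa> (Poly_Mapping.single m c) x * mpoly_eval \<kappa> (Poly_Mapping.single m' c') x"
  by (simp add: mult_single eval_single hom_mult lookup_add power_add prod.distrib mult_ac)

lemma eval_mult: "mpoly_eval \<kappa> (p * q) x = mpoly_eval \<kappa> p x * mpoly_eval \<kappa> q x"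
proof -
  let ?s = "\<lambda>p m. Poly_Mapping.single m (Poly_Mapping.lookup p m)"
  have "p * q = (\<Sum>m\<in>Poly_Mapping.keys p. ?s p m) * (\<Sum>m\<in>Poly_Mapping.keys q. ?s q m)"
    using poly_mapping_sum_single[of p] poly_mapping_sum_single[of q] by simp
  also have "mpoly_eval \<kappa> \<dots> x =
      mpoly_eval \<kappa> (\<Sum>m\<in>Poly_Mapping.keys p. ?s p m) x * mpoly_eval \<kappa> (\<Sum>m\<in>Poly_Mapping.keys q. ?s q m) x"
    by (simp only: sum_product eval_sum eval_single_mult_single)
  finally show ?thesis
    using poly_mapping_sum_single[of p] poly_mapping_sum_single[of q] by simp
qed

lemma eval_mono_hom:
  assumes "coeff_hom \<psi>"
  shows "\<psi> (mpoly_eval \<kappa> p x) = mpoly_eval (\<lambda>c. \<psi> (\<kappa> c)) p (\<lambda>i. \<psi> (x i))"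
proof -
  interpret h: coeff_hom \<psi> by fact
  have s: "\<psi> (sum f A) = (\<Sum>a\<in>A. \<psi> (f a))" for f :: "_ \<Rightarrow> 'b" and A :: "_ set"
    by (induction A rule: infinite_finite_induct) (auto simp: h.hom_zero h.hom_add)
  have p: "\<psi> (prod f A) = (\<Prod>a\<in>A. \<psi> (f a))" for f :: "_ \<Rightarrow> 'b" and A :: "_ set"
    by (induction A rule: infinite_finite_induct) (auto simp: h.hom_one h.hom_mult)
  have e: "\<psi> (y ^ n) = \<psi> y ^ n" for y n
    by (induction n) (auto simp: h.hom_one h.hom_mult)
  show ?thesis
    unfolding mpoly_eval_def by (simp add: s p e h.hom_mult)
qed

end

interpretation id_hom: coeff_hom "id :: 'a::comm_ring_1 \<Rightarrow> 'a"
  by unfold_locales auto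

text \<open>Working with functions instead of coefficient maps gives an induction principle and
  closure rules; \<open>polyfun_iff\<close> returns to \<open>ceval\<close>.\<close>

inductive polyfun :: "(complex ^ 'n::finite \<Rightarrow> complex) \<Rightarrow> bool" where
  polyfun_const: "polyfun (\<lambda>_. c)"
| polyfun_coord: "polyfun (\<lambda>x. x $ i)"
| polyfun_add: "polyfun f \<Longrightarrow> polyfun g \<Longrightarrow> polyfun (\<lambda>x. f x + g x)"
| polyfun_mult: "polyfun f \<Longrightarrow> polyfun g \<Longrightarrow> polyfun (\<lambda>x. f x * g x)"

lemma polyfun_power: "polyfun f \<Longrightarrow> polyfun (\<lambda>x. f x ^ n)"
  by (induction n) (auto intro: polyfun.intros)

lemma polyfun_sum: "(\<And>a. a \<in> A \<Longrightarrow> polyfun (f a)) \<Longrightarrow> polyfun (\<lambda>x. \<Sum>a\<in>A. f a x)"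
  by (induction A rule: infinite_finite_induct) (auto intro: polyfun.intros)

lemma polyfun_prod: "(\<And>a. a \<in> A \<Longrightarrow> polyfun (f a)) \<Longrightarrow> polyfun (\<lambda>x. \<Prod>a\<in>A. f a x)"
  by (induction A rule: infinite_finite_induct) (auto intro: polyfun.intros)

lemma polyfun_diff: "polyfun f \<Longrightarrow> polyfun g \<Longrightarrow> polyfun (\<lambda>x. f x - g x)"
  using polyfun_add[of f "\<lambda>x. -1 * g x"] polyfun_mult[OF polyfun_const[of "-1"], of g] by simp

lemma polyfun_ceval: "polyfun (ceval p)"
  unfolding mpoly_eval_def
  by (intro polyfun_sum polyfun_mult polyfun_prod polyfun_power polyfun_coord polyfun_const)

lemma eval_mvar: "mpoly_eval id (mvar i) x = x i"
  by (simp add: mvar_def id_hom.eval_single lookup_single when_def if_distrib prod.delta' cong: if_cong)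

lemma polyfun_imp_ceval: "polyfun f \<Longrightarrow> \<exists>p. f = ceval p"
proof (induction rule: polyfun.induct)
  case (polyfun_const c)
  show ?case
    by (rule exI[of _ "Poly_Mapping.single 0 c"]) (rule ext, subst id_hom.eval_single, simp)
next
  case (polyfun_coord i)
  show ?case by (rule exI[of _ "mvar i"]) (rule ext, subst eval_mvar, simp)
next
  case (polyfun_add f g)
  then obtain p q where "f = ceval p" "g = ceval q" by blast
  then show ?case by (intro exI[of _ "p + q"]) (rule ext, subst id_hom.eval_add, simp)
next
  case (polyfun_mult f g)
  then obtain p q where "f = ceval p" "g = ceval q" by blast
  then show ?case by (intro exI[of _ "p * q"]) (rule ext, subst id_hom.eval_mult, simp)
qed

lemma polyfun_iff: "polyfun f \<longleftrightarrow> (\<exists>p. f = ceval p)"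
  using polyfun_ceval polyfun_imp_ceval by blast

lemma zariski_closure_polyfun:
  "zariski_closure X = {x. \<forall>f. polyfun f \<and> (\<forall>y\<in>X. f y = 0) \<longrightarrow> f x = 0}"
  unfolding zariski_closure_def polyfun_iff by auto

lemma algebraic_set_closed:
  assumes "algebraic_set X" "\<And>f. polyfun f \<Longrightarrow> (\<forall>y\<in>X. f y = 0) \<Longrightarrow> f x = 0"
  shows "x \<in> X"
  using assms polyfun_ceval unfolding algebraic_set_def by blast

lemma algebraic_setI:
  assumes "X = {x. \<forall>f\<in>F. f x = 0}" "\<And>f. f \<in> F \<Longrightarrow> polyfun f"
  shows "algebraic_set X"
  unfolding algebraic_set_def
proof (rule exI[of _ "{p. ceval p \<in> F}"])
  have "(\<forall>f\<in>F. f x = 0) \<longleftrightarrow> (\<forall>p\<in>{p. ceval p \<in> F}. ceval p x = 0)" for x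
    using polyfun_imp_ceval[OF assms(2)] by fastforce
  then show "X = {x. \<forall>p\<in>{p. ceval p \<in> F}. ceval p x = 0}" using assms(1) by simp
qed

lemma zariski_closure_algebraic: "algebraic_set (zariski_closure X)"
  unfolding zariski_closure_polyfun
  by (rule algebraic_setI[where F = "{f. polyfun f \<and> (\<forall>y\<in>X. f y = 0)}"]) auto

lemma zariski_closure_subset: "X \<subseteq> zariski_closure X"
  unfolding zariski_closure_def by auto

lemma algebraic_set_singleton: "algebraic_set {a :: complex ^ 'n::finite}"
proof (rule algebraic_setI[where F = "range (\<lambda>i x. x $ i - a $ i)"])
  show "{a} = {x. \<forall>f\<in>range (\<lambda>i x. x $ i - a $ i). f x = 0}"
    by (auto simp: vec_eq_iff)
qed (auto intro: polyfun_diff polyfun_coord polyfun_const)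

lemma algebraic_set_Un:
  assumes "algebraic_set X" "algebraic_set Y"
  shows "algebraic_set (X \<union> Y)"
proof (rule algebraic_setI[where F = "{\<lambda>x. f x * g x | f g. polyfun f \<and> polyfun g \<and>
    (\<forall>y\<in>X. f y = 0) \<and> (\<forall>y\<in>Y. g y = 0)}"])
  show "X \<union> Y = {x. \<forall>f\<in>{\<lambda>x. f x * g x | f g. polyfun f \<and> polyfun g \<and>
    (\<forall>y\<in>X. f y = 0) \<and> (\<forall>y\<in>Y. g y = 0)}. f x = 0}" (is "_ = ?R")
  proof (intro equalityI subsetI)
    fix x assume x: "x \<in> ?R"
    show "x \<in> X \<union> Y"
    proof (rule ccontr)
      assume "x \<notin> X \<union> Y"
      then have "x \<notin> X" "x \<notin> Y" by auto
      then obtain f g where f: "polyfun f" "\<forall>y\<in>X. f y = 0" "f x \<noteq> 0"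
        and g: "polyfun g" "\<forall>y\<in>Y. g y = 0" "g x \<noteq> 0"
        using algebraic_set_closed[OF assms(1)] algebraic_set_closed[OF assms(2)] by metis
      have "(\<lambda>x. f x * g x) \<in> {\<lambda>x. f x * g x | f g. polyfun f \<and> polyfun g \<and>
          (\<forall>y\<in>X. f y = 0) \<and> (\<forall>y\<in>Y. g y = 0)}"
        using f g by blast
      with x have "f x * g x = 0" by fastforce
      with \<open>f x \<noteq> 0\<close> \<open>g x \<noteq> 0\<close> show False by simp
    qed
  qed auto
qed (auto intro: polyfun_mult)

lemma algebraic_set_empty: "algebraic_set {}"
  by (rule algebraic_setI[where F = "{\<lambda>_. 1}"]) (auto intro: polyfun_const)

lemma algebraic_set_finite: "finite X \<Longrightarrow> algebraic_set (X :: (complex ^ 'n::finite) set)"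
proof (induction X rule: finite_induct)
  case (insert x F)
  then show ?case using algebraic_set_Un[OF algebraic_set_singleton[of x]] by simp
qed (rule algebraic_set_empty)

lemma algebraic_set_zeros:
  assumes "algebraic_set X" "polyfun f"
  shows "algebraic_set {x \<in> X. f x = 0}"
proof -
  obtain S where S: "X = {x. \<forall>p\<in>S. ceval p x = 0}"
    using assms(1) unfolding algebraic_set_def by blast
  show ?thesis
    by (rule algebraic_setI[where F = "insert f (ceval ` S)"])
       (use assms(2) polyfun_ceval in \<open>auto simp: S\<close>)
qed

lemma irreducible_set_UnD:
  "irreducible_set X \<Longrightarrow> algebraic_set Y \<Longrightarrow> algebraic_set Z \<Longrightarrow> X = Y \<union> Z \<Longrightarrow> X = Y \<or> X = Z"
  unfolding irreducible_set_def by simp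

lemma irreducible_set_prime:
  assumes "irreducible_set X" "polyfun f" "polyfun g" "\<forall>x\<in>X. f x * g x = 0"
  shows "(\<forall>x\<in>X. f x = 0) \<or> (\<forall>x\<in>X. g x = 0)"
proof -
  have "X = {x \<in> X. f x = 0} \<union> {x \<in> X. g x = 0}" using assms(4) by auto
  moreover have "algebraic_set X" using assms(1) by (simp add: irreducible_set_def)
  ultimately have "X = {x \<in> X. f x = 0} \<or> X = {x \<in> X. g x = 0}"
    by (intro irreducible_set_UnD[OF assms(1)] algebraic_set_zeros assms(2,3))
  then show ?thesis by blast
qed

lemma finite_irreducible_set_singleton:
  assumes "irreducible_set X" "finite X"
  shows "\<exists>a. X = {a}"
proof -
  obtain a where a: "a \<in> X" using assms by (auto simp: irreducible_set_def)
  have "X = {a} \<union> (X - {a})" using a by auto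
  moreover have "algebraic_set {a}" "algebraic_set (X - {a})"
    using assms by (auto intro: algebraic_set_finite)
  ultimately have "X = {a} \<or> X = X - {a}" by (intro irreducible_set_UnD[OF assms(1)])
  then show ?thesis using a by auto
qed

lemma irreducible_set_singleton: "irreducible_set {a :: complex ^ 'n::finite}"
  unfolding irreducible_set_def
proof (intro conjI allI impI)
  fix Y Z assume "algebraic_set Y \<and> algebraic_set Z \<and> {a} = Y \<union> Z"
  then have "Y \<union> Z = {a}" by simp
  then show "{a} = Y \<or> {a} = Z" using Un_singleton_iff[of Y Z a] by auto
qed (auto simp: algebraic_set_singleton)

section \<open>The ascending chain condition for ideals\<close>

definition ideal_set :: "'r::comm_ring_1 set \<Rightarrow> bool" where
  "ideal_set I \<longleftrightarrow> 0 \<in> I \<and> (\<forall>a\<in>I. \<forall>b\<in>I. a + b \<in> I) \<and> (\<forall>r. \<forall>a\<in>I. r * a \<in> I)"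

text \<open>The Noetherian property as a statement about a type, so that it can be passed from a
  ring to its polynomial ring repeatedly.\<close>

definition ideals_acc :: "'r::comm_ring_1 itself \<Rightarrow> bool" where
  "ideals_acc _ \<longleftrightarrow> (\<forall>I :: nat \<Rightarrow> 'r set.
     (\<forall>n. ideal_set (I n)) \<and> (\<forall>n. I n \<subseteq> I (Suc n)) \<longrightarrow> (\<exists>N. \<forall>n\<ge>N. I n = I N))"

lemma ideal_set_field:
  fixes I :: "'r::field set"
  assumes "ideal_set I" "a \<in> I" "a \<noteq> 0"
  shows "I = UNIV"
proof -
  have "b \<in> I" for b
    using assms(1)[unfolded ideal_set_def, THEN conjunct2, THEN conjunct2, rule_format, OF assms(2), of "b / a"]
      assms(3) by simp
  then show ?thesis by auto
qed

lemma ideals_acc_field: "ideals_acc TYPE('r::field)"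
  unfolding ideals_acc_def
proof (intro allI impI, elim conjE)
  fix I :: "nat \<Rightarrow> 'r set"
  assume I: "\<forall>n. ideal_set (I n)" "\<forall>n. I n \<subseteq> I (Suc n)"
  have mono: "m \<le> n \<Longrightarrow> I m \<subseteq> I n" for m n using I(2) by (simp add: lift_Suc_mono_le)
  show "\<exists>N. \<forall>n\<ge>N. I n = I N"
  proof (cases "\<exists>N a. a \<in> I N \<and> a \<noteq> 0")
    case True
    then obtain N a where "a \<in> I N" "a \<noteq> 0" by blast
    then have "I n = UNIV" if "n \<ge> N" for n
      using ideal_set_field I(1) mono[OF that] by blast
    then show ?thesis by blast
  next
    case False
    then have "I n = {0}" for n using I(1) unfolding ideal_set_def by blast
    then show ?thesis by blast
  qed
qed

text \<open>Admitting all degrees up to \<open>d\<close>, not only \<open>d\<close> itself, makes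
  this set an ideal and makes it increase with \<open>d\<close>.\<close>

definition lead_ideal :: "'r::comm_ring_1 poly set \<Rightarrow> nat \<Rightarrow> 'r set" where
  "lead_ideal I d = {Polynomial.coeff f d | f. f \<in> I \<and> Polynomial.degree f \<le> d}"

lemma ideal_set_lead_ideal:
  assumes "ideal_set I" shows "ideal_set (lead_ideal I d)"
  unfolding ideal_set_def
proof (intro conjI ballI allI)
  show "0 \<in> lead_ideal I d"
    unfolding lead_ideal_def using assms by (auto simp: ideal_set_def intro!: exI[of _ 0])
next
  fix a b assume "a \<in> lead_ideal I d" "b \<in> lead_ideal I d"
  then obtain f g where "f \<in> I" "g \<in> I" "Polynomial.degree f \<le> d" "Polynomial.degree g \<le> d"
    "a = Polynomial.coeff f d" "b = Polynomial.coeff g d" by (auto simp: lead_ideal_def)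
  then show "a + b \<in> lead_ideal I d"
    unfolding lead_ideal_def using assms
    by (auto simp: ideal_set_def degree_add_le intro!: exI[of _ "f + g"])
next
  fix r a assume "a \<in> lead_ideal I d"
  then obtain f where "f \<in> I" "Polynomial.degree f \<le> d" "a = Polynomial.coeff f d"
    by (auto simp: lead_ideal_def)
  then show "r * a \<in> lead_ideal I d"
    unfolding lead_ideal_def using assms degree_smult_le[of r f]
    by (auto simp: ideal_set_def intro!: exI[of _ "[:r:] * f"])
qed

lemma lead_ideal_mono: "I \<subseteq> J \<Longrightarrow> lead_ideal I d \<subseteq> lead_ideal J d"
  unfolding lead_ideal_def by blast

lemma lead_ideal_mono_degree:
  assumes "ideal_set I" "d \<le> e" shows "lead_ideal I d \<subseteq> lead_ideal I e"
proof
  fix c assume "c \<in> lead_ideal I d"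
  then obtain f where f: "f \<in> I" "Polynomial.degree f \<le> d" "c = Polynomial.coeff f d"
    by (auto simp: lead_ideal_def)
  let ?g = "monom 1 (e - d) * f"
  have "?g \<in> I" using f(1) assms(1) by (auto simp: ideal_set_def)
  moreover have "Polynomial.degree ?g \<le> e"
    using degree_mult_le[of "monom 1 (e - d)" f] degree_monom_le[of "1::'a" "e - d"] f(2) assms(2)
    by linarith
  moreover have "Polynomial.coeff ?g e = c"
    using assms(2) f(3) by (simp add: coeff_monom_mult)
  ultimately show "c \<in> lead_ideal I e" unfolding lead_ideal_def by blast
qed

lemma ideal_set_diff:
  assumes "ideal_set I" "a \<in> I" "b \<in> I" shows "a - b \<in> I"
proof -
  have "a + (-1) * b \<in> I" using assms unfolding ideal_set_def by blast
  then show ?thesis by simp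
qed

text \<open>Induction on the degree: an element of \<open>J\<close> is reduced by an element of
  \<open>I\<close> with the same coefficient at the top degree, and the difference has lower
  degree.\<close>

lemma ideal_eqI_lead_ideal:
  assumes "ideal_set I" "ideal_set J" "I \<subseteq> J" "\<And>d. lead_ideal I d = lead_ideal J d"
  shows "I = J"
proof -
  have "\<forall>f\<in>J. Polynomial.degree f < n \<longrightarrow> f \<in> I" for n
  proof (induction n)
    case (Suc n)
    show ?case
    proof (intro ballI impI)
      fix f assume f: "f \<in> J" "Polynomial.degree f < Suc n"
      then have "Polynomial.coeff f n \<in> lead_ideal J n" unfolding lead_ideal_def by auto
      then obtain g where g: "g \<in> I" "Polynomial.degree g \<le> n"
        "Polynomial.coeff g n = Polynomial.coeff f n"
        unfolding assms(4)[symmetric] by (auto simp: lead_ideal_def)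
      let ?h = "f - g"
      have hJ: "?h \<in> J" using f g assms ideal_set_diff by blast
      have "Polynomial.degree ?h \<le> n" using f g by (intro degree_diff_le) auto
      moreover have "Polynomial.coeff ?h n = 0" using g by simp
      ultimately have "?h = 0 \<or> Polynomial.degree ?h < n"
        by (metis le_neq_implies_less leading_coeff_0_iff)
      then have "?h \<in> I" using Suc hJ assms(1) by (auto simp: ideal_set_def)
      then have "?h + g \<in> I" using g assms(1) unfolding ideal_set_def by blast
      then show "f \<in> I" by simp
    qed
  qed simp
  then show ?thesis using assms(3) by blast
qed

text \<open>Hilbert's basis theorem in chain form. Stationarity of every
  \<open>lead_ideal (I n) d\<close> must be reached at an index independent of
  \<open>d\<close>.\<close>

lemma ideals_acc_poly:
  assumes "ideals_acc TYPE('r::comm_ring_1)"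
  shows "ideals_acc TYPE('r poly)"
  unfolding ideals_acc_def
proof (intro allI impI, elim conjE)
  fix I :: "nat \<Rightarrow> 'r poly set"
  assume I: "\<forall>n. ideal_set (I n)" "\<forall>n. I n \<subseteq> I (Suc n)"
  have mono: "m \<le> n \<Longrightarrow> I m \<subseteq> I n" for m n using I(2) by (simp add: lift_Suc_mono_le)
  have L: "lead_ideal (I i) d \<subseteq> lead_ideal (I j) e" if "i \<le> j" "d \<le> e" for i j d e
    using lead_ideal_mono[OF mono[OF that(1)]] lead_ideal_mono_degree[OF _ that(2)] I(1) by blast
  have acc: "\<exists>N. \<forall>n\<ge>N. K n = K N"
    if "\<And>n. ideal_set (K n)" "\<And>n. K n \<subseteq> K (Suc n)" for K :: "nat \<Rightarrow> 'r set"
    using assms that unfolding ideals_acc_def by blast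
  \<comment> \<open>The diagonal chain settles all degrees d \<ge> N at once; only the finitely many
    smaller degrees need their own indices \<open>S d\<close>.\<close>
  obtain N where N: "\<And>n. n \<ge> N \<Longrightarrow> lead_ideal (I n) n = lead_ideal (I N) N"
    using acc[of "\<lambda>n. lead_ideal (I n) n"] I(1) L[OF le_SucI[OF le_refl] le_SucI[OF le_refl]]
      ideal_set_lead_ideal by blast
  have "\<exists>N. \<forall>n\<ge>N. lead_ideal (I n) d = lead_ideal (I N) d" for d
    using acc[of "\<lambda>n. lead_ideal (I n) d"] I(1) L[OF le_SucI[OF le_refl] le_refl]
      ideal_set_lead_ideal by blast
  then have "\<exists>S. \<forall>d. \<forall>n\<ge>S d. lead_ideal (I n) d = lead_ideal (I (S d)) d"
    by (intro choice) blast
  then obtain S where S: "\<And>d n. n \<ge> S d \<Longrightarrow> lead_ideal (I n) d = lead_ideal (I (S d)) d" by blast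
  define M where "M = Max (insert N (S ` {..<N}))"
  have MN: "M \<ge> N" and MS: "\<And>d. d < N \<Longrightarrow> M \<ge> S d" unfolding M_def by (auto intro: Max_ge)
  have big: "lead_ideal (I n) d = lead_ideal (I N) N" if "n \<ge> N" "d \<ge> N" for n d
  proof
    show "lead_ideal (I n) d \<subseteq> lead_ideal (I N) N"
      using L[of n "max n d" d "max n d"] N[of "max n d"] that by auto
    show "lead_ideal (I N) N \<subseteq> lead_ideal (I n) d" using L that by auto
  qed
  have "I M = I n" if "n \<ge> M" for n
  proof (rule ideal_eqI_lead_ideal)
    fix d
    show "lead_ideal (I M) d = lead_ideal (I n) d"
    proof (cases "d < N")
      case True
      then show ?thesis using S[of d n] S[of d M] MS[of d] that by auto
    next
      case False
      then show ?thesis using big[of n d] big[of M d] MN that by auto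
    qed
  qed (use I mono that in auto)
  then show "\<exists>N. \<forall>n\<ge>N. I n = I N" by metis
qed

section \<open>Polynomials in two and three variables as nested univariate polynomials\<close>

definition ev2 :: "complex poly poly \<Rightarrow> complex \<Rightarrow> complex \<Rightarrow> complex" where
  "ev2 g x y = poly (poly g [:y:]) x"

text \<open>The outermost polynomial variable is always the last argument: \<open>ev2 g x y\<close>
  reads \<open>g\<close> as a polynomial in \<open>y\<close> over the polynomials in
  \<open>x\<close>, and \<open>ev3\<close> adds \<open>w\<close> outside.\<close>

definition ev3 :: "complex poly poly poly \<Rightarrow> complex \<Rightarrow> complex \<Rightarrow> complex \<Rightarrow> complex" where
  "ev3 g x y w = ev2 (poly g [:[:w:]:]) x y"

lemma ev2_simps [simp]:
  "ev2 (g + h) x y = ev2 g x y + ev2 h x y" "ev2 (g * h) x y = ev2 g x y * ev2 h x y"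
  "ev2 (g - h) x y = ev2 g x y - ev2 h x y"
  "ev2 0 x y = 0" "ev2 1 x y = 1" "ev2 [:[:c:]:] x y = c"
  by (simp_all add: ev2_def)

lemma ev3_simps [simp]:
  "ev3 (g + h) x y w = ev3 g x y w + ev3 h x y w" "ev3 (g * h) x y w = ev3 g x y w * ev3 h x y w"
  "ev3 (g - h) x y w = ev3 g x y w - ev3 h x y w"
  "ev3 0 x y w = 0" "ev3 1 x y w = 1" "ev3 [:f:] x y w = ev2 f x y"
  by (simp_all add: ev3_def)

lemma ev2_const: "ev2 [:p:] x y = poly p x"
  by (simp add: ev2_def)

lemma ev2_smult: "ev2 (Polynomial.smult c g) x y = poly c x * ev2 g x y"
  by (simp add: ev2_def)

lemma ev2_pCons: "ev2 (pCons c g) x y = poly c x + y * ev2 g x y"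
  by (simp add: ev2_def)

lemma ev3_pCons: "ev3 (pCons c g) x y w = ev2 c x y + w * ev3 g x y w"
  by (simp add: ev3_def ev2_smult)

lemma polyfun_poly: "polyfun u \<Longrightarrow> polyfun (\<lambda>p. poly g (u p))"
  by (induction g) (auto intro: polyfun.intros)

lemma polyfun_ev2: "polyfun u \<Longrightarrow> polyfun v \<Longrightarrow> polyfun (\<lambda>p. ev2 g (u p) (v p))"
  by (induction g) (auto simp: ev2_pCons intro: polyfun.intros polyfun_poly)

text \<open>Stated for arbitrary coordinates \<open>u\<close>, \<open>v\<close>, \<open>w\<close>,
  because the projections used later are taken after a linear change of coordinates.\<close>

lemma polyfun_nested:
  assumes "polyfun f" "\<And>i. \<exists>g. \<forall>p. p $ i = ev3 g (u p) (v p) (w p)"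
  shows "\<exists>g. \<forall>p. f p = ev3 g (u p) (v p) (w p)"
  using assms(1)
proof (induction rule: polyfun.induct)
  case (polyfun_const c)
  show ?case by (rule exI[of _ "[:[:[:c:]:]:]"]) simp
next
  case (polyfun_coord i)
  show ?case by (rule assms(2))
next
  case (polyfun_add f h)
  then show ?case by (metis ev3_simps(1))
next
  case (polyfun_mult f h)
  then show ?case by (metis ev3_simps(2))
qed

section \<open>Irreducible subsets and dimension\<close>

lemma UNIV_3_coords:
  assumes "P 1" "P 2" "P 3" shows "P (i :: 3)"
  using exhaust_3[of i] assms by auto

text \<open>A strictly descending chain of algebraic sets would give an ascending chain of ideals
  that never becomes stationary, so a minimal infinite algebraic subset exists. It is irreducible:
  if it is a union of two algebraic sets, one of them is infinite and hence everything.\<close>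

lemma algebraic_set_minimal_infinite:
  fixes Z :: "(complex ^ 3) set"
  assumes "algebraic_set Z" "infinite Z"
  shows "\<exists>W\<subseteq>Z. irreducible_set W \<and> infinite W"
proof -
  define A where "A = {X :: (complex ^ 3) set. algebraic_set X \<and> infinite X \<and> X \<subseteq> Z}"
  let ?r = "{(Y, X). X \<in> A \<and> Y \<in> A \<and> Y \<subset> X}"
  have "wf ?r"
    unfolding wf_iff_no_infinite_down_chain
  proof
    assume "\<exists>X. \<forall>i. (X (Suc i), X i) \<in> ?r"
    then obtain X where "\<forall>i. (X (Suc i), X i) \<in> ?r" by blast
    then have X: "X i \<in> A" "X (Suc i) \<subset> X i" for i by auto
    define I where "I i = {g. \<forall>p\<in>X i. ev3 g (p $ 1) (p $ 2) (p $ 3) = 0}" for i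
    have "ideal_set (I i)" for i unfolding ideal_set_def I_def by auto
    moreover have "I i \<subseteq> I (Suc i)" for i using X(2)[of i] unfolding I_def by auto
    moreover have "ideals_acc TYPE(complex poly poly poly)"
      by (intro ideals_acc_poly ideals_acc_field)
    ultimately obtain N where N: "\<And>n. n \<ge> N \<Longrightarrow> I n = I N"
      unfolding ideals_acc_def by blast
    have "X N \<subseteq> X (Suc N)"
    proof
      fix q assume q: "q \<in> X N"
      show "q \<in> X (Suc N)"
      proof (rule algebraic_set_closed)
        show "algebraic_set (X (Suc N))" using X(1)[of "Suc N"] by (simp add: A_def)
        fix f :: "complex ^ 3 \<Rightarrow> complex" assume f: "polyfun f" "\<forall>y\<in>X (Suc N). f y = 0"
        have "\<exists>g. \<forall>p. p $ i = ev3 g (p $ 1) (p $ 2) (p $ 3)" for i :: 3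
        proof (rule UNIV_3_coords[of _ i])
          show "\<exists>g. \<forall>p. p $ 1 = ev3 g (p $ 1) (p $ 2) (p $ 3)"
            by (rule exI[of _ "[:[:[:0, 1:]:]:]"]) (simp add: ev2_const)
          show "\<exists>g. \<forall>p. p $ 2 = ev3 g (p $ 1) (p $ 2) (p $ 3)"
            by (rule exI[of _ "[:[:0, 1:]:]"]) (simp add: ev2_pCons)
          show "\<exists>g. \<forall>p. p $ 3 = ev3 g (p $ 1) (p $ 2) (p $ 3)"
            by (rule exI[of _ "[:0, 1:]"]) (simp add: ev3_pCons)
        qed
        from polyfun_nested[OF f(1) this] obtain g where
          g: "\<And>p. f p = ev3 g (p $ 1) (p $ 2) (p $ 3)" by blast
        with f(2) have "g \<in> I (Suc N)" by (simp add: I_def)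
        then have "g \<in> I N" using N[of "Suc N"] by simp
        then show "f q = 0" using q g by (simp add: I_def)
      qed
    qed
    with X(2)[of N] show False by blast
  qed
  then obtain W where W: "W \<in> A" "\<And>Y. (Y, W) \<in> ?r \<Longrightarrow> Y \<notin> A"
  proof (rule wfE_min)
    show "Z \<in> A" using assms by (simp add: A_def)
  qed blast
  have W': "Y \<notin> A" if "Y \<subset> W" for Y
  proof
    assume "Y \<in> A"
    then have "(Y, W) \<in> ?r" using W(1) that by simp
    then show False using W(2) \<open>Y \<in> A\<close> by blast
  qed
  have "irreducible_set W"
    unfolding irreducible_set_def
  proof (intro conjI allI impI)
    show "algebraic_set W" "W \<noteq> {}" using W(1) by (auto simp: A_def)
    fix Y V assume YV: "algebraic_set Y \<and> algebraic_set V \<and> W = Y \<union> V"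
    then have "infinite Y \<or> infinite V" using W(1) by (auto simp: A_def)
    then have "Y \<in> A \<or> V \<in> A" using YV W(1) by (auto simp: A_def)
    moreover have "Y \<subseteq> W" "V \<subseteq> W" using YV by auto
    ultimately show "W = Y \<or> W = V" using W' by blast
  qed
  with W(1) show ?thesis by (auto simp: A_def)
qed

text \<open>An infinite zero set would contain an infinite irreducible \<open>W\<close>, and a point
  of \<open>W\<close>, \<open>W\<close> and \<open>X\<close> would form a chain too long for
  dimension 1.\<close>

lemma irreducible_curve_zeros_finite:
  fixes X :: "(complex ^ 3) set"
  assumes "irreducible_curve X" "polyfun f" "x0 \<in> X" "f x0 \<noteq> 0"
  shows "finite {x \<in> X. f x = 0}"
proof (rule ccontr)
  assume inf: "infinite {x \<in> X. f x = 0}"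
  have X: "irreducible_set X" "alg_dim X = 1" using assms(1) by (auto simp: irreducible_curve_def)
  then have "algebraic_set {x \<in> X. f x = 0}"
    using algebraic_set_zeros assms(2) by (auto simp: irreducible_set_def)
  from algebraic_set_minimal_infinite[OF this inf] obtain W where
    W: "W \<subseteq> {x \<in> X. f x = 0}" "irreducible_set W" "infinite W" by blast
  then obtain w where w: "w \<in> W" by (auto simp: irreducible_set_def)
  define Z :: "nat \<Rightarrow> (complex ^ 3) set" where
    "Z i = (if i = 0 then {w} else if i = 1 then W else X)" for i
  have "W \<noteq> {w}" using W(3) by auto
  then have "{w} \<subset> W" using w by auto
  moreover have "W \<subset> X" using W(1) assms(3,4) by auto
  ultimately have "\<forall>i<2. Z i \<subset> Z (Suc i)" unfolding Z_def by (auto simp: less_2_cases_iff)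
  moreover have "\<forall>i\<le>2. irreducible_set (Z i) \<and> Z i \<subseteq> X"
    using W X w by (auto simp: Z_def irreducible_set_singleton)
  ultimately have "enat 2 \<le> alg_dim X"
    unfolding alg_dim_def by (intro Sup_upper) blast
  then show False using X(2) by (simp add: one_enat_def)
qed

section \<open>Lifting points along coordinate projections\<close>

lemma minimal_degree_exists:
  assumes "\<exists>f. P f" shows "\<exists>g. P g \<and> (\<forall>f. P f \<longrightarrow> Polynomial.degree (g :: 'a::zero poly) \<le> Polynomial.degree f)"
proof -
  obtain f where "P f" using assms by blast
  from ex_has_least_nat[of P f Polynomial.degree, OF this] show ?thesis by blast
qed

text \<open>\<open>'r\<close> is a ring of polynomial functions on base points \<open>'p\<close>,
  and \<open>'r poly\<close> adds one coordinate \<open>w\<close>. It is instantiated over the line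
  and over the plane, so that points are lifted one coordinate at a time.\<close>

locale point_evaluation =
  fixes \<iota> :: "complex \<Rightarrow> 'r::idom" and ev :: "'p \<Rightarrow> 'r \<Rightarrow> complex"
  assumes ev_add: "ev a (r + s) = ev a r + ev a s" and ev_mult: "ev a (r * s) = ev a r * ev a s"
    and ev_zero: "ev a 0 = 0" and ev_one: "ev a 1 = 1" and ev_const: "ev a (\<iota> c) = c"
begin

definition evx :: "'p \<Rightarrow> complex \<Rightarrow> 'r poly \<Rightarrow> complex" where
  "evx a w f = ev a (poly f (\<iota> w))"

definition vanishing :: "('p \<times> complex) set \<Rightarrow> 'r poly set" where
  "vanishing S = {f. \<forall>(a, w)\<in>S. evx a w f = 0}"

text \<open>The elimination ideal: the elements of the ideal \<open>vanishing S\<close> that are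
  constant in the new coordinate.\<close>

definition base_vanishing :: "('p \<times> complex) set \<Rightarrow> 'r set" where
  "base_vanishing S = {c. \<forall>(a, w)\<in>S. ev a c = 0}"

lemma ev_power: "ev a (r ^ n) = ev a r ^ n"
  by (induction n) (auto simp: ev_one ev_mult)

lemma evx_zero: "evx a w 0 = 0"
  by (simp add: evx_def ev_zero)

lemma evx_pCons: "evx a w (pCons c f) = ev a c + w * evx a w f"
  by (simp add: evx_def ev_add ev_mult ev_const)

lemma evx_add: "evx a w (f + g) = evx a w f + evx a w g"
  by (simp add: evx_def ev_add)

lemma evx_diff: "evx a w (f - g) = evx a w f - evx a w g"
  using evx_add[of a w "f - g" g] by simp

lemma evx_mult: "evx a w (f * g) = evx a w f * evx a w g"
  by (simp add: evx_def ev_mult)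

lemma evx_smult: "evx a w (Polynomial.smult c f) = ev a c * evx a w f"
  by (simp add: evx_def ev_mult)

lemma evx_monom: "evx a w (monom c n) = ev a c * w ^ n"
  by (simp add: evx_def poly_monom ev_mult ev_power ev_const)

lemma evx_map_poly: "evx a w f = poly (map_poly (ev a) f) w"
  by (induction f) (auto simp: evx_pCons evx_zero map_poly_pCons ev_zero)

lemma evx_eq_0:
  assumes "\<And>i. ev a (Polynomial.coeff f i) = 0" shows "evx a w f = 0"
proof -
  have "map_poly (ev a) f = 0"
    by (rule poly_eqI) (simp add: coeff_map_poly ev_zero assms)
  then show ?thesis by (simp add: evx_map_poly)
qed

lemma vanishingD: "f \<in> vanishing S \<Longrightarrow> (a, w) \<in> S \<Longrightarrow> evx a w f = 0"
  unfolding vanishing_def by fastforce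

lemma base_vanishingD: "c \<in> base_vanishing S \<Longrightarrow> (a, w) \<in> S \<Longrightarrow> ev a c = 0"
  unfolding base_vanishing_def by fastforce

lemma zero_base_vanishing: "0 \<in> base_vanishing S"
  by (auto simp: base_vanishing_def ev_zero)

text \<open>A leading term whose coefficient vanishes on the base can be removed without leaving the
  ideal, and the surviving coefficient bounds how often this happens.\<close>

lemma vanishing_strip:
  assumes "f \<in> vanishing S" "Polynomial.coeff f i \<notin> base_vanishing S"
  shows "\<exists>g\<in>vanishing S. lead_coeff g \<notin> base_vanishing S \<and> Polynomial.degree g \<le> Polynomial.degree f"
  using assms
proof (induction "Polynomial.degree f" arbitrary: f rule: less_induct)
  case less
  show ?case
  proof (cases "lead_coeff f \<in> base_vanishing S")
    case False
    then show ?thesis using less.prems by blast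
  next
    case True
    define f' where "f' = f - monom (lead_coeff f) (Polynomial.degree f)"
    have "i \<noteq> Polynomial.degree f" using True less.prems by auto
    then have i: "Polynomial.coeff f' i \<notin> base_vanishing S" using less.prems by (simp add: f'_def)
    then have "f' \<noteq> 0" using zero_base_vanishing by auto
    moreover have "Polynomial.degree f' \<le> Polynomial.degree f"
      unfolding f'_def by (intro degree_diff_le) (auto intro: degree_monom_le)
    moreover have "Polynomial.coeff f' (Polynomial.degree f) = 0" by (simp add: f'_def)
    ultimately have d: "Polynomial.degree f' < Polynomial.degree f"
      by (metis le_neq_implies_less leading_coeff_0_iff)
    have "f' \<in> vanishing S"
      using vanishingD[OF less.prems(1)] base_vanishingD[OF True]
      unfolding vanishing_def f'_def by (auto simp: evx_diff evx_monom)
    from less.hyps[OF d this i] obtain g where "g \<in> vanishing S"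
      "lead_coeff g \<notin> base_vanishing S" "Polynomial.degree g \<le> Polynomial.degree f'" by blast
    then show ?thesis using d by (intro bexI[of _ g]) auto
  qed
qed

text \<open>\<open>G\<close> has minimal degree among the members whose leading coefficient is not
  identically zero on the base. Pseudo-division by \<open>G\<close> then leaves remainders with all
  coefficients in the elimination ideal, so above a point where the leading coefficient of
  \<open>G\<close> is nonzero, a root of \<open>G\<close> is a root of the whole ideal.\<close>

lemma lift_algebraic:
  assumes "f \<in> vanishing S" "Polynomial.coeff f i \<notin> base_vanishing S"
  obtains G where "G \<in> vanishing S" "lead_coeff G \<notin> base_vanishing S" "Polynomial.degree G > 0"
    "\<And>a w h. (\<forall>c\<in>base_vanishing S. ev a c = 0) \<Longrightarrow> ev a (lead_coeff G) \<noteq> 0 \<Longrightarrow>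
      evx a w G = 0 \<Longrightarrow> h \<in> vanishing S \<Longrightarrow> evx a w h = 0"
proof -
  let ?P = "\<lambda>g. g \<in> vanishing S \<and> lead_coeff g \<notin> base_vanishing S"
  have "\<exists>g. ?P g" using vanishing_strip[OF assms] by blast
  from minimal_degree_exists[of ?P, OF this] obtain G where G: "?P G"
    and min: "\<And>g. ?P g \<Longrightarrow> Polynomial.degree G \<le> Polynomial.degree g" by blast
  have G0: "G \<noteq> 0" using G zero_base_vanishing by auto
  show ?thesis
  proof
    show "G \<in> vanishing S" "lead_coeff G \<notin> base_vanishing S" using G by auto
    show "Polynomial.degree G > 0"
    proof (rule ccontr)
      assume "\<not> Polynomial.degree G > 0"
      then obtain c where c: "G = [:c:]" by (metis degree_eq_zeroE neq0_conv)
      then have "c \<in> base_vanishing S"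
        using vanishingD[of G S] G unfolding base_vanishing_def by (auto simp: evx_pCons evx_zero)
      then show False using G c by simp
    qed
    fix a w h
    assume a: "\<forall>c\<in>base_vanishing S. ev a c = 0" "ev a (lead_coeff G) \<noteq> 0"
      "evx a w G = 0" and h: "h \<in> vanishing S"
    obtain q r where qr: "pseudo_divmod h G = (q, r)" by fastforce
    let ?c = "lead_coeff G ^ (Suc (Polynomial.degree h) - Polynomial.degree G)"
    have eq: "Polynomial.smult ?c h = G * q + r" and
      dr: "r = 0 \<or> Polynomial.degree r < Polynomial.degree G"
      using pseudo_divmod[OF G0 qr] by auto
    have r: "r = Polynomial.smult ?c h - G * q" using eq by simp
    have "r \<in> vanishing S"
      unfolding r vanishing_def using vanishingD[of h S] vanishingD[of G S] h G
      by (auto simp: evx_diff evx_smult evx_mult)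
    have "Polynomial.coeff r i \<in> base_vanishing S" for i
    proof (rule ccontr)
      assume i: "Polynomial.coeff r i \<notin> base_vanishing S"
      then have "r \<noteq> 0" using zero_base_vanishing by auto
      from vanishing_strip[OF \<open>r \<in> vanishing S\<close> i] obtain g where
        "?P g" "Polynomial.degree g \<le> Polynomial.degree r" by blast
      with min[of g] dr \<open>r \<noteq> 0\<close> show False by simp
    qed
    then have "evx a w r = 0" using a(1) by (intro evx_eq_0) auto
    then have "ev a ?c * evx a w h = 0"
      using a(3) arg_cong[OF eq, of "evx a w"] by (simp add: evx_smult evx_add evx_mult)
    then show "evx a w h = 0" using a(2) by (simp add: ev_power)
  qed
qed

text \<open>Either the new coordinate is algebraic over the base, and \<open>l\<close> is the
  leading coefficient of the minimal \<open>G\<close>, or every member of the ideal has all its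
  coefficients in the elimination ideal, any \<open>w\<close> will do, and \<open>l\<close> is
  1.\<close>

lemma lift_generic:
  assumes "S \<noteq> {}"
  obtains l where "l \<notin> base_vanishing S"
    "\<And>a. (\<forall>c\<in>base_vanishing S. ev a c = 0) \<Longrightarrow> ev a l \<noteq> 0 \<Longrightarrow>
      \<exists>w. \<forall>h\<in>vanishing S. evx a w h = 0"
proof (cases "\<exists>f\<in>vanishing S. \<exists>i. Polynomial.coeff f i \<notin> base_vanishing S")
  case True
  then obtain f i where f: "f \<in> vanishing S" "Polynomial.coeff f i \<notin> base_vanishing S" by blast
  obtain G where G: "lead_coeff G \<notin> base_vanishing S" "Polynomial.degree G > 0"
    and lift: "\<And>a w h. (\<forall>c\<in>base_vanishing S. ev a c = 0) \<Longrightarrow> ev a (lead_coeff G) \<noteq> 0 \<Longrightarrow>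
      evx a w G = 0 \<Longrightarrow> h \<in> vanishing S \<Longrightarrow> evx a w h = 0"
    by (rule lift_algebraic[OF f]) (rule that)
  show ?thesis
  proof (rule that[OF G(1)])
    fix a assume a: "\<forall>c\<in>base_vanishing S. ev a c = 0" "ev a (lead_coeff G) \<noteq> 0"
    have "Polynomial.degree (map_poly (ev a) G) = Polynomial.degree G"
      by (rule map_poly_degree_eq) (use a(2) in auto)
    then have "\<not> constant (poly (map_poly (ev a) G))"
      using G(2) by (simp add: constant_degree)
    from Fundamental_Theorem_Algebra.fundamental_theorem_of_algebra[OF this] obtain w where "evx a w G = 0"
      by (auto simp: evx_map_poly)
    then show "\<exists>w. \<forall>h\<in>vanishing S. evx a w h = 0" using lift[OF a] by blast
  qed
next
  case False
  have "1 \<notin> base_vanishing S" using assms by (auto simp: base_vanishing_def ev_one)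
  then show ?thesis
    by (rule that) (use False evx_eq_0 in blast)
qed

end

text \<open>A substitute for resultants.\<close>

lemma prime_ideal_elimination:
  fixes J :: "'r::idom poly set"
  assumes J: "ideal_set J" and prime: "\<And>f g. f * g \<in> J \<Longrightarrow> f \<in> J \<or> g \<in> J"
    and const: "\<And>c. [:c:] \<in> J \<Longrightarrow> c = 0" and "g \<in> J" "g \<noteq> 0" and l: "l \<notin> J"
  obtains B u where "B \<noteq> 0" "[:B:] - u * l \<in> J"
proof -
  have J0: "0 \<in> J" and Ja: "\<And>a b. a \<in> J \<Longrightarrow> b \<in> J \<Longrightarrow> a + b \<in> J"
    and Jm: "\<And>a b. a \<in> J \<Longrightarrow> b * a \<in> J" using J by (auto simp: ideal_set_def)
  note Jd = ideal_set_diff[OF J]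
  obtain G where G: "G \<in> J" "G \<noteq> 0"
    and Gmin: "\<And>f. f \<in> J \<Longrightarrow> f \<noteq> 0 \<Longrightarrow> Polynomial.degree G \<le> Polynomial.degree f"
    using minimal_degree_exists[of "\<lambda>f. f \<in> J \<and> f \<noteq> 0"] assms(4,5) by blast
  \<comment> \<open>The ideal generated by \<open>J\<close> and \<open>l\<close>; the aim is a
    nonzero constant polynomial in it, found as a nonzero element of least degree.\<close>
  define I where "I = {f. \<exists>u. f - u * l \<in> J}"
  have "J \<subseteq> I" unfolding I_def by (auto intro!: exI[of _ 0])
  have "l \<in> I" unfolding I_def using J0 by (auto intro!: exI[of _ 1])
  have Im: "b * a \<in> I" if aI: "a \<in> I" for a b
  proof -
    obtain u where "a - u * l \<in> J" using aI by (auto simp: I_def)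
    then have "b * (a - u * l) \<in> J" by (rule Jm)
    moreover have "b * (a - u * l) = b * a - (b * u) * l" by (simp add: algebra_simps)
    ultimately show ?thesis unfolding I_def by auto
  qed
  have Id: "a - b \<in> I" if aI: "a \<in> I" and bI: "b \<in> I" for a b
  proof -
    obtain u v where "a - u * l \<in> J" "b - v * l \<in> J" using aI bI by (auto simp: I_def)
    then have "(a - u * l) - (b - v * l) \<in> J" by (rule Jd)
    moreover have "(a - u * l) - (b - v * l) = (a - b) - (u - v) * l" by (simp add: algebra_simps)
    ultimately show ?thesis unfolding I_def by auto
  qed
  obtain H where H: "H \<in> I" "H \<noteq> 0"
    and Hmin: "\<And>f. f \<in> I \<Longrightarrow> f \<noteq> 0 \<Longrightarrow> Polynomial.degree H \<le> Polynomial.degree f"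
    using minimal_degree_exists[of "\<lambda>f. f \<in> I \<and> f \<noteq> 0"] G \<open>J \<subseteq> I\<close> by blast
  \<comment> \<open>The pseudo-remainder of \<open>l\<close> by \<open>G\<close> lies in
    \<open>I\<close> and is nonzero: otherwise a nonzero constant times \<open>l\<close> would lie
    in the prime ideal \<open>J\<close>.\<close>
  have Gdeg: "Polynomial.degree H < Polynomial.degree G"
  proof (rule ccontr)
    assume ge: "\<not> ?thesis"
    obtain q r where qr: "pseudo_divmod l G = (q, r)" by fastforce
    let ?c = "lead_coeff G ^ (Suc (Polynomial.degree l) - Polynomial.degree G)"
    have eq: "Polynomial.smult ?c l = G * q + r"
      and dr: "r = 0 \<or> Polynomial.degree r < Polynomial.degree G"
      using pseudo_divmod[OF G(2) qr] by auto
    have r: "r = [:?c:] * l - q * G" using eq by (simp add: mult.commute)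
    have "r \<noteq> 0"
    proof
      assume "r = 0"
      then have "[:?c:] * l = q * G" using r by simp
      then have "[:?c:] * l \<in> J" using Jm[OF G(1)] by simp
      from prime[OF this] l const[of ?c] G(2) show False by auto
    qed
    moreover have "r \<in> I" unfolding r using \<open>l \<in> I\<close> G(1) \<open>J \<subseteq> I\<close> Im Id by blast
    ultimately have "Polynomial.degree H \<le> Polynomial.degree r" using Hmin by blast
    then show False using dr ge \<open>r \<noteq> 0\<close> by simp
  qed
  \<comment> \<open>\<open>H\<close> divides a constant multiple of \<open>G\<close>. Having lower
    degree than \<open>G\<close>, it is not in \<open>J\<close>, so by primality the cofactor is,
    and the cofactor has degree at least that of \<open>G\<close>.\<close>
  have "Polynomial.degree H = 0"
  proof -
    obtain q r where qr: "pseudo_divmod G H = (q, r)" by fastforce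
    let ?c = "lead_coeff H ^ (Suc (Polynomial.degree G) - Polynomial.degree H)"
    have eq: "Polynomial.smult ?c G = H * q + r"
      and dr: "r = 0 \<or> Polynomial.degree r < Polynomial.degree H"
      using pseudo_divmod[OF H(2) qr] by auto
    have r: "r = [:?c:] * G - q * H" using eq by (simp add: mult.commute)
    have "r \<in> I" unfolding r using H(1) G(1) \<open>J \<subseteq> I\<close> Im Id by blast
    then have "r = 0" using Hmin dr by fastforce
    then have eq: "H * q = [:?c:] * G" using r by (simp add: mult.commute)
    have "H * q \<in> J" unfolding eq by (rule Jm[OF G(1)])
    have q0: "q \<noteq> 0" using eq G(2) H(2) by auto
    have "H \<notin> J" using Gmin[OF _ H(2)] Gdeg by auto
    then have "q \<in> J" using prime \<open>H * q \<in> J\<close> by blast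
    then have "Polynomial.degree G \<le> Polynomial.degree q" using Gmin q0 by blast
    moreover have "Polynomial.degree (H * q) = Polynomial.degree H + Polynomial.degree q"
      using q0 H(2) by (rule degree_mult_eq[rotated])
    moreover have "Polynomial.degree ([:?c:] * G) = Polynomial.degree G"
      using H(2) by simp
    ultimately show ?thesis using eq by simp
  qed
  then obtain B where B: "H = [:B:]" by (rule degree_eq_zeroE)
  show ?thesis
    using that[of B] H B unfolding I_def by auto
qed

section \<open>Projection of a space curve to a plane\<close>

interpretation line: point_evaluation "\<lambda>c. [:c:]" "\<lambda>x g. poly g x"
  by unfold_locales auto

interpretation plane: point_evaluation "\<lambda>c. [:[:c:]:]" "\<lambda>a g. ev2 g (fst a) (snd a)"
  by unfold_locales auto

lemma line_evx: "line.evx x y g = ev2 g x y"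
  by (simp add: line.evx_def ev2_def)

lemma plane_evx: "plane.evx a w g = ev3 g (fst a) (snd a) w"
  by (simp add: plane.evx_def ev3_def)

text \<open>\<open>G = 0\<close> contains the projected curve, and \<open>B\<close> excludes the
  first coordinates above which a root of \<open>G\<close> might fail to come from \<open>X\<close>.
  Unboundedness of \<open>u\<close> makes \<open>u\<close> take infinitely many values, so no
  nonzero polynomial in \<open>u\<close> alone vanishes on \<open>X\<close>.\<close>

lemma irreducible_curve_projection:
  fixes X :: "(complex ^ 3) set"
  assumes X: "irreducible_curve X"
    and uv: "polyfun u" "polyfun v"
    and nested: "\<And>i. \<exists>g. \<forall>p. p $ i = ev3 g (u p) (v p) (w p)"
    and surj: "\<And>x y z. \<exists>p. u p = x \<and> v p = y \<and> w p = z"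
    and unbounded: "\<And>R. \<exists>p\<in>X. norm (u p) > R"
  obtains G B where "G \<noteq> 0" "\<And>p. p \<in> X \<Longrightarrow> ev2 G (u p) (v p) = 0" "B \<noteq> 0"
    "\<And>\<beta> y. poly B \<beta> \<noteq> 0 \<Longrightarrow> ev2 G \<beta> y = 0 \<Longrightarrow> \<exists>p\<in>X. u p = \<beta> \<and> v p = y"
proof -
  define S2 where "S2 = (\<lambda>p. ((u p, v p), w p)) ` X"
  define S1 where "S1 = (\<lambda>p. (u p, v p)) ` X"
  have irr: "irreducible_set X" and alg: "algebraic_set X"
    using X by (auto simp: irreducible_curve_def irreducible_set_def)
  have S2: "h \<in> plane.vanishing S2 \<longleftrightarrow> (\<forall>p\<in>X. ev3 h (u p) (v p) (w p) = 0)" for h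
    by (auto simp: plane.vanishing_def S2_def plane_evx)
  have J2: "c \<in> plane.base_vanishing S2 \<longleftrightarrow> (\<forall>p\<in>X. ev2 c (u p) (v p) = 0)" for c
    by (auto simp: plane.base_vanishing_def S2_def)
  have S1: "h \<in> line.vanishing S1 \<longleftrightarrow> (\<forall>p\<in>X. ev2 h (u p) (v p) = 0)" for h
    by (auto simp: line.vanishing_def S1_def line_evx)
  have J1: "c \<in> line.base_vanishing S1 \<longleftrightarrow> (\<forall>p\<in>X. poly c (u p) = 0)" for c
    by (auto simp: line.base_vanishing_def S1_def)
  have u_inf: "infinite (u ` X)"
  proof
    assume "finite (u ` X)"
    then have "bounded (u ` X)" by (rule finite_imp_bounded)
    then obtain R where "\<forall>z\<in>u ` X. norm z \<le> R" by (auto simp: bounded_iff)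
    with unbounded[of R] show False by force
  qed
  have J1_0: "c = 0" if "c \<in> line.base_vanishing S1" for c
  proof (rule ccontr)
    assume "c \<noteq> 0"
    then have "finite {z. poly c z = 0}" by (rule poly_roots_finite)
    moreover have "u ` X \<subseteq> {z. poly c z = 0}" using that J1 by auto
    ultimately show False using u_inf finite_subset by blast
  qed
  have closed: "\<exists>p\<in>X. u p = x \<and> v p = y" if "\<forall>h\<in>plane.vanishing S2. ev3 h x y z = 0" for x y z
  proof -
    obtain p where p: "u p = x" "v p = y" "w p = z" using surj by blast
    have "p \<in> X"
    proof (rule algebraic_set_closed[OF alg])
      fix f :: "complex ^ 3 \<Rightarrow> complex" assume f: "polyfun f" "\<forall>q\<in>X. f q = 0"
      from polyfun_nested[OF f(1) nested] obtain g where
        g: "\<And>q. f q = ev3 g (u q) (v q) (w q)" by blast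
      then have "g \<in> plane.vanishing S2" using f(2) by (simp add: S2)
      then show "f p = 0" using that g p by simp
    qed
    with p show ?thesis by blast
  qed
  have "X \<noteq> {}" using irr by (simp add: irreducible_set_def)
  then have "S2 \<noteq> {}" by (simp add: S2_def)
  obtain l where l: "l \<notin> plane.base_vanishing S2"
    and l_lift: "\<And>a. (\<forall>c\<in>plane.base_vanishing S2. ev2 c (fst a) (snd a) = 0) \<Longrightarrow>
      ev2 l (fst a) (snd a) \<noteq> 0 \<Longrightarrow> \<exists>w. \<forall>h\<in>plane.vanishing S2. plane.evx a w h = 0"
    by (rule plane.lift_generic[OF \<open>S2 \<noteq> {}\<close>]) (rule that)
  have lift: "\<exists>p\<in>X. u p = x \<and> v p = y"
    if "\<And>c. c \<in> line.vanishing S1 \<Longrightarrow> ev2 c x y = 0" "ev2 l x y \<noteq> 0" for x y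
  proof -
    have "\<exists>z. \<forall>h\<in>plane.vanishing S2. plane.evx (x, y) z h = 0"
      using that by (intro l_lift) (auto simp: J2 S1)
    then show ?thesis using closed by (auto simp: plane_evx)
  qed
  \<comment> \<open>If the projection were dense in the plane, then for a generic \<beta> all but
    finitely many points (\<beta>, y) would lift, and the fibre \<open>u = \<beta>\<close> of the
    curve would be infinite.\<close>
  have "\<exists>g\<in>line.vanishing S1. g \<noteq> 0"
  proof (rule ccontr)
    assume "\<not> ?thesis"
    then have zero: "\<And>g. g \<in> line.vanishing S1 \<Longrightarrow> g = 0" by blast
    have "l \<noteq> 0" using l by (auto simp: J2)
    then have "finite {z. poly (lead_coeff l) z = 0}" by (intro poly_roots_finite) simp
    then obtain \<beta> where \<beta>: "poly (lead_coeff l) \<beta> \<noteq> 0"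
      using infinite_UNIV_char_0[where 'a = complex] by (metis (mono_tags, lifting) UNIV_eq_I mem_Collect_eq)
    define h where "h = map_poly (\<lambda>c. poly c \<beta>) l"
    have "Polynomial.coeff h (Polynomial.degree l) \<noteq> 0" using \<beta> by (simp add: h_def coeff_map_poly)
    then have "h \<noteq> 0" by auto
    then have fin: "finite {y. poly h y = 0}" by (rule poly_roots_finite)
    have h: "poly h y = ev2 l \<beta> y" for y
      using line.evx_map_poly[of \<beta> y l] by (simp add: h_def line_evx)
    have "- {y. poly h y = 0} \<subseteq> v ` {p \<in> X. u p - \<beta> = 0}"
    proof
      fix y assume "y \<in> - {y. poly h y = 0}"
      then have "ev2 l \<beta> y \<noteq> 0" by (simp add: h)
      then obtain p where "p \<in> X" "u p = \<beta>" "v p = y" using lift[of \<beta> y] zero by fastforce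
      then show "y \<in> v ` {p \<in> X. u p - \<beta> = 0}" by (intro image_eqI[of _ _ p]) auto
    qed
    moreover have "infinite (- {y. poly h y = 0})"
      using fin infinite_UNIV_char_0[where 'a = complex] by (metis finite_Collect_not Collect_neg_eq)
    ultimately have "infinite (v ` {p \<in> X. u p - \<beta> = 0})" by (rule infinite_super)
    then have "infinite {p \<in> X. u p - \<beta> = 0}" using finite_imageI by blast
    moreover obtain x0 where "x0 \<in> X" "u x0 - \<beta> \<noteq> 0"
      using unbounded[of "norm \<beta>"] by force
    ultimately show False
      using irreducible_curve_zeros_finite[OF X polyfun_diff[OF uv(1) polyfun_const[of \<beta>]]] by blast
  qed
  then obtain g where g: "g \<in> line.vanishing S1" "g \<noteq> 0" by blast
  then obtain i where "Polynomial.coeff g i \<noteq> 0" by (metis leading_coeff_0_iff)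
  then have i: "Polynomial.coeff g i \<notin> line.base_vanishing S1" using J1_0 by blast
  obtain G where G: "G \<in> line.vanishing S1" "lead_coeff G \<notin> line.base_vanishing S1"
    and G_lift: "\<And>a w h. (\<forall>c\<in>line.base_vanishing S1. poly c a = 0) \<Longrightarrow> poly (lead_coeff G) a \<noteq> 0 \<Longrightarrow>
      line.evx a w G = 0 \<Longrightarrow> h \<in> line.vanishing S1 \<Longrightarrow> line.evx a w h = 0"
    by (rule line.lift_algebraic[OF g(1) i]) (rule that)
  have G0: "G \<noteq> 0" using G(2) line.zero_base_vanishing by auto
  \<comment> \<open>Lifting to \<open>X\<close> needs \<open>l\<close> to be nonzero at the point, a
    condition involving both coordinates. Modulo the ideal of the projection, \<open>B0\<close> is a
    multiple of \<open>l\<close>, so the condition follows from one on \<beta> alone.\<close>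
  obtain B0 U where B0: "B0 \<noteq> 0" "[:B0:] - U * l \<in> line.vanishing S1"
  proof (rule prime_ideal_elimination[of "line.vanishing S1" G l])
    show "ideal_set (line.vanishing S1)" by (auto simp: ideal_set_def S1)
    show "f \<in> line.vanishing S1 \<or> h \<in> line.vanishing S1" if "f * h \<in> line.vanishing S1" for f h
      using that irreducible_set_prime[OF irr polyfun_ev2 polyfun_ev2, of u v u v f h] uv by (simp add: S1)
    show "c = 0" if "[:c:] \<in> line.vanishing S1" for c
      using that J1_0[of c] by (simp add: S1 J1 ev2_const)
    show "l \<notin> line.vanishing S1" using l by (simp add: S1 J2)
  qed (use G G0 in auto)
  show ?thesis
  proof (rule that)
    show "G \<noteq> 0" by fact
    show "ev2 G (u p) (v p) = 0" if "p \<in> X" for p using G(1) that by (simp add: S1)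
    show "B0 * lead_coeff G \<noteq> 0" using B0(1) G0 by simp
    fix \<beta> y assume \<beta>: "poly (B0 * lead_coeff G) \<beta> \<noteq> 0" and y: "ev2 G \<beta> y = 0"
    have van: "ev2 h \<beta> y = 0" if "h \<in> line.vanishing S1" for h
    proof -
      have "\<forall>c\<in>line.base_vanishing S1. poly c \<beta> = 0" using J1_0 by fastforce
      with G_lift[of \<beta> y h] \<beta> y that show ?thesis by (simp add: line_evx)
    qed
    from van[OF B0(2)] have "poly B0 \<beta> = ev2 U \<beta> y * ev2 l \<beta> y" by (simp add: ev2_const)
    with \<beta> have "ev2 l \<beta> y \<noteq> 0" by auto
    with van show "\<exists>p\<in>X. u p = \<beta> \<and> v p = y" by (rule lift)
  qed
qed

section \<open>Polynomially parametrized space curves\<close>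

lemma complex_root_exists: "e \<ge> 1 \<Longrightarrow> \<exists>t. t ^ e = (z :: complex)"
  using exists_complex_root[of e z] by (metis not_one_le_zero)

text \<open>If \<open>e\<close> does not divide \<open>i\<close>, multiplying the summation variable
  by a root \<open>z\<close> with \<open>z ^ i \<noteq> 1\<close> reproduces the sum with a factor
  different from 1.\<close>

lemma sum_roots_of_unity_power:
  assumes "e \<ge> 1"
  shows "(\<Sum>w | w ^ e = 1. w ^ i) = (if e dvd i then of_nat e else (0::complex))"
proof (cases "e dvd i")
  case True
  then have "w ^ i = 1" if "w ^ e = 1" for w :: complex
    using that by (auto simp: dvd_def power_mult)
  then have "(\<Sum>w | w ^ e = (1::complex). w ^ i) = of_nat (card {w::complex. w ^ e = 1})" by simp
  then show ?thesis using True assms by (simp add: card_roots_unity_eq)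
next
  case False
  \<comment> \<open>Otherwise all \<open>e\<close> roots of unity would solve
    \<open>z ^ (i mod e) = 1\<close>, which has only \<open>i mod e < e\<close> solutions.\<close>
  have "\<exists>z::complex. z ^ e = 1 \<and> z ^ i \<noteq> 1"
  proof (rule ccontr)
    assume none: "\<not> ?thesis"
    have mod: "z ^ (i mod e) = z ^ i" if "z ^ e = 1" for z :: complex
    proof -
      have "z ^ i = z ^ (e * (i div e) + i mod e)" by simp
      also have "\<dots> = z ^ (i mod e)" unfolding power_add power_mult that by simp
      finally show ?thesis by simp
    qed
    with none have sub: "{z::complex. z ^ e = 1} \<subseteq> {z. z ^ (i mod e) = 1}" by auto
    have pos: "i mod e > 0" using False by (simp add: dvd_eq_mod_eq_0)
    have "card {z::complex. z ^ e = 1} \<le> card {z::complex. z ^ (i mod e) = 1}"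
      by (intro card_mono sub finite_roots_unity) (use pos in auto)
    moreover have "i mod e < e" using assms by simp
    ultimately show False using pos assms by (simp add: card_roots_unity_eq)
  qed
  then obtain z :: complex where z: "z ^ e = 1" "z ^ i \<noteq> 1" by blast
  then have z0: "z \<noteq> 0" using assms by (auto simp: power_0_left split: if_splits)
  have "(\<Sum>w | w ^ e = 1. w ^ i) = (\<Sum>w | w ^ e = 1. (z * w) ^ i)"
    by (rule sum.reindex_bij_witness[of _ "\<lambda>w. z * w" "\<lambda>w. w / z"])
       (use z z0 in \<open>auto simp: power_mult_distrib power_divide\<close>)
  also have "\<dots> = z ^ i * (\<Sum>w | w ^ e = 1. w ^ i)"
    by (simp add: power_mult_distrib sum_distrib_left)
  finally show ?thesis using z(2) False by simp
qed

lemma ev2_altdef: "ev2 g x y = (\<Sum>i\<le>Polynomial.degree g. poly (Polynomial.coeff g i) x * y ^ i)"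
  unfolding ev2_def poly_altdef[of g] by (simp add: poly_sum)

lemma ev2_map_const: "ev2 (map_poly (\<lambda>c. [:c:]) q) x y = poly q y"
  by (induction q) (simp_all add: ev2_pCons map_poly_pCons)

lemma ev2_prod: "ev2 (\<Prod>a\<in>A. f a) x y = (\<Prod>a\<in>A. ev2 (f a) x y)"
  by (induction A rule: infinite_finite_induct) auto

text \<open>The norm of \<open>L - s t\<close> from the polynomials in \<open>t\<close> to those in \<open>t ^ e\<close>; averaging over the
  roots of unity shows that it only involves powers of \<open>t ^ e\<close>.\<close>

lemma norm_polynomial:
  assumes "e \<ge> 1"
  obtains c :: "nat \<Rightarrow> complex poly" and D :: nat where
    "\<And>t L. (\<Prod>w | w ^ e = 1. L - poly s (w * t)) = (\<Sum>i\<le>D. poly (c i) L * (t ^ e) ^ i)"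
proof -
  let ?U = "{w::complex. w ^ e = 1}"
  have fin: "finite ?U" using assms by (intro finite_roots_unity) auto
  define P :: "complex poly poly" where
    "P = (\<Prod>w\<in>?U. [:[:0, 1:]:] - map_poly (\<lambda>c. [:c:]) (pcompose s [:0, w:]))"
  have P: "ev2 P L t = (\<Prod>w\<in>?U. L - poly s (w * t))" for L t
    by (simp add: P_def ev2_prod ev2_map_const ev2_const poly_pcompose mult.commute)
  have inv: "ev2 P L (z * t) = ev2 P L t" if z: "z \<in> ?U" for z L t
  proof -
    have "z \<noteq> 0" using z assms by (auto simp: power_0_left split: if_splits)
    then show ?thesis unfolding P
      by (intro prod.reindex_bij_witness[of _ "\<lambda>w. w / z" "\<lambda>w. w * z"])
         (use z in \<open>auto simp: power_mult_distrib power_divide mult.assoc\<close>)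
  qed
  let ?n = "Polynomial.degree P"
  let ?c = "\<lambda>i. if i * e \<le> ?n then Polynomial.coeff P (i * e) else 0"
  have "ev2 P L t = (\<Sum>i\<le>?n. poly (?c i) L * (t ^ e) ^ i)" for L t
  proof -
    have "of_nat e * ev2 P L t = (\<Sum>w\<in>?U. ev2 P L (w * t))"
      using inv assms by (simp add: card_roots_unity_eq)
    also have "\<dots> = (\<Sum>i\<le>?n. \<Sum>w\<in>?U. poly (Polynomial.coeff P i) L * t ^ i * w ^ i)"
      unfolding ev2_altdef by (subst sum.swap) (simp add: power_mult_distrib mult_ac)
    also have "\<dots> = (\<Sum>i\<le>?n. poly (Polynomial.coeff P i) L * t ^ i * (if e dvd i then of_nat e else 0))"
      by (simp add: sum_distrib_left[symmetric] sum_roots_of_unity_power[OF assms])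
    also have "\<dots> = of_nat e * (\<Sum>i | i \<le> ?n \<and> e dvd i. poly (Polynomial.coeff P i) L * t ^ i)"
      by (simp add: sum_distrib_left sum.inter_filter[symmetric] if_distrib mult_ac cong: if_cong)
    also have "(\<Sum>i | i \<le> ?n \<and> e dvd i. poly (Polynomial.coeff P i) L * t ^ i) =
        (\<Sum>i | i * e \<le> ?n. poly (Polynomial.coeff P (i * e)) L * t ^ (i * e))"
      by (rule sum.reindex_bij_witness[of _ "\<lambda>i. i * e" "\<lambda>i. i div e"]) (use assms in auto)
    also have "\<dots> = (\<Sum>i\<le>?n. poly (?c i) L * (t ^ e) ^ i)"
    proof (rule sum.mono_neutral_cong_left)
      have "i \<le> ?n" if "i * e \<le> ?n" for i
      proof -
        have "i * 1 \<le> i * e" using assms by (rule mult_le_mono2)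
        then show ?thesis using that by linarith
      qed
      then show "{i. i * e \<le> ?n} \<subseteq> {..?n}" by auto
    qed (auto simp: power_mult[symmetric] mult.commute)
    finally show ?thesis using assms by simp
  qed
  then show ?thesis using that[of ?c ?n] P by simp
qed

locale polynomial_space_curve =
  fixes e :: nat and s2 s3 :: "complex poly" and \<psi> :: "complex \<Rightarrow> complex ^ 3" and Q :: "(complex ^ 3) set"
  assumes e: "e \<ge> 1" and deg: "Polynomial.degree s2 \<le> e" "Polynomial.degree s3 \<le> e"
    and \<psi>: "\<And>u. \<psi> u = vector [u ^ e, poly s2 u, poly s3 u]"
    and Q: "Q = zariski_closure (range \<psi>)"
begin

lemma polyfun_psi: "polyfun f \<Longrightarrow> \<exists>P. \<forall>u. f (\<psi> u) = poly P u"
proof (induction rule: polyfun.induct)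
  case (polyfun_const c)
  show ?case by (rule exI[of _ "[:c:]"]) simp
next
  case (polyfun_coord i)
  show ?case
  proof (rule UNIV_3_coords[of _ i])
    show "\<exists>P. \<forall>u. \<psi> u $ 1 = poly P u"
      by (rule exI[of _ "monom 1 e"]) (simp add: \<psi> poly_monom)
  qed (auto simp: \<psi>)
next
  case (polyfun_add f g)
  then show ?case by (metis poly_add)
next
  case (polyfun_mult f g)
  then show ?case by (metis poly_mult)
qed

text \<open>For s = s2 + \<tau> s3 the norm is a polynomial in x_1 and x_2 + \<tau> x_3 that
  vanishes on the curve, hence at every \<open>x\<close> of the closure. So x_2 + \<tau> x_3 agrees
  with its value at one of the points of the curve over x_1. There are at most \<open>e\<close> of
  these, so a suitable \<tau> tells them all apart from \<open>x\<close> if \<open>x\<close> is none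
  of them.\<close>

lemma range_closed: "Q = range \<psi>"
proof
  show "range \<psi> \<subseteq> Q" unfolding Q by (rule zariski_closure_subset)
  show "Q \<subseteq> range \<psi>"
  proof
    fix x assume "x \<in> Q"
    then have x: "f x = 0" if "polyfun f" "\<And>u. f (\<psi> u) = 0" for f
      using that by (auto simp: Q zariski_closure_polyfun)
    let ?U = "{w::complex. w ^ e = 1}"
    have fin: "finite ?U" using e by (intro finite_roots_unity) auto
    obtain t0 where t0: "t0 ^ e = x $ 1" using complex_root_exists[OF e] by blast
    show "x \<in> range \<psi>"
    proof (rule ccontr)
      assume "x \<notin> range \<psi>"
      then have ne: "x \<noteq> \<psi> (w * t0)" for w by auto
      have bad: "finite {\<tau>. x $ 2 + \<tau> * x $ 3 = poly s2 (w * t0) + \<tau> * poly s3 (w * t0)}"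
        if "w \<in> ?U" for w
      proof -
        let ?p = "[:x $ 2 - poly s2 (w * t0), x $ 3 - poly s3 (w * t0):]"
        have "?p \<noteq> 0"
        proof
          assume "?p = 0"
          then have "x = \<psi> (w * t0)"
            using that t0 by (auto simp: \<psi> vec_eq_iff forall_3 power_mult_distrib)
          with ne show False by blast
        qed
        then have "finite {\<tau>. poly ?p \<tau> = 0}" by (rule poly_roots_finite)
        then show ?thesis by (rule rev_finite_subset) (auto simp: algebra_simps)
      qed
      have "finite (\<Union>w\<in>?U. {\<tau>. x $ 2 + \<tau> * x $ 3 = poly s2 (w * t0) + \<tau> * poly s3 (w * t0)})"
        by (intro finite_UN_I fin bad)
      then obtain \<tau> where \<tau>: "\<And>w. w \<in> ?U \<Longrightarrow>
          x $ 2 + \<tau> * x $ 3 \<noteq> poly s2 (w * t0) + \<tau> * poly s3 (w * t0)"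
        using ex_new_if_finite[OF infinite_UNIV_char_0[where 'a = complex]] by blast
      define s where "s = s2 + Polynomial.smult \<tau> s3"
      obtain c D where c: "\<And>t L. (\<Prod>w\<in>?U. L - poly s (w * t)) = (\<Sum>i\<le>D. poly (c i) L * (t ^ e) ^ i)"
        by (rule norm_polynomial[OF e, of s]) (rule that)
      define F where "F p = (\<Sum>i\<le>D. poly (c i) (p $ 2 + \<tau> * p $ 3) * (p $ 1) ^ i)" for p :: "complex ^ 3"
      have "F x = 0"
      proof (rule x)
        show "polyfun F" unfolding F_def
          by (intro polyfun_sum polyfun_mult polyfun_poly polyfun_power polyfun_add polyfun_coord polyfun_const)
        fix u
        have "F (\<psi> u) = (\<Prod>w\<in>?U. poly s u - poly s (w * u))"
          unfolding c by (simp add: F_def \<psi> s_def)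
        also have "\<dots> = 0" by (rule prod_zero[OF fin]) (auto intro!: exI[of _ 1])
        finally show "F (\<psi> u) = 0" .
      qed
      moreover have "F x = (\<Prod>w\<in>?U. (x $ 2 + \<tau> * x $ 3) - poly s (w * t0))"
        unfolding c F_def t0 ..
      ultimately obtain w where "w \<in> ?U" "(x $ 2 + \<tau> * x $ 3) - poly s (w * t0) = 0"
        using fin by auto
      with \<tau>[of w] show False by (simp add: s_def)
    qed
  qed
qed

lemma algebraic_Q: "algebraic_set Q"
  unfolding Q by (rule zariski_closure_algebraic)

text \<open>Functions on the curve pull back along \<psi> to univariate polynomials, which form an
  integral domain.\<close>

lemma irreducible_Q: "irreducible_set Q"
  unfolding irreducible_set_def
proof (intro conjI allI impI algebraic_Q)
  show "Q \<noteq> {}" by (simp add: range_closed)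
  fix Y Z assume YZ: "algebraic_set Y \<and> algebraic_set Z \<and> Q = Y \<union> Z"
  have "range \<psi> \<subseteq> Y \<or> range \<psi> \<subseteq> Z"
  proof (rule ccontr)
    assume "\<not> ?thesis"
    then obtain u v where uv: "\<psi> u \<notin> Y" "\<psi> v \<notin> Z" by blast
    obtain f where f: "polyfun f" "\<forall>y\<in>Y. f y = 0" "f (\<psi> u) \<noteq> 0"
      using algebraic_set_closed[of Y "\<psi> u"] YZ uv(1) by metis
    obtain g where g: "polyfun g" "\<forall>y\<in>Z. g y = 0" "g (\<psi> v) \<noteq> 0"
      using algebraic_set_closed[of Z "\<psi> v"] YZ uv(2) by metis
    obtain F G where F: "\<And>t. f (\<psi> t) = poly F t" and G: "\<And>t. g (\<psi> t) = poly G t"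
      using polyfun_psi f(1) g(1) by metis
    have "poly (F * G) t = 0" for t
    proof -
      have "\<psi> t \<in> Y \<union> Z" using YZ range_closed by auto
      then show ?thesis using f(2) g(2) F[of t] G[of t] by auto
    qed
    then have "F * G = 0" using poly_all_0_iff_0 by blast
    then show False using f(3) g(3) F[of u] G[of v] by auto
  qed
  then show "Q = Y \<or> Q = Z" using YZ range_closed by auto
qed

lemma finite_proper_closed:
  assumes "algebraic_set W" "W \<subset> Q" shows "finite W"
proof -
  obtain q where q: "q \<in> Q" "q \<notin> W" using assms(2) by blast
  obtain f where f: "polyfun f" "\<forall>y\<in>W. f y = 0" "f q \<noteq> 0"
    using algebraic_set_closed[OF assms(1), of q] q(2) by metis
  obtain P where P: "\<And>u. f (\<psi> u) = poly P u" using polyfun_psi[OF f(1)] by blast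
  have "P \<noteq> 0" using f(3) q(1) P by (auto simp: range_closed)
  then have "finite {u. poly P u = 0}" by (rule poly_roots_finite)
  moreover have "W \<subseteq> \<psi> ` {u. poly P u = 0}"
    using assms(2) f(2) P by (force simp: range_closed)
  ultimately show ?thesis using finite_surj by blast
qed

lemma infinite_Q: "infinite Q"
proof
  assume "finite Q"
  then have "finite ((\<lambda>p. p $ 1) ` Q)" by (rule finite_imageI)
  moreover have "(\<lambda>p. p $ 1) ` Q = UNIV"
  proof -
    have "z \<in> (\<lambda>p. p $ 1) ` Q" for z
    proof -
      obtain u where "u ^ e = z" using complex_root_exists[OF e] by blast
      then show ?thesis by (intro image_eqI[of _ _ "\<psi> u"]) (auto simp: \<psi> range_closed)
    qed
    then show ?thesis by auto
  qed
  ultimately show False using infinite_UNIV_char_0[where 'a = complex] by simp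
qed

text \<open>Proper closed subsets are finite, so the proper irreducible ones are points and no chain
  has length 2.\<close>

lemma irreducible_curve_Q: "irreducible_curve Q"
  unfolding irreducible_curve_def
proof (intro conjI irreducible_Q antisym)
  let ?D = "{enat d | d. \<exists>Z :: nat \<Rightarrow> (complex ^ 3) set.
     (\<forall>i\<le>d. irreducible_set (Z i) \<and> Z i \<subseteq> Q) \<and> (\<forall>i<d. Z i \<subset> Z (Suc i))}"
  show "alg_dim Q \<le> 1"
    unfolding alg_dim_def
  proof (rule Sup_least)
    fix m assume "m \<in> ?D"
    then obtain d and Z :: "nat \<Rightarrow> (complex ^ 3) set" where m: "m = enat d"
      and Z: "\<And>i. i \<le> d \<Longrightarrow> irreducible_set (Z i) \<and> Z i \<subseteq> Q" "\<And>i. i < d \<Longrightarrow> Z i \<subset> Z (Suc i)"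
      by blast
    have "d \<le> 1"
    proof (rule ccontr)
      assume d: "\<not> d \<le> 1"
      then have "Z 1 \<subset> Q" using Z(1)[of 2] Z(2)[of 1] by (auto simp: numeral_2_eq_2)
      then have "finite (Z 1)" using Z(1)[of 1] d finite_proper_closed by (auto simp: irreducible_set_def)
      with Z(1)[of 1] d have "\<exists>a. Z 1 = {a}" by (intro finite_irreducible_set_singleton) auto
      then obtain a where "Z 1 = {a}" by blast
      then have "Z 0 = {}" using Z(2)[of 0] d by auto
      then show False using Z(1)[of 0] by (auto simp: irreducible_set_def)
    qed
    then show "m \<le> 1" by (simp add: m one_enat_def)
  qed
  define Z where "Z i = (if i = 0 then {\<psi> 0} else Q)" for i :: nat
  have "{\<psi> 0} \<noteq> Q" using infinite_Q by (metis finite.emptyI finite_insert)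
  then have "{\<psi> 0} \<subset> Q" by (auto simp: range_closed)
  then have "\<forall>i<1. Z i \<subset> Z (Suc i)" by (simp add: Z_def)
  moreover have "\<forall>i\<le>1. irreducible_set (Z i) \<and> Z i \<subseteq> Q"
    using \<open>{\<psi> 0} \<subset> Q\<close> by (auto simp: Z_def irreducible_set_singleton irreducible_Q)
  ultimately have "enat 1 \<in> ?D" by blast
  then show "1 \<le> alg_dim Q" unfolding alg_dim_def one_enat_def by (rule Sup_upper)
qed

lemma algebraic_curve_Q: "algebraic_curve Q"
  unfolding algebraic_curve_def by (rule exI[of _ "{Q}"]) (simp add: irreducible_curve_Q)

text \<open>A plane section pulls back to the roots of a polynomial of degree at most
  \<open>e\<close>, so the finite sections have a largest cardinality. The plane x_1 = 0 shows that
  finite sections exist.\<close>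

lemma has_degree_Q: "\<exists>d\<le>e. has_degree Q d"
proof -
  define S where "S = {card (Q \<inter> hyperplane \<alpha> \<beta>) | \<alpha> \<beta>. \<alpha> \<noteq> 0 \<and> finite (Q \<inter> hyperplane \<alpha> \<beta>)}"
  define h where "h \<alpha> \<beta> = monom (\<alpha> $ 1) e + Polynomial.smult (\<alpha> $ 2) s2 + Polynomial.smult (\<alpha> $ 3) s3 - [:\<beta>:]"
    for \<alpha> :: "complex ^ 3" and \<beta>
  have h: "Q \<inter> hyperplane \<alpha> \<beta> = \<psi> ` {u. poly (h \<alpha> \<beta>) u = 0}" for \<alpha> \<beta>
    by (auto simp: range_closed hyperplane_def h_def \<psi> sum_3 poly_monom)
  have hdeg: "Polynomial.degree (h \<alpha> \<beta>) \<le> e" for \<alpha> \<beta>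
    unfolding h_def using deg
    by (intro degree_diff_le degree_add_le) (auto intro: degree_monom_le order_trans[OF degree_smult_le])
  have bound: "card (Q \<inter> hyperplane \<alpha> \<beta>) \<le> e" if "finite (Q \<inter> hyperplane \<alpha> \<beta>)" for \<alpha> \<beta>
  proof -
    have "h \<alpha> \<beta> \<noteq> 0"
    proof
      assume "h \<alpha> \<beta> = 0"
      then have "Q \<inter> hyperplane \<alpha> \<beta> = Q" unfolding h by (simp add: range_closed)
      with that infinite_Q show False by simp
    qed
    then have "finite {u. poly (h \<alpha> \<beta>) u = 0}" "card {u. poly (h \<alpha> \<beta>) u = 0} \<le> e"
      using poly_roots_finite card_poly_roots_bound[of "h \<alpha> \<beta>"] hdeg[of \<alpha> \<beta>] by (auto intro: order_trans)
    then show ?thesis unfolding h using card_image_le order_trans by blast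
  qed
  have "S \<subseteq> {..e}" using bound by (auto simp: S_def)
  then have "finite S" using finite_subset by blast
  have "h (axis 1 1) 0 \<noteq> 0"
    by (simp add: h_def axis_def)
  then have "finite (Q \<inter> hyperplane (axis 1 1) 0)"
    unfolding h by (intro finite_imageI poly_roots_finite)
  then have "card (Q \<inter> hyperplane (axis 1 1) 0) \<in> S" unfolding S_def by (auto intro!: exI[of _ "axis 1 1"])
  then have "S \<noteq> {}" by blast
  have "Max S \<in> S" using \<open>finite S\<close> \<open>S \<noteq> {}\<close> by (rule Max_in)
  moreover have "card (Q \<inter> hyperplane \<alpha> \<beta>) \<le> Max S"
    if "\<alpha> \<noteq> 0" "finite (Q \<inter> hyperplane \<alpha> \<beta>)" for \<alpha> \<beta>
    using that by (intro Max_ge[OF \<open>finite S\<close>]) (auto simp: S_def)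
  moreover have "\<exists>\<alpha> \<beta>. \<alpha> \<noteq> 0 \<and> finite (Q \<inter> hyperplane \<alpha> \<beta>) \<and> card (Q \<inter> hyperplane \<alpha> \<beta>) = m"
    if "m \<in> S" for m
    using that by (auto simp: S_def)
  ultimately have "has_degree Q (Max S)" by (simp add: has_degree_def)
  moreover have "Max S \<le> e" using \<open>Max S \<in> S\<close> \<open>S \<subseteq> {..e}\<close> by auto
  ultimately show ?thesis by blast
qed

end

section \<open>Curves approaching a parametrized curve\<close>

lemma ev2_nonzero:
  assumes "g \<noteq> 0" obtains x y where "ev2 g x y \<noteq> 0"
proof -
  have "lead_coeff g \<noteq> 0" using assms by simp
  then obtain x where x: "poly (lead_coeff g) x \<noteq> 0" using poly_all_0_iff_0 by blast
  define h where "h = map_poly (\<lambda>c. poly c x) g"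
  have "Polynomial.coeff h (Polynomial.degree g) \<noteq> 0" using x by (simp add: h_def coeff_map_poly)
  then have "h \<noteq> 0" by auto
  then obtain y where "poly h y \<noteq> 0" using poly_all_0_iff_0 by blast
  moreover have "poly (map_poly (\<lambda>c. poly c x) f) y = ev2 f x y" for f
    by (induction f) (auto simp: ev2_pCons map_poly_pCons)
  ultimately show ?thesis using that[of x y] by (simp add: h_def)
qed

text \<open>The displacement \<open>c\<close> is made the inner variable and \<open>t\<close> the
  outer one, so the leading coefficient of \<open>H\<close> at infinity is a polynomial in
  \<open>c\<close>.\<close>

lemma ev2_substitution:
  "\<exists>H. \<forall>c t. ev2 H c t = ev2 G (t ^ e) (poly s t + c)"
proof (induction G)
  case 0
  show ?case by (rule exI[of _ 0]) simp
next
  case (pCons a G)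
  then obtain H where H: "\<And>c t. ev2 H c t = ev2 G (t ^ e) (poly s t + c)" by blast
  show ?case
    by (rule exI[of _ "map_poly (\<lambda>c. [:c:]) (pcompose a (monom 1 e)) +
          (map_poly (\<lambda>c. [:c:]) s + [:[:0, 1:]:]) * H"])
       (simp add: ev2_map_const ev2_pCons ev2_const poly_pcompose poly_monom H)
qed

text \<open>Uniformity in \<open>c\<close> on the unit disc is what Hurwitz's theorem will
  require.\<close>

lemma ev2_leading_bound:
  assumes "m = Polynomial.degree H"
  obtains A where "A \<ge> 0" "\<And>c t. norm c \<le> 1 \<Longrightarrow> norm t \<ge> 1 \<Longrightarrow>
    norm (ev2 H c t / t ^ m - poly (lead_coeff H) c) \<le> A / norm t"
proof -
  have "\<exists>b. \<forall>c. norm c \<le> 1 \<longrightarrow> norm (poly p c) \<le> b" for p :: "complex poly"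
    using poly_bound_exists[of 1 p] by blast
  then have "\<exists>b. \<forall>i c. norm c \<le> 1 \<longrightarrow> norm (poly (Polynomial.coeff H i) c) \<le> b i"
    by (intro choice) blast
  then obtain b where b: "\<And>i c. norm c \<le> 1 \<Longrightarrow> norm (poly (Polynomial.coeff H i) c) \<le> b i"
    by blast
  have b0: "b i \<ge> 0" for i using b[of 0 i] by (smt (verit) norm_ge_zero norm_zero)
  show ?thesis
  proof (rule that[of "\<Sum>i<m. b i"])
    show "(\<Sum>i<m. b i) \<ge> 0" by (intro sum_nonneg b0)
    fix c t :: complex assume c: "norm c \<le> 1" and t: "norm t \<ge> 1"
    then have t0: "t \<noteq> 0" by auto
    have "ev2 H c t = (\<Sum>i<m. poly (Polynomial.coeff H i) c * t ^ i) + poly (lead_coeff H) c * t ^ m"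
      unfolding ev2_altdef assms by (simp add: lessThan_Suc_atMost[symmetric])
    then have eq: "ev2 H c t / t ^ m - poly (lead_coeff H) c =
        (\<Sum>i<m. poly (Polynomial.coeff H i) c * (t ^ i / t ^ m))"
      using t0 by (simp add: add_divide_distrib sum_divide_distrib)
    have "norm (t ^ i / t ^ m) \<le> 1 / norm t" if "i < m" for i
    proof -
      have "norm t ^ Suc i \<le> norm t ^ m" using that t by (intro power_increasing) auto
      then show ?thesis using t t0 by (simp add: norm_divide norm_power field_simps)
    qed
    then have "norm (\<Sum>i<m. poly (Polynomial.coeff H i) c * (t ^ i / t ^ m)) \<le> (\<Sum>i<m. b i * (1 / norm t))"
    proof (intro sum_norm_le)
      fix i assume i: "i \<in> {..<m}"
      have "norm (poly (Polynomial.coeff H i) c) * norm (t ^ i / t ^ m) \<le> b i * (1 / norm t)"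
        using \<open>\<And>i. i < m \<Longrightarrow> norm (t ^ i / t ^ m) \<le> 1 / norm t\<close> i b[OF c] b0
        by (intro mult_mono) auto
      then show "norm (poly (Polynomial.coeff H i) c * (t ^ i / t ^ m)) \<le> b i * (1 / norm t)"
        by (simp only: norm_mult)
    qed
    then show "norm (ev2 H c t / t ^ m - poly (lead_coeff H) c) \<le> (\<Sum>i<m. b i) / norm t"
      unfolding eq by (simp add: sum_divide_distrib)
  qed
qed

text \<open>After division by \<open>t ^ m\<close>, \<open>H\<close> tends to its leading
  coefficient \<open>P\<close> as \<open>t\<close> grows. The given sequence is used only to obtain
  \<open>P(0) = 0\<close>; from there the conclusion holds for every large \<open>t\<close>, in
  whatever direction.\<close>

lemma small_roots_at_infinity:
  fixes H :: "complex poly poly"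
  assumes H: "H \<noteq> 0" and t: "filterlim t at_infinity sequentially" and c: "c \<longlonglongrightarrow> 0"
    and zero: "\<forall>\<^sub>F n in sequentially. ev2 H (c n) (t n) = 0"
  shows "\<forall>\<^sub>F t in at_infinity. \<exists>c. norm c < 1 \<and> ev2 H c t = 0"
proof -
  define m where "m = Polynomial.degree H"
  define P where "P = lead_coeff H"
  have P0: "P \<noteq> 0" using H by (simp add: P_def)
  obtain A where A: "A \<ge> 0" "\<And>c t. norm c \<le> 1 \<Longrightarrow> norm t \<ge> 1 \<Longrightarrow>
    norm (ev2 H c t / t ^ m - poly (lead_coeff H) c) \<le> A / norm t"
    by (rule ev2_leading_bound[OF m_def]) (rule that)
  note A = A[folded P_def]
  have lim0: "(\<lambda>n. A / norm (\<tau> n)) \<longlonglongrightarrow> 0" if "filterlim \<tau> at_infinity sequentially" for \<tau> :: "nat \<Rightarrow> complex"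
    by (rule real_tendsto_divide_at_top[OF tendsto_const filterlim_at_infinity_imp_norm_at_top[OF that]])
  have ev1: "\<forall>\<^sub>F n in sequentially. norm (t n) \<ge> 1"
    using filterlim_at_infinity_imp_norm_at_top[OF t] by (simp add: filterlim_at_top)
  have ev2: "\<forall>\<^sub>F n in sequentially. norm (c n) \<le> 1"
    using tendstoD[OF c, of 1] by (auto elim!: eventually_mono)
  have "(\<lambda>n. poly P (c n)) \<longlonglongrightarrow> 0"
  proof (rule Lim_null_comparison[OF _ lim0[OF t]])
    show "\<forall>\<^sub>F n in sequentially. norm (poly P (c n)) \<le> A / norm (t n)"
      using ev1 ev2 zero
    proof eventually_elim
      case (elim n)
      then show ?case using A(2)[of "c n" "t n"] by simp
    qed
  qed
  moreover have "(\<lambda>n. poly P (c n)) \<longlonglongrightarrow> poly P 0" by (rule tendsto_poly[OF c])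
  ultimately have Pz: "poly P 0 = 0" using LIMSEQ_unique by blast
  show ?thesis
  proof (rule ccontr)
    assume neg: "\<not> ?thesis"
    have "\<exists>t. norm t \<ge> real n + 1 \<and> (\<forall>c. norm c < 1 \<longrightarrow> ev2 H c t \<noteq> 0)" for n :: nat
    proof (rule ccontr)
      assume "\<not> ?thesis"
      then have "\<forall>t. norm t \<ge> real n + 1 \<longrightarrow> (\<exists>c. norm c < 1 \<and> ev2 H c t = 0)" by blast
      then show False using neg unfolding eventually_at_infinity by blast
    qed
    then have "\<exists>\<tau>. \<forall>n. norm (\<tau> n) \<ge> real n + 1 \<and> (\<forall>c. norm c < 1 \<longrightarrow> ev2 H c (\<tau> n) \<noteq> 0)"
      by (intro choice) blast
    then obtain \<tau> where \<tau>: "\<And>n. norm (\<tau> n) \<ge> real n + 1"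
      and nz: "\<And>n c. norm c < 1 \<Longrightarrow> ev2 H c (\<tau> n) \<noteq> 0" by blast
    have \<tau>1: "norm (\<tau> n) \<ge> 1" for n using \<tau>[of n] by simp
    have "filterlim (\<lambda>n. norm (\<tau> n)) at_top sequentially"
    proof (rule filterlim_at_top_mono[OF filterlim_real_sequentially])
      show "\<forall>\<^sub>F n in sequentially. real n \<le> norm (\<tau> n)"
        by (rule always_eventually) (use \<tau> in \<open>metis add.commute add_increasing le_add_same_cancel2 order_trans zero_le_one\<close>)
    qed
    then have \<tau>lim: "filterlim \<tau> at_infinity sequentially"
      by (rule filterlim_norm_at_top_imp_at_infinity)
    have "poly P 0 \<noteq> 0"
    \<comment> \<open>Zero-free functions along \<tau> would converge to the nonconstant
      \<open>P\<close>, which would then be zero-free as well, although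
      \<open>P(0) = 0\<close>.\<close>
    proof (rule Hurwitz_no_zeros[where S = "ball 0 1" and g = "poly P" and \<F> = "\<lambda>n c. ev2 H c (\<tau> n) / \<tau> n ^ m"])
      show "(\<lambda>c. ev2 H c (\<tau> n) / \<tau> n ^ m) holomorphic_on ball 0 1" for n
        unfolding ev2_altdef using \<tau>1[of n] by (intro holomorphic_intros) auto
      show "poly P holomorphic_on ball 0 1" by (intro holomorphic_intros)
      show "uniform_limit K (\<lambda>n c. ev2 H c (\<tau> n) / \<tau> n ^ m) (poly P) sequentially"
        if "compact K" "K \<subseteq> ball 0 1" for K
      proof (rule uniform_limitI)
        fix \<epsilon> :: real assume "\<epsilon> > 0"
        then have "\<forall>\<^sub>F n in sequentially. A / norm (\<tau> n) < \<epsilon>"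
          using order_tendstoD(2)[OF lim0[OF \<tau>lim]] by blast
        then show "\<forall>\<^sub>F n in sequentially. \<forall>c\<in>K. dist (ev2 H c (\<tau> n) / \<tau> n ^ m) (poly P c) < \<epsilon>"
        proof eventually_elim
          case (elim n)
          show ?case
          proof
            fix c assume "c \<in> K"
            then have "norm c \<le> 1" using that(2) by auto
            from A(2)[OF this \<tau>1[of n]] elim
            show "dist (ev2 H c (\<tau> n) / \<tau> n ^ m) (poly P c) < \<epsilon>" by (simp add: dist_norm)
          qed
        qed
      qed
      show "\<not> poly P constant_on ball 0 1"
      proof
        assume "poly P constant_on ball 0 1"
        then obtain k where k: "\<And>x. x \<in> ball 0 1 \<Longrightarrow> poly P x = k" unfolding constant_on_def by blast
        have "k = 0" using k[of 0] Pz by simp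
        then have "ball 0 1 \<subseteq> {x. poly P x = 0}" using k by auto
        then have "finite (ball (0::complex) 1)" using poly_roots_finite[OF P0] finite_subset by blast
        then show False using uncountable_ball[of 1 "0::complex"] countable_finite by auto
      qed
      show "ev2 H z (\<tau> n) / \<tau> n ^ m \<noteq> 0" if "z \<in> ball 0 1" for n z
        using nz[of z n] that \<tau>1[of n] by auto
    qed auto
    then show False using Pz by simp
  qed
qed

lemma eventually_power_root_free:
  fixes B :: "complex poly"
  assumes "B \<noteq> 0" "e \<ge> 1" shows "\<forall>\<^sub>F t in at_infinity. poly B (t ^ e) \<noteq> 0"
proof -
  have "bounded {z. poly B z = 0}" using poly_roots_finite[OF assms(1)] by (rule finite_imp_bounded)
  then obtain R where R: "\<And>z. poly B z = 0 \<Longrightarrow> norm z \<le> R" by (auto simp: bounded_iff)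
  show ?thesis unfolding eventually_at_infinity
  proof (intro exI allI impI)
    fix t :: complex assume t: "max (R + 1) 1 \<le> norm t"
    then have "norm t ^ 1 \<le> norm t ^ e" using assms(2) by (intro power_increasing) auto
    with t have "norm (t ^ e) > R" by (simp add: norm_power)
    then show "poly B (t ^ e) \<noteq> 0" using R by force
  qed
qed

text \<open>All \<open>w * t\<close> with \<open>w ^ e = 1\<close> have the same \<open>e\<close>-th
  power, so the roots of \<open>G\<close> near the values \<open>poly s (w * t)\<close> lie over one
  first coordinate. They are distinct because the displacements are below 1 while the values end up
  at least 2 apart.\<close>

lemma many_roots_from_conjugates:
  fixes G :: "complex poly poly" and s B :: "complex poly"
  assumes G: "G \<noteq> 0" and B: "B \<noteq> 0" and e: "e \<ge> 1"
    and conj: "\<And>w. w ^ e = 1 \<Longrightarrow> w \<noteq> 1 \<Longrightarrow> \<exists>t. poly s (w * t) \<noteq> poly s t"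
    and t: "filterlim t at_infinity sequentially" and c: "c \<longlonglongrightarrow> 0"
    and zero: "\<forall>\<^sub>F n in sequentially. ev2 G (t n ^ e) (poly s (t n) + c n) = 0"
  obtains \<beta> Y where "poly B \<beta> \<noteq> 0" "\<And>y. y \<in> Y \<Longrightarrow> ev2 G \<beta> y = 0" "finite Y" "card Y = e"
proof -
  let ?U = "{w::complex. w ^ e = 1}"
  have fin: "finite ?U" using e by (intro finite_roots_unity) auto
  obtain H where H: "\<And>c t. ev2 H c t = ev2 G (t ^ e) (poly s t + c)" using ev2_substitution by blast
  have "H \<noteq> 0"
  proof
    assume H0: "H = 0"
    obtain x y where xy: "ev2 G x y \<noteq> 0" using ev2_nonzero[OF G] .
    obtain t where "t ^ e = x" using complex_root_exists[OF e] by blast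
    then show False using H[of "y - poly s t" t] H0 xy by simp
  qed
  from small_roots_at_infinity[OF this t c] zero
  have small: "\<forall>\<^sub>F t in at_infinity. \<exists>c. norm c < 1 \<and> ev2 H c t = 0" by (simp add: H)
  have small': "\<forall>\<^sub>F t in at_infinity. \<exists>c. norm c < 1 \<and> ev2 H c (w * t) = 0" if w: "w \<in> ?U" for w
  proof -
    from w have "norm w ^ e = 1" by (metis (mono_tags) mem_Collect_eq norm_one norm_power)
    then have "norm w = 1" using e power_eq_1_iff[of "norm w" e] by (simp add: power_eq_1_iff)
    obtain b where b: "\<And>t. b \<le> norm t \<Longrightarrow> \<exists>c. norm c < 1 \<and> ev2 H c t = 0"
      using small unfolding eventually_at_infinity by blast
    show ?thesis unfolding eventually_at_infinity
      by (rule exI[of _ b]) (use b \<open>norm w = 1\<close> in \<open>auto simp: norm_mult\<close>)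
  qed
  \<comment> \<open>The difference polynomial \<open>d\<close> is nonzero and has constant term 0,
    hence is nonconstant and unbounded at infinity.\<close>
  have sep: "\<forall>\<^sub>F t in at_infinity. norm (poly s (v * t) - poly s (w * t)) \<ge> 2"
    if vw: "v \<in> ?U" "w \<in> ?U" "v \<noteq> w" for v w
  proof -
    define d where "d = pcompose s [:0, v:] - pcompose s [:0, w:]"
    have d: "poly d t = poly s (v * t) - poly s (w * t)" for t
      by (simp add: d_def poly_pcompose mult.commute)
    have w0: "w \<noteq> 0" using vw e by (auto simp: power_0_left split: if_splits)
    have "(v / w) ^ e = 1" "v / w \<noteq> 1" using vw w0 by (auto simp: power_divide)
    from conj[OF this] obtain t where t: "poly s (v / w * t) \<noteq> poly s t" by blast
    then have "poly d (t / w) \<noteq> 0" using w0 by (simp add: d)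
    moreover obtain a p where p: "d = pCons a p" by (cases d) auto
    have "a = 0" using d[of 0] by (simp add: p)
    ultimately have "p \<noteq> 0" using p by auto
    from poly_infinity[OF this, of 2 a] show ?thesis
      unfolding eventually_at_infinity d[symmetric] p by blast
  qed
  have "\<forall>\<^sub>F t in at_infinity. poly B (t ^ e) \<noteq> 0 \<and> (\<forall>w\<in>?U. \<exists>c. norm c < 1 \<and> ev2 H c (w * t) = 0) \<and>
      (\<forall>v\<in>?U. \<forall>w\<in>?U. v \<noteq> w \<longrightarrow> norm (poly s (v * t) - poly s (w * t)) \<ge> 2)"
    by (intro eventually_conj eventually_power_root_free B e eventually_ball_finite[OF fin] ballI small')
       (use sep in \<open>auto intro!: eventually_ball_finite[OF fin]\<close>)
  then obtain t where t: "poly B (t ^ e) \<noteq> 0" "\<forall>w\<in>?U. \<exists>c. norm c < 1 \<and> ev2 H c (w * t) = 0"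
    "\<forall>v\<in>?U. \<forall>w\<in>?U. v \<noteq> w \<longrightarrow> norm (poly s (v * t) - poly s (w * t)) \<ge> 2"
    using eventually_happens trivial_limit_at_infinity by blast
  from bchoice[OF t(2)] obtain \<gamma> where \<gamma>: "\<And>w. w \<in> ?U \<Longrightarrow> norm (\<gamma> w) < 1 \<and> ev2 H (\<gamma> w) (w * t) = 0"
    by blast
  define y where "y w = poly s (w * t) + \<gamma> w" for w
  have "inj_on y ?U"
  proof (rule inj_onI, rule ccontr)
    fix v w assume vw: "v \<in> ?U" "w \<in> ?U" "y v = y w" "v \<noteq> w"
    then have "poly s (v * t) - poly s (w * t) = \<gamma> w - \<gamma> v" by (simp add: y_def algebra_simps)
    then have "norm (poly s (v * t) - poly s (w * t)) \<le> norm (\<gamma> w) + norm (\<gamma> v)"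
      by (simp add: norm_triangle_ineq4)
    moreover have "norm (poly s (v * t) - poly s (w * t)) \<ge> 2" using t(3) vw by blast
    ultimately show False using \<gamma>[OF vw(1)] \<gamma>[OF vw(2)] by linarith
  qed
  then have "card (y ` ?U) = e" using e by (simp add: card_image card_roots_unity_eq)
  moreover have "ev2 G (t ^ e) z = 0" if "z \<in> y ` ?U" for z
    using that \<gamma> by (auto simp: y_def H power_mult_distrib)
  ultimately show ?thesis using that[of "t ^ e" "y ` ?U"] t(1) fin by simp
qed

text \<open>Shifts the parameter so that the first coordinate absorbs the error \<epsilon> exactly.
  The bound \<open>degree s \<le> e\<close> keeps the effect on \<open>s\<close> negligible: the
  change of \<open>t ^ e\<close> is only \<epsilon>, and that of lower powers is controlled by
  it.\<close>

lemma power_perturbation: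
  fixes t \<epsilon> :: "nat \<Rightarrow> complex"
  assumes e: "e \<ge> 1" and deg: "Polynomial.degree s \<le> e"
    and t: "filterlim t at_infinity sequentially" and \<epsilon>: "\<epsilon> \<longlonglongrightarrow> 0"
  obtains t' where "filterlim t' at_infinity sequentially"
    "\<forall>\<^sub>F n in sequentially. t' n ^ e = t n ^ e + \<epsilon> n"
    "(\<lambda>n. poly s (t' n) - poly s (t n)) \<longlonglongrightarrow> 0"
proof -
  have e0: "e \<noteq> 0" using e by simp
  define q where "q n = \<epsilon> n * inverse (t n) ^ e" for n
  \<comment> \<open>\<open>u\<close> is the \<open>e\<close>-th root of 1 + \<epsilon> / t^e close
    to 1, and the new parameter is \<open>t * u\<close>. The geometric sum \<open>S j\<close> is the
    cofactor of \<open>u - 1\<close> in \<open>u ^ j - 1\<close> and tends to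
    \<open>j\<close>.\<close>
  define u where "u n = exp (Ln (1 + q n) / of_nat e)" for n
  define S where "S j n = (\<Sum>i<j. u n ^ i)" for j n
  have inv: "(\<lambda>n. inverse (t n)) \<longlonglongrightarrow> 0" using t by (rule filterlim_compose[OF tendsto_inverse_0])
  have "q \<longlonglongrightarrow> 0 * 0 ^ e" unfolding q_def by (intro tendsto_intros \<epsilon> inv)
  then have q: "q \<longlonglongrightarrow> 0" by simp
  have "(\<lambda>n. 1 + q n) \<longlonglongrightarrow> 1 + 0" by (intro tendsto_intros q)
  then have q1: "(\<lambda>n. 1 + q n) \<longlonglongrightarrow> 1" by simp
  have "u \<longlonglongrightarrow> exp (Ln 1 / of_nat e)" unfolding u_def by (intro tendsto_intros q1) (use e0 in auto)
  then have u: "u \<longlonglongrightarrow> 1" by simp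
  have "S j \<longlonglongrightarrow> (\<Sum>i<j. 1 ^ i)" for j unfolding S_def by (intro tendsto_intros u)
  then have S: "S j \<longlonglongrightarrow> of_nat j" for j by simp
  have ev_u: "\<forall>\<^sub>F n in sequentially. u n ^ e = 1 + q n"
    using tendsto_imp_eventually_ne[OF q1 one_neq_zero]
  proof eventually_elim
    case (elim n)
    then show ?case using e0 by (simp add: u_def exp_of_nat_mult[symmetric])
  qed
  have ev_t: "\<forall>\<^sub>F n in sequentially. norm (t n) \<ge> 1"
    using filterlim_at_infinity_imp_norm_at_top[OF t] by (simp add: filterlim_at_top)
  have ev_S: "\<forall>\<^sub>F n in sequentially. S e n \<noteq> 0"
    using tendsto_imp_eventually_ne[OF S[of e]] e0 by simp
  have diff: "u n ^ j - 1 = (u n - 1) * S j n" for n j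
    by (simp add: S_def power_diff_1_eq)
  have "(\<lambda>n. \<epsilon> n / S e n) \<longlonglongrightarrow> 0 / of_nat e" by (intro tendsto_divide \<epsilon> S) (use e0 in auto)
  moreover have "\<forall>\<^sub>F n in sequentially. t n ^ e * (u n - 1) = \<epsilon> n / S e n"
    using ev_u ev_t ev_S
  proof eventually_elim
    case (elim n)
    then have "t n \<noteq> 0" by auto
    have "(u n - 1) * S e n = q n" using elim(1) diff[of n e] by simp
    then have "t n ^ e * (u n - 1) * S e n = \<epsilon> n" using \<open>t n \<noteq> 0\<close>
      by (simp add: q_def mult.assoc field_simps)
    then show ?case using elim(3) by (simp add: field_simps)
  qed
  ultimately have top: "(\<lambda>n. t n ^ e * (u n - 1)) \<longlonglongrightarrow> 0" by (simp add: filterlim_cong)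
  have low: "(\<lambda>n. t n ^ j * (u n - 1)) \<longlonglongrightarrow> 0" if "j \<le> e" for j
  proof (rule Lim_null_comparison[OF _ tendsto_norm_zero[OF top]])
    show "\<forall>\<^sub>F n in sequentially. norm (t n ^ j * (u n - 1)) \<le> norm (t n ^ e * (u n - 1))"
      using ev_t
    proof eventually_elim
      case (elim n)
      then have "norm (t n) ^ j \<le> norm (t n) ^ e" using that by (intro power_increasing) auto
      then show ?case by (simp add: norm_mult norm_power mult_right_mono)
    qed
  qed
  have pow: "(\<lambda>n. (t n * u n) ^ j - t n ^ j) \<longlonglongrightarrow> 0" if "j \<le> e" for j
  proof -
    have "(\<lambda>n. t n ^ j * (u n - 1) * S j n) \<longlonglongrightarrow> 0 * of_nat j"
      by (intro tendsto_mult low[OF that] S)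
    moreover have "(t n * u n) ^ j - t n ^ j = t n ^ j * (u n - 1) * S j n" for n
    proof -
      have "(t n * u n) ^ j - t n ^ j = t n ^ j * (u n ^ j - 1)"
        by (simp add: power_mult_distrib right_diff_distrib)
      then show ?thesis by (simp only: diff mult.assoc)
    qed
    ultimately show ?thesis by simp
  qed
  show ?thesis
  proof (rule that[of "\<lambda>n. t n * u n"])
    show "filterlim (\<lambda>n. t n * u n) at_infinity sequentially"
      using tendsto_mult_filterlim_at_infinity[OF u one_neq_zero t] by (simp add: mult.commute)
    show "\<forall>\<^sub>F n in sequentially. (t n * u n) ^ e = t n ^ e + \<epsilon> n"
      using ev_u ev_t
    proof eventually_elim
      case (elim n)
      then have "t n \<noteq> 0" by auto
      then show ?case using elim(1) by (simp add: power_mult_distrib q_def algebra_simps power_inverse)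
    qed
    have sum: "poly s x = (\<Sum>j\<le>e. Polynomial.coeff s j * x ^ j)" for x
      unfolding poly_altdef using deg by (intro sum.mono_neutral_left) (auto simp: coeff_eq_0)
    have "(\<lambda>n. \<Sum>j\<le>e. Polynomial.coeff s j * ((t n * u n) ^ j - t n ^ j)) \<longlonglongrightarrow>
        (\<Sum>j\<le>e. Polynomial.coeff s j * 0)"
      by (intro tendsto_sum tendsto_mult tendsto_const pow) auto
    then show "(\<lambda>n. poly s (t n * u n) - poly s (t n)) \<longlonglongrightarrow> 0"
      by (simp add: sum right_diff_distrib sum_subtractf)
  qed
qed

lemma infdist_less_imp:
  assumes "A \<noteq> {}" "infdist x A < \<epsilon>" shows "\<exists>a\<in>A. dist x a < \<epsilon>"
proof (rule ccontr)
  assume "\<not> ?thesis"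
  then have "\<epsilon> \<le> infdist x A"
    unfolding infdist_notempty[OF assms(1)] using assms(1) by (intro cINF_greatest) auto
  with assms(2) show False by simp
qed

context polynomial_space_curve
begin

text \<open>\<open>D\<close> has finitely many components, and closeness at level \<open>n\<close>
  implies closeness at all smaller levels; so one component is close at every level.\<close>

lemma approaching_points:
  assumes D: "algebraic_curve D" and appr: "approaches_at D Q M p"
  obtains A t \<delta> where "irreducible_curve A" "A \<subseteq> D" "filterlim t at_infinity sequentially"
    "\<And>n :: nat. \<delta> n \<in> A" "(\<lambda>n. \<psi> (t n) - \<delta> n) \<longlonglongrightarrow> 0"
proof -
  from D obtain \<A> where \<A>: "finite \<A>" "\<A> \<noteq> {}" "\<And>A. A \<in> \<A> \<Longrightarrow> irreducible_curve A" "D = \<Union>\<A>"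
    unfolding algebraic_curve_def by blast
  have "D \<noteq> {}" using \<A> by (fastforce simp: irreducible_curve_def irreducible_set_def)
  have branch: "\<And>z. norm z > M \<Longrightarrow> p z $ 1 = z \<and> p z \<in> Q"
    and lim: "((\<lambda>z. infdist (p z) D) \<longlongrightarrow> 0) at_infinity"
    using appr by (auto simp: approaches_at_def infinity_branch_def)
  define near where "near A n \<longleftrightarrow> (\<exists>t \<delta>. \<delta> \<in> A \<and> norm t > real n \<and> dist (\<psi> t) \<delta> < 1 / (real n + 1))"
    for A n
  have near_mono: "near A m" if "near A n" "m \<le> n" for A m n
  proof -
    obtain t \<delta> where "\<delta> \<in> A" "norm t > real n" "dist (\<psi> t) \<delta> < 1 / (real n + 1)"
      using \<open>near A n\<close> by (auto simp: near_def)
    moreover have "1 / (real n + 1) \<le> 1 / (real m + 1)" using that(2) by (intro divide_left_mono) auto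
    ultimately show ?thesis using that(2) unfolding near_def by (intro exI[of _ t] exI[of _ \<delta>]) auto
  qed
  have ex: "\<exists>A\<in>\<A>. near A n" for n :: nat
  proof -
    have "\<forall>\<^sub>F z in at_infinity. infdist (p z) D < 1 / (real n + 1)"
      using order_tendstoD(2)[OF lim, of "1 / (real n + 1)"] by simp
    then obtain b where b: "\<And>z. norm z \<ge> b \<Longrightarrow> infdist (p z) D < 1 / (real n + 1)"
      unfolding eventually_at_infinity by blast
    \<comment> \<open>Beyond \<open>b\<close> the distance to \<open>D\<close> is small, beyond
      \<open>M\<close> the branch is defined, and \<open>(real n + 1) ^ e\<close> forces the
      parameter \<open>t\<close> with \<open>t ^ e = z\<close> to have norm at least
      \<open>n + 1\<close>.\<close>
    define R where "R = Max {b, M + 1, (real n + 1) ^ e}"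
    have R: "R \<ge> b" "R \<ge> M + 1" "R \<ge> (real n + 1) ^ e" by (auto simp: R_def)
    define z where "z = complex_of_real R"
    have "R \<ge> 0" using R(3) by (rule order_trans[rotated]) simp
    then have nz: "norm z = R" by (simp add: z_def)
    have z: "p z $ 1 = z" "p z \<in> Q" using branch[of z] R(2) nz by auto
    then obtain t where t: "p z = \<psi> t" by (auto simp: range_closed)
    have "t ^ e = z" using z(1) t by (simp add: \<psi>)
    then have "(real n + 1) ^ e \<le> norm t ^ e" using nz R(3) by (metis norm_power)
    then have nt: "real n + 1 \<le> norm t" using e by (simp add: power_mono_iff)
    have "infdist (\<psi> t) D < 1 / (real n + 1)" using b[of z] nz R(1) t by simp
    then obtain \<delta> where "\<delta> \<in> D" "dist (\<psi> t) \<delta> < 1 / (real n + 1)"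
      using infdist_less_imp[OF \<open>D \<noteq> {}\<close>] by blast
    then show ?thesis using nt \<A>(4) by (force simp: near_def)
  qed
  have "\<exists>A\<in>\<A>. \<forall>n. near A n"
  proof (rule ccontr)
    assume "\<not> ?thesis"
    then have "\<forall>A\<in>\<A>. \<exists>n. \<not> near A n" by blast
    from bchoice[OF this] obtain N where N: "\<And>A. A \<in> \<A> \<Longrightarrow> \<not> near A (N A)" by blast
    obtain A where "A \<in> \<A>" "near A (Max (N ` \<A>))" using ex by blast
    moreover have "N A \<le> Max (N ` \<A>)" using \<A>(1) \<open>A \<in> \<A>\<close> by (intro Max_ge) auto
    ultimately show False using N near_mono by blast
  qed
  then obtain A where A: "A \<in> \<A>" "\<And>n. near A n" by blast
  have "\<forall>n. \<exists>x. snd x \<in> A \<and> norm (fst x) > real n \<and> dist (\<psi> (fst x)) (snd x) < 1 / (real n + 1)"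
    using A(2) by (force simp: near_def)
  from choice[OF this] obtain x where x: "\<And>n. snd (x n) \<in> A" "\<And>n. norm (fst (x n)) > real n"
    "\<And>n. dist (\<psi> (fst (x n))) (snd (x n)) < 1 / (real n + 1)" by blast
  show ?thesis
  proof (rule that[of A "\<lambda>n. fst (x n)" "\<lambda>n. snd (x n)"])
    show "irreducible_curve A" "A \<subseteq> D" using A(1) \<A> by auto
    have "filterlim (\<lambda>n. norm (fst (x n))) at_top sequentially"
      by (rule filterlim_at_top_mono[OF filterlim_real_sequentially]) (intro always_eventually allI less_imp_le x(2))
    then show "filterlim (\<lambda>n. fst (x n)) at_infinity sequentially"
      by (rule filterlim_norm_at_top_imp_at_infinity)
    show "(\<lambda>n. \<psi> (fst (x n)) - snd (x n)) \<longlonglongrightarrow> 0"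
    proof (rule Lim_null_comparison)
      show "\<forall>\<^sub>F n in sequentially. norm (\<psi> (fst (x n)) - snd (x n)) \<le> 1 / (real n + 1)"
        using x(3) by (intro always_eventually allI) (simp add: dist_norm less_imp_le)
      show "(\<lambda>n. 1 / (real n + 1)) \<longlonglongrightarrow> 0"
        using LIMSEQ_Suc[OF lim_inverse_n'] by (simp add: add.commute)
    qed
  qed (use x in auto)
qed

text \<open>The plane \<open>x $ 1 = \<beta>\<close> is the witness: the \<open>e\<close> roots of
  \<open>G\<close> over \<beta> lift to points of \<open>A\<close> with different values of
  \<open>v\<close>.\<close>

lemma approaching_curve_degree:
  assumes conj: "\<And>w. w ^ e = 1 \<Longrightarrow> w \<noteq> 1 \<Longrightarrow> \<exists>t. poly s2 (w * t) \<noteq> poly s2 t \<or> poly s3 (w * t) \<noteq> poly s3 t"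
    and D: "algebraic_curve D" "has_degree D d" "approaches_at D Q M p"
  shows "e \<le> d"
proof -
  let ?U = "{w::complex. w ^ e = 1}"
  have fin: "finite ?U" using e by (intro finite_roots_unity) auto
  have bad: "finite {l. \<forall>t. poly s2 (w * t) + l * poly s3 (w * t) = poly s2 t + l * poly s3 t}" (is "finite ?B")
    if w: "w \<in> ?U - {1}" for w
  proof -
    obtain t where t: "poly s2 (w * t) \<noteq> poly s2 t \<or> poly s3 (w * t) \<noteq> poly s3 t"
      using conj[of w] w by auto
    let ?p = "[:poly s2 (w * t) - poly s2 t, poly s3 (w * t) - poly s3 t:]"
    have "finite {l. poly ?p l = 0}" using t by (intro poly_roots_finite) auto
    moreover have "?B \<subseteq> {l. poly ?p l = 0}" by (auto simp: algebra_simps)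
    ultimately show ?thesis by (rule rev_finite_subset)
  qed
  have "finite (\<Union>w\<in>?U - {1}. {l. \<forall>t. poly s2 (w * t) + l * poly s3 (w * t) = poly s2 t + l * poly s3 t})"
    using fin by (intro finite_UN_I bad) auto
  \<comment> \<open>Conjugates may agree in one of the two coordinates; the combination with a
    generic \<open>l\<close> still separates all of them.\<close>
  from ex_new_if_finite[OF infinite_UNIV_char_0[where 'a = complex] this] obtain l where
    l_new: "l \<notin> (\<Union>w\<in>?U - {1}. {l. \<forall>t. poly s2 (w * t) + l * poly s3 (w * t) = poly s2 t + l * poly s3 t})"
    by blast
  have l: "\<exists>t. poly s2 (w * t) + l * poly s3 (w * t) \<noteq> poly s2 t + l * poly s3 t"
    if "w \<in> ?U - {1}" for w
  proof (rule ccontr)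
    assume "\<not> ?thesis"
    then have "l \<in> {l. \<forall>t. poly s2 (w * t) + l * poly s3 (w * t) = poly s2 t + l * poly s3 t}" by simp
    with that l_new show False by blast
  qed
  define s where "s = s2 + Polynomial.smult l s3"
  have s_deg: "Polynomial.degree s \<le> e"
    unfolding s_def using deg by (intro degree_add_le) (auto intro: order_trans[OF degree_smult_le])
  define v where "v x = x $ 2 + l * x $ 3" for x :: "complex ^ 3"
  have v_psi: "v (\<psi> u) = poly s u" for u by (simp add: v_def s_def \<psi>)
  obtain A t \<delta> where A: "irreducible_curve A" "A \<subseteq> D" and t: "filterlim t at_infinity sequentially"
    and \<delta>: "\<And>n :: nat. \<delta> n \<in> A" and lim: "(\<lambda>n. \<psi> (t n) - \<delta> n) \<longlonglongrightarrow> 0"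
    by (rule approaching_points[OF D(1,3)]) (rule that)
  have lim_nth: "(\<lambda>n. (\<psi> (t n) - \<delta> n) $ i) \<longlonglongrightarrow> 0" for i
    using tendsto_vec_nth[OF lim, of i] by simp
  define \<epsilon> where "\<epsilon> n = \<delta> n $ 1 - t n ^ e" for n
  have \<epsilon>: "\<epsilon> \<longlonglongrightarrow> 0"
    using tendsto_minus[OF lim_nth[of 1]] by (simp add: \<epsilon>_def[abs_def] \<psi>)
  obtain t' where t': "filterlim t' at_infinity sequentially"
    "\<forall>\<^sub>F n in sequentially. t' n ^ e = t n ^ e + \<epsilon> n"
    "(\<lambda>n. poly s (t' n) - poly s (t n)) \<longlonglongrightarrow> 0"
    by (rule power_perturbation[OF e s_deg t \<epsilon>]) (rule that)
  \<comment> \<open>The displacement is measured from \<open>t'\<close>, whose \<open>e\<close>-th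
    power is eventually exactly the first coordinate of \<open>\<delta> n\<close>.\<close>
  define c where "c n = v (\<delta> n) - poly s (t' n)" for n
  have "(\<lambda>n. - (((\<psi> (t n) - \<delta> n) $ 2 + l * (\<psi> (t n) - \<delta> n) $ 3) + (poly s (t' n) - poly s (t n)))) \<longlonglongrightarrow>
      - ((0 + l * 0) + 0)"
    by (intro tendsto_intros lim_nth t'(3))
  moreover have "- (((\<psi> (t n) - \<delta> n) $ 2 + l * (\<psi> (t n) - \<delta> n) $ 3) + (poly s (t' n) - poly s (t n))) = c n" for n
    by (simp add: c_def v_def \<psi> s_def algebra_simps)
  ultimately have c: "c \<longlonglongrightarrow> 0" by simp
  have unbounded: "\<exists>x\<in>A. norm (x $ 1) > R" for R
  proof -
    have "\<forall>\<^sub>F n in sequentially. norm (t' n) > max R 1"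
      using filterlim_at_infinity_imp_norm_at_top[OF t'(1)] unfolding filterlim_at_top_dense by blast
    with t'(2) have "\<forall>\<^sub>F n in sequentially. norm (\<delta> n $ 1) > R"
    proof eventually_elim
      case (elim n)
      then have le: "norm (t' n) ^ 1 \<le> norm (t' n) ^ e" using e by (intro power_increasing) auto
      have "norm (t' n ^ e) > R" using le elim(2) by (simp add: norm_power)
      with elim(1) show ?case by (simp add: \<epsilon>_def)
    qed
    then show ?thesis using \<delta> eventually_happens'[OF sequentially_bot] by blast
  qed
  have coords: "\<exists>g. \<forall>x. x $ i = ev3 g (x $ 1) (v x) (x $ 3)" for i :: 3
  proof (rule UNIV_3_coords[of _ i])
    show "\<exists>g. \<forall>x. x $ 1 = ev3 g (x $ 1) (v x) (x $ 3)"
      by (rule exI[of _ "[:[:[:0, 1:]:]:]"]) (simp add: ev2_const)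
    show "\<exists>g. \<forall>x. x $ 2 = ev3 g (x $ 1) (v x) (x $ 3)"
      by (rule exI[of _ "[:[:0, 1:], [:[:-l:]:]:]"]) (simp add: ev3_pCons ev2_pCons v_def)
    show "\<exists>g. \<forall>x. x $ 3 = ev3 g (x $ 1) (v x) (x $ 3)"
      by (rule exI[of _ "[:0, 1:]"]) (simp add: ev3_pCons)
  qed
  have surj: "\<exists>x :: complex ^ 3. x $ 1 = a \<and> v x = b \<and> x $ 3 = c" for a b c
    by (rule exI[of _ "vector [a, b - l * c, c]"]) (simp add: v_def)
  have "polyfun v" unfolding v_def by (intro polyfun_add polyfun_mult polyfun_coord polyfun_const)
  obtain G B where G: "G \<noteq> 0" "\<And>x. x \<in> A \<Longrightarrow> ev2 G (x $ 1) (v x) = 0" and B: "B \<noteq> 0"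
    and lift: "\<And>\<beta> y. poly B \<beta> \<noteq> 0 \<Longrightarrow> ev2 G \<beta> y = 0 \<Longrightarrow> \<exists>x\<in>A. x $ 1 = \<beta> \<and> v x = y"
    by (rule irreducible_curve_projection[OF A(1) polyfun_coord[of 1] \<open>polyfun v\<close>
        coords surj unbounded]) (rule that)
  from D(1) obtain \<A> where \<A>: "finite \<A>" "\<And>A. A \<in> \<A> \<Longrightarrow> irreducible_curve A" "D = \<Union>\<A>"
    unfolding algebraic_curve_def by blast
  \<comment> \<open>The section must be finite on all components of \<open>D\<close>, not only on
    \<open>A\<close>. If \<beta> differs from the first coordinate of one chosen point of each
    component, no component lies in the plane \<open>x $ 1 = \<beta>\<close>.\<close>
  define first where "first X = (SOME x :: complex ^ 3. x \<in> X) $ 1" for X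
  have fiber: "finite {x \<in> X. x $ 1 = \<beta>}" if X: "X \<in> \<A>" "\<beta> \<noteq> first X" for X :: "(complex ^ 3) set" and \<beta>
  proof -
    have "X \<noteq> {}" using \<A>(2)[OF X(1)] by (simp add: irreducible_curve_def irreducible_set_def)
    then have "(SOME x. x \<in> X) \<in> X" by (simp add: some_in_eq)
    moreover have "(SOME x. x \<in> X) $ 1 - \<beta> \<noteq> 0" using X(2) by (simp add: first_def)
    ultimately have "finite {x \<in> X. x $ 1 - \<beta> = 0}"
      by (intro irreducible_curve_zeros_finite[OF \<A>(2)[OF X(1)] polyfun_diff[OF polyfun_coord polyfun_const]])
    then show ?thesis by simp
  qed
  define B' where "B' = B * (\<Prod>X\<in>\<A>. [:- first X, 1:])"
  have "B' \<noteq> 0" using B \<A>(1) by (simp add: B'_def)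
  have "\<forall>\<^sub>F n in sequentially. ev2 G (t' n ^ e) (poly s (t' n) + c n) = 0"
    using t'(2)
  proof eventually_elim
    case (elim n)
    then have "t' n ^ e = \<delta> n $ 1" by (simp add: \<epsilon>_def)
    then show ?case using G(2)[OF \<delta>[of n]] by (simp add: c_def)
  qed
  moreover have "\<exists>t. poly s (w * t) \<noteq> poly s t" if "w ^ e = 1" "w \<noteq> 1" for w
    using l[of w] that by (simp add: s_def)
  ultimately obtain \<beta> Y where \<beta>: "poly B' \<beta> \<noteq> 0" and Y: "\<And>y. y \<in> Y \<Longrightarrow> ev2 G \<beta> y = 0" "finite Y" "card Y = e"
    using many_roots_from_conjugates[OF G(1) \<open>B' \<noteq> 0\<close> e _ t'(1) c] by blast
  let ?H = "hyperplane (axis 1 1) \<beta> :: (complex ^ 3) set"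
  have H: "x \<in> ?H \<longleftrightarrow> x $ 1 = \<beta>" for x
    by (simp add: hyperplane_def sum_3 axis_def)
  have "finite (D \<inter> ?H)"
  proof -
    have "\<beta> \<noteq> first X" if "X \<in> \<A>" for X
      using \<beta> that \<A>(1) by (auto simp: B'_def poly_prod)
    then have "finite (\<Union>X\<in>\<A>. {x \<in> X. x $ 1 = \<beta>})" using \<A>(1) fiber by blast
    then show ?thesis by (rule rev_finite_subset) (auto simp: \<A>(3) H)
  qed
  moreover have "axis 1 1 \<noteq> (0 :: complex ^ 3)" by (simp add: axis_eq_0_iff)
  ultimately have "card (D \<inter> ?H) \<le> d" using D(2) unfolding has_degree_def by blast
  moreover have "Y \<subseteq> v ` (D \<inter> ?H)"
  proof
    fix y assume "y \<in> Y"
    have "poly B \<beta> \<noteq> 0" using \<beta> by (auto simp: B'_def)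
    from lift[OF this Y(1)[OF \<open>y \<in> Y\<close>]] obtain x where "x \<in> A" "x $ 1 = \<beta>" "v x = y" by blast
    then show "y \<in> v ` (D \<inter> ?H)" using A(2) H by blast
  qed
  then have "card Y \<le> card (D \<inter> ?H)" using surj_card_le[OF \<open>finite (D \<inter> ?H)\<close>] by blast
  ultimately show ?thesis using Y(3) by simp
qed

lemma perfect_Q:
  assumes conj: "\<And>w. w ^ e = 1 \<Longrightarrow> w \<noteq> 1 \<Longrightarrow> \<exists>t. poly s2 (w * t) \<noteq> poly s2 t \<or> poly s3 (w * t) \<noteq> poly s3 t"
  shows "perfect_curve Q"
proof -
  obtain d0 where "d0 \<le> e" "has_degree Q d0" using has_degree_Q by blast
  then show ?thesis
    unfolding perfect_curve_def using algebraic_curve_Q approaching_curve_degree[OF conj]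
    by (meson le_trans not_le)
qed

end

section \<open>Asymptotics of the lift function\<close>

lemma coeff_hom_const: "coeff_hom (\<lambda>c::complex. [:c:])"
  by unfold_locales (auto simp: one_pCons)

lemma coeff_hom_poly: "coeff_hom (\<lambda>p::complex poly. poly p t)"
  by unfold_locales auto

lemma prod_vars_rename:
  fixes x :: "'w::finite \<Rightarrow> 'b::comm_semiring_1" and g :: "'v::finite \<Rightarrow> 'w"
  shows "(\<Prod>j\<in>UNIV. x j ^ Poly_Mapping.lookup (monom_rename g m) j) =
    (\<Prod>i\<in>UNIV. x (g i) ^ Poly_Mapping.lookup m i)"
proof -
  have "(\<Prod>j\<in>UNIV. x j ^ Poly_Mapping.lookup (monom_rename g m) j) =
      (\<Prod>j\<in>UNIV. \<Prod>i\<in>UNIV. x j ^ (Poly_Mapping.lookup m i when g i = j))"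
    by (simp add: monom_rename_def lookup_sum lookup_single power_sum)
  also have "\<dots> = (\<Prod>i\<in>UNIV. \<Prod>j\<in>UNIV. x j ^ (Poly_Mapping.lookup m i when g i = j))"
    by (rule prod.swap)
  also have "\<dots> = (\<Prod>i\<in>UNIV. x (g i) ^ Poly_Mapping.lookup m i)"
  proof (rule prod.cong[OF refl])
    fix i
    have "(\<Prod>j\<in>UNIV. x j ^ (Poly_Mapping.lookup m i when g i = j)) =
        (\<Prod>j\<in>UNIV. if g i = j then x j ^ Poly_Mapping.lookup m i else 1)"
      by (rule prod.cong) (auto simp: when_def)
    then show "(\<Prod>j\<in>UNIV. x j ^ (Poly_Mapping.lookup m i when g i = j)) = x (g i) ^ Poly_Mapping.lookup m i"
      by simp
  qed
  finally show ?thesis .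
qed

lemma eval_rename:
  fixes p :: "(complex, 'v::finite) mpoly" and g :: "'v \<Rightarrow> 'w::finite"
  shows "mpoly_eval id (mpoly_rename g p) x = mpoly_eval id p (\<lambda>i. x (g i))"
proof -
  have "mpoly_eval id (mpoly_rename g p) x = (\<Sum>m\<in>Poly_Mapping.keys p.
      Poly_Mapping.lookup p m * (\<Prod>i\<in>UNIV. x (g i) ^ Poly_Mapping.lookup m i))"
    by (simp add: mpoly_rename_def id_hom.eval_sum id_hom.eval_single prod_vars_rename del: id_apply)
       (simp only: id_apply)
  then show ?thesis by (simp add: mpoly_eval_def)
qed

lemma eval_homogenize:
  fixes p :: "(complex, 'v::finite) mpoly"
  assumes y: "y \<noteq> 0"
  shows "mpoly_eval id (homogenize p) (case_option y (\<lambda>i. y * x i)) = y ^ total_deg p * mpoly_eval id p x"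
proof -
  let ?v = "case_option y (\<lambda>i. y * x i)"
  have mono: "mpoly_eval id (Poly_Mapping.single (monom_rename Some m +
        Poly_Mapping.single None (total_deg p - monom_deg m)) (Poly_Mapping.lookup p m)) ?v =
      y ^ total_deg p * (Poly_Mapping.lookup p m * (\<Prod>i\<in>UNIV. x i ^ Poly_Mapping.lookup m i))"
    if m: "m \<in> Poly_Mapping.keys p" for m
  proof -
    have le: "monom_deg m \<le> total_deg p"
      unfolding total_deg_def using m by (intro Max_ge) auto
    have "(\<Prod>j\<in>UNIV. ?v j ^ Poly_Mapping.lookup (Poly_Mapping.single None (total_deg p - monom_deg m)) j) =
        (\<Prod>j\<in>(UNIV :: 'v option set). if j = None then y ^ (total_deg p - monom_deg m) else 1)"
      by (rule prod.cong) (auto simp: lookup_single when_def)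
    then have 1: "(\<Prod>j\<in>UNIV. ?v j ^ Poly_Mapping.lookup (Poly_Mapping.single None (total_deg p - monom_deg m)) j) =
        y ^ (total_deg p - monom_deg m)" by simp
    have "(\<Prod>i\<in>UNIV. ?v (Some i) ^ Poly_Mapping.lookup m i) =
        y ^ monom_deg m * (\<Prod>i\<in>UNIV. x i ^ Poly_Mapping.lookup m i)"
      by (simp add: power_mult_distrib prod.distrib monom_deg_def power_sum)
    then show ?thesis
      unfolding id_hom.eval_single lookup_add power_add prod.distrib prod_vars_rename 1
      using le by (simp add: power_add[symmetric] mult_ac)
  qed
  show ?thesis
    unfolding homogenize_def id_hom.eval_sum
    by (simp add: mono sum_distrib_left[symmetric] cong: sum.cong) (simp add: mpoly_eval_def)
qed

lemma eval_f3_poly: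
  "mpoly_eval id (f3_poly h1 h2) (\<lambda>i. x $ i) = x $ 3 * ceval h2 (proj12 x) - ceval h1 (proj12 x)"
proof -
  have "(\<lambda>i. x $ emb23 i) = (\<lambda>i. proj12 x $ i)"
  proof
    fix i :: 2
    show "x $ emb23 i = proj12 x $ i"
      using exhaust_2[of i] by (auto simp: emb23_def proj12_def)
  qed
  then show ?thesis
    by (simp add: f3_poly_def id_hom.eval_diff id_hom.eval_mult eval_rename eval_mvar)
qed

text \<open>Dividing the homogeneous coordinates by the last one, \<open>t ^ n\<close>, gives an
  affine point with first coordinate \<open>t ^ k\<close>, at which \<open>f3\<close> is linear in
  the third coordinate.\<close>

lemma poly_F_subst:
  assumes t: "t \<noteq> 0"
  shows "poly (F_subst (homogenize (f3_poly h1 h2)) k n a b) t =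
    (t ^ n) ^ total_deg (f3_poly h1 h2) *
      ((\<Sum>i\<le>k. b i * t ^ (k - i)) * ceval h2 (vector [t ^ k, (\<Sum>i\<le>n + k. a i * t ^ (n + k - i)) / t ^ n]) -
       ceval h1 (vector [t ^ k, (\<Sum>i\<le>n + k. a i * t ^ (n + k - i)) / t ^ n]))"
proof -
  interpret coeff_hom "\<lambda>c::complex. [:c:]" by (rule coeff_hom_const)
  let ?A = "(\<Sum>i\<le>n + k. a i * t ^ (n + k - i))" and ?B = "(\<Sum>i\<le>k. b i * t ^ (k - i))"
  define X :: "complex ^ 3" where "X = vector [t ^ k, ?A / t ^ n, ?B]"
  have "(\<lambda>j. poly (case_option (monom 1 n) (\<lambda>i. (vector [monom 1 (n + k),
              \<Sum>i\<le>n + k. monom (a i) (n + k - i),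
              monom 1 n * (\<Sum>i\<le>k. monom (b i) (k - i))] :: complex poly ^ 3) $ i) j) t) =
      case_option (t ^ n) (\<lambda>i. t ^ n * X $ i)"
  proof
    fix j :: "3 option"
    show "poly (case_option (monom 1 n) (\<lambda>i. (vector [monom 1 (n + k),
              \<Sum>i\<le>n + k. monom (a i) (n + k - i),
              monom 1 n * (\<Sum>i\<le>k. monom (b i) (k - i))] :: complex poly ^ 3) $ i) j) t =
      case_option (t ^ n) (\<lambda>i. t ^ n * X $ i) j"
    proof (cases j)
      case None
      then show ?thesis by (simp add: poly_monom)
    next
      case (Some i)
      then show ?thesis using exhaust_3[of i] t
        by (auto simp: X_def poly_monom power_add poly_sum)
    qed
  qed
  then have "poly (F_subst (homogenize (f3_poly h1 h2)) k n a b) t =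
      mpoly_eval id (homogenize (f3_poly h1 h2)) (case_option (t ^ n) (\<lambda>i. t ^ n * X $ i))"
    unfolding F_subst_def eval_mono_hom[OF coeff_hom_poly] by (simp add: id_def)
  also have "\<dots> = (t ^ n) ^ total_deg (f3_poly h1 h2) * mpoly_eval id (f3_poly h1 h2) (\<lambda>i. X $ i)"
    using t by (intro eval_homogenize) simp
  finally show ?thesis unfolding eval_f3_poly by (simp add: X_def proj12_def)
qed

text \<open>The coefficient at exponent \<mu> - k may depend on the perturbed
  \<open>a (n + k)\<close>; continuity of each coefficient in the perturbation is enough to pass to
  the limit.\<close>

definition coeffs_continuous :: "(complex \<Rightarrow> complex poly) \<Rightarrow> bool" where
  "coeffs_continuous f \<longleftrightarrow> (\<forall>j. continuous_on UNIV (\<lambda>c. Polynomial.coeff (f c) j))"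

lemma coeffs_continuous_const: "coeffs_continuous (\<lambda>_. p)"
  by (simp add: coeffs_continuous_def)

lemma coeffs_continuous_add:
  "coeffs_continuous f \<Longrightarrow> coeffs_continuous g \<Longrightarrow> coeffs_continuous (\<lambda>c. f c + g c)"
  by (auto simp: coeffs_continuous_def intro!: continuous_intros)

lemma coeffs_continuous_mult:
  "coeffs_continuous f \<Longrightarrow> coeffs_continuous g \<Longrightarrow> coeffs_continuous (\<lambda>c. f c * g c)"
  by (auto simp: coeffs_continuous_def coeff_mult intro!: continuous_intros)

lemma coeffs_continuous_power: "coeffs_continuous f \<Longrightarrow> coeffs_continuous (\<lambda>c. f c ^ n)"
  by (induction n) (auto intro: coeffs_continuous_const coeffs_continuous_mult)

lemma coeffs_continuous_sum:
  "(\<And>a. a \<in> A \<Longrightarrow> coeffs_continuous (f a)) \<Longrightarrow> coeffs_continuous (\<lambda>c. \<Sum>a\<in>A. f a c)"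
  by (induction A rule: infinite_finite_induct)
     (auto intro: coeffs_continuous_const coeffs_continuous_add)

lemma coeffs_continuous_prod:
  "(\<And>a. a \<in> A \<Longrightarrow> coeffs_continuous (f a)) \<Longrightarrow> coeffs_continuous (\<lambda>c. \<Prod>a\<in>A. f a c)"
  by (induction A rule: infinite_finite_induct)
     (auto intro: coeffs_continuous_const coeffs_continuous_mult)

lemma coeffs_continuous_monom: "continuous_on UNIV u \<Longrightarrow> coeffs_continuous (\<lambda>c. monom (u c) n)"
  unfolding coeffs_continuous_def
proof
  fix j assume u: "continuous_on UNIV u"
  then show "continuous_on UNIV (\<lambda>c. Polynomial.coeff (monom (u c) n) j)"
    by (cases "n = j") simp_all
qed

lemma coeffs_continuous_F_subst:
  "coeffs_continuous (\<lambda>c. F_subst F k n (a(N := a N + c)) b)"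
  unfolding F_subst_def mpoly_eval_def
proof (intro coeffs_continuous_sum coeffs_continuous_mult coeffs_continuous_const
    coeffs_continuous_prod coeffs_continuous_power)
  fix j :: "3 option"
  have upd: "coeffs_continuous (\<lambda>c. monom ((a(N := a N + c)) i) (n + k - i))" for i
    by (rule coeffs_continuous_monom) (cases "i = N", auto intro: continuous_intros)
  show "coeffs_continuous (\<lambda>c. case_option (monom 1 n) (\<lambda>i. (vector [monom 1 (n + k),
              \<Sum>i\<le>n + k. monom ((a(N := a N + c)) i) (n + k - i),
              monom 1 n * (\<Sum>i\<le>k. monom (b i) (k - i))] :: complex poly ^ 3) $ i) j)"
  proof (cases j)
    case None
    then show ?thesis by (simp add: coeffs_continuous_const)
  next
    case (Some i)
    have "coeffs_continuous (\<lambda>c. (vector [monom 1 (n + k),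
              \<Sum>i\<le>n + k. monom ((a(N := a N + c)) i) (n + k - i),
              monom 1 n * (\<Sum>i\<le>k. monom (b i) (k - i))] :: complex poly ^ 3) $ i)"
      by (rule UNIV_3_coords[of _ i]; simp only: vector_3)
        (rule coeffs_continuous_const coeffs_continuous_sum[OF upd])+
    then show ?thesis using Some by simp
  qed
qed

lemma poly_eq_sum_degree_le:
  fixes p :: "'a::comm_semiring_1 poly"
  shows "Polynomial.degree p \<le> m \<Longrightarrow> poly p x = (\<Sum>i\<le>m. Polynomial.coeff p i * x ^ i)"
  unfolding poly_altdef by (rule sum.mono_neutral_left) (auto simp: coeff_eq_0)

text \<open>A tail of the series perturbs the last coefficient of its truncation by some \<open>c t\<close> that tends to 0
  as \<open>t\<close> tends to infinity; it only affects the terms of exponent at most \<open>m\<close>.\<close>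

lemma leading_coeff_perturbed:
  assumes f: "coeffs_continuous f" and deg: "\<And>c j. j > m \<Longrightarrow> Polynomial.coeff (f c) j = 0"
    and c: "(c \<longlongrightarrow> 0) F" and t: "filterlim t at_infinity F"
  shows "((\<lambda>w. poly (f (c w)) (t w) / t w ^ m) \<longlongrightarrow> Polynomial.coeff (f 0) m) F"
proof -
  have "((\<lambda>w. \<Sum>j<m. Polynomial.coeff (f (c w)) j * inverse (t w) ^ (m - j)) \<longlongrightarrow>
      (\<Sum>j<m. Polynomial.coeff (f 0) j * 0 ^ (m - j))) F"
  proof (intro tendsto_sum tendsto_mult tendsto_power)
    show "((\<lambda>w. Polynomial.coeff (f (c w)) j) \<longlongrightarrow> Polynomial.coeff (f 0) j) F" for j
    proof -
      have "isCont (\<lambda>c. Polynomial.coeff (f c) j) 0"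
        using f by (simp add: coeffs_continuous_def continuous_on_eq_continuous_at)
      then show ?thesis using c by (rule isCont_tendsto_compose)
    qed
    show "((\<lambda>w. inverse (t w)) \<longlongrightarrow> 0) F" using t by (rule filterlim_compose[OF tendsto_inverse_0])
  qed
  moreover have "((\<lambda>w. Polynomial.coeff (f (c w)) m) \<longlongrightarrow> Polynomial.coeff (f 0) m) F"
  proof -
    have "isCont (\<lambda>c. Polynomial.coeff (f c) m) 0"
      using f by (simp add: coeffs_continuous_def continuous_on_eq_continuous_at)
    then show ?thesis using c by (rule isCont_tendsto_compose)
  qed
  moreover have "(\<Sum>j<m. Polynomial.coeff (f 0) j * 0 ^ (m - j)) = 0"
    by (intro sum.neutral) (auto simp: power_0_left)
  ultimately have "((\<lambda>w. (\<Sum>j<m. Polynomial.coeff (f (c w)) j * inverse (t w) ^ (m - j)) +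
      Polynomial.coeff (f (c w)) m) \<longlongrightarrow> 0 + Polynomial.coeff (f 0) m) F"
    by (intro tendsto_add) auto
  moreover have "\<forall>\<^sub>F w in F. (\<Sum>j<m. Polynomial.coeff (f (c w)) j * inverse (t w) ^ (m - j)) +
      Polynomial.coeff (f (c w)) m = poly (f (c w)) (t w) / t w ^ m"
    using t[THEN filterlim_at_infinity_imp_eventually_ne, of 0]
  proof eventually_elim
    case (elim w)
    have "Polynomial.degree (f (c w)) \<le> m" using deg by (intro degree_le) auto
    then have "poly (f (c w)) (t w) = (\<Sum>j\<le>m. Polynomial.coeff (f (c w)) j * t w ^ j)"
      by (rule poly_eq_sum_degree_le)
    also have "\<dots> = (\<Sum>j<m. Polynomial.coeff (f (c w)) j * t w ^ j) + Polynomial.coeff (f (c w)) m * t w ^ m"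
      by (simp add: lessThan_Suc_atMost[symmetric])
    also have "\<dots> / t w ^ m = (\<Sum>j<m. Polynomial.coeff (f (c w)) j * inverse (t w) ^ (m - j)) +
        Polynomial.coeff (f (c w)) m"
    proof -
      have "t w ^ j / t w ^ m = inverse (t w) ^ (m - j)" if "j < m" for j
        using elim that by (simp add: power_diff field_simps)
      then show ?thesis
        using elim by (simp add: add_divide_distrib sum_divide_distrib times_divide_eq_right[symmetric]
            del: times_divide_eq_right)
    qed
    finally show ?case by simp
  qed
  ultimately show ?thesis by (simp add: filterlim_cong)
qed

text \<open>The difference is \<open>w\<close> times the power series with coefficients
  \<open>a (i + N + 1)\<close>, which is continuous at 0.\<close>

lemma series_tail_tendsto:
  fixes a :: "nat \<Rightarrow> complex" and w0 :: complex
  assumes w0: "w0 \<noteq> 0" and R: "\<And>w. norm w < norm w0 \<Longrightarrow> (\<lambda>i. a i * w ^ i) sums R w"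
  shows "((\<lambda>w. inverse w ^ N * R w - (\<Sum>i\<le>N. a i * inverse w ^ (N - i))) \<longlongrightarrow> 0) (at 0)"
proof -
  define m where "m = Suc N"
  define g where "g w = suminf (\<lambda>i. a (i + m) * w ^ i)" for w
  define w1 where "w1 = w0 / 2"
  have w1: "w1 \<noteq> 0" "norm w1 < norm w0" using w0 by (auto simp: w1_def norm_divide)
  have shift: "summable (\<lambda>i. a (i + m) * w ^ i)" if "norm w < norm w0" "w \<noteq> 0" for w
  proof -
    have "summable (\<lambda>i. a (i + m) * w ^ (i + m))"
      using R[OF that(1)] by (subst summable_iff_shift) (rule sums_summable)
    from summable_mult[OF this, of "inverse w ^ m"] show ?thesis
      using that(2) by (simp add: power_add field_simps)
  qed
  have "isCont g 0"
    unfolding g_def by (rule isCont_powser[OF shift[OF w1(2,1)]]) (use w1 in simp)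
  then have "(g \<longlongrightarrow> g 0) (at 0)" by (simp add: isCont_def)
  then have "((\<lambda>w. w * g w) \<longlongrightarrow> 0 * g 0) (at 0)" by (intro tendsto_mult tendsto_ident_at)
  then have lim: "((\<lambda>w. w * g w) \<longlongrightarrow> 0) (at 0)" by simp
  have "\<forall>\<^sub>F w in at 0. w * g w = inverse w ^ N * R w - (\<Sum>i\<le>N. a i * inverse w ^ (N - i))"
  proof -
    have "\<forall>\<^sub>F w in at 0. w \<noteq> 0 \<and> norm w < norm w0"
      unfolding eventually_at using w0 by (intro exI[of _ "norm w0"]) auto
    then show ?thesis
    proof eventually_elim
      case (elim w)
      then have "R w = suminf (\<lambda>i. a i * w ^ i)" using R sums_unique by blast
      also have "\<dots> = suminf (\<lambda>i. a (i + m) * w ^ (i + m)) + (\<Sum>i<m. a i * w ^ i)"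
        using R elim by (intro suminf_split_initial_segment) (auto simp: sums_iff)
      also have "suminf (\<lambda>i. a (i + m) * w ^ (i + m)) = suminf (\<lambda>i. (a (i + m) * w ^ i) * w ^ m)"
        by (simp add: power_add mult.assoc)
      also have "\<dots> = g w * w ^ m"
        unfolding g_def using shift elim by (intro suminf_mult2[symmetric]) auto
      finally have "inverse w ^ N * R w = g w * w ^ m * inverse w ^ N + (\<Sum>i<m. a i * w ^ i * inverse w ^ N)"
        by (simp add: algebra_simps sum_distrib_left)
      also have "g w * w ^ m * inverse w ^ N = w * g w"
        using elim by (simp add: m_def power_inverse field_simps)
      also have "(\<Sum>i<m. a i * w ^ i * inverse w ^ N) = (\<Sum>i\<le>N. a i * inverse w ^ (N - i))"
        unfolding m_def lessThan_Suc_atMost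
      proof (rule sum.cong[OF refl])
        fix i assume "i \<in> {..N}"
        then have "inverse w ^ N = inverse w ^ (N - i) * inverse w ^ i" by (simp add: power_add[symmetric])
        then show "a i * w ^ i * inverse w ^ N = a i * inverse w ^ (N - i)"
          using elim by (simp add: power_inverse field_simps)
      qed
      finally show ?case by simp
    qed
  qed
  with lim show ?thesis by (rule Lim_transform_eventually)
qed

text \<open>Here \<open>w\<close> is the local parameter at infinity, so \<open>inverse w\<close>
  plays the role of \<open>t\<close>.\<close>

lemma lift_asymptotics:
  fixes a b :: "nat \<Rightarrow> complex" and w0 :: complex
  assumes k: "k \<ge> 1" and w0: "w0 \<noteq> 0"
    and R: "\<And>w. norm w < norm w0 \<Longrightarrow> (\<lambda>i. a i * w ^ i) sums R w"
    and expansion: "Lambda_expansion (homogenize (f3_poly h1 h2)) k a n \<mu> r \<rho> \<rho>s"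
    and zero: "\<forall>i\<le>k. Lambda \<rho> \<rho>s i a b = 0"
  defines "x \<equiv> \<lambda>w. vector [inverse w ^ k, inverse w ^ k * R w] :: complex ^ 2"
  shows "\<forall>\<^sub>F w in at 0. ceval h2 (x w) \<noteq> 0"
    and "((\<lambda>w. (\<Sum>i\<le>k. b i * inverse w ^ (k - i)) - lift_function h1 h2 (x w)) \<longlongrightarrow> 0) (at 0)"
proof -
  define N where "N = n + k"
  \<comment> \<open>The first exponent at which the expansion for \<open>b\<close> and the one for
    \<open>b'\<close> can differ; above it both have zero coefficients.\<close>
  define m where "m = \<mu> - k"
  define c where "c w = inverse w ^ N * R w - (\<Sum>i\<le>N. a i * inverse w ^ (N - i))" for w
  \<comment> \<open>With \<open>c w\<close> added to its last coefficient, the truncated sum equals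
    the full series at \<open>w\<close>.\<close>
  define a' where "a' c = a(N := a N + c)" for c
  define b' where "b' = b(k := b k + 1)"
  define f where "f b c = F_subst (homogenize (f3_poly h1 h2)) k n (a' c) b" for b c
  have ex: "k \<le> \<mu>" "r \<le> n" "\<rho> a \<noteq> 0"
    and \<rho>: "\<And>a' a''. (\<forall>i\<le>r. a' i = a'' i) \<Longrightarrow> \<rho> a' = \<rho> a''"
    and \<rho>s: "\<And>j a' a'' b b'. j \<le> k \<Longrightarrow> (\<forall>i\<le>r + j. a' i = a'' i) \<Longrightarrow> (\<forall>i<j. b i = b' i) \<Longrightarrow>
      \<rho>s j a' b = \<rho>s j a'' b'"
    and F: "\<And>a' b. (\<forall>i\<le>r. a' i = a i) \<Longrightarrow>
      Polynomial.degree (F_subst (homogenize (f3_poly h1 h2)) k n a' b) \<le> \<mu> \<and>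
      (\<forall>j\<le>k. Polynomial.coeff (F_subst (homogenize (f3_poly h1 h2)) k n a' b) (\<mu> - j) = Lambda \<rho> \<rho>s j a' b)"
    using expansion unfolding Lambda_expansion_def by blast+
  have a'_low: "a' c i = a i" if "i < N" for c i using that by (simp add: a'_def)
  have a'_r: "\<forall>i\<le>r. a' c i = a i" for c using a'_low ex(2) k by (simp add: N_def)
  have f_deg: "Polynomial.degree (f b c) \<le> \<mu>" for b c using F[OF a'_r] by (simp add: f_def)
  have f_coeff: "Polynomial.coeff (f b c) (\<mu> - j) = Lambda \<rho> \<rho>s j (a' c) b" if "j \<le> k" for b c j
    using F[OF a'_r] that by (simp add: f_def)
  have \<rho>_a': "\<rho> (a' c) = \<rho> a" for c using a'_r by (intro \<rho>)
  \<comment> \<open>For j < k the indices up to \<open>r + j\<close> stay below \<open>N\<close>, so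
    neither the perturbation of \<open>a N\<close> nor a change of \<open>b k\<close> is
    visible.\<close>
  have low: "Lambda \<rho> \<rho>s j (a' c) \<beta> = 0" if j: "j < k" and \<beta>: "\<forall>i<k. \<beta> i = b i" for j c \<beta>
  proof -
    have "\<rho>s j (a' c) \<beta> = \<rho>s j a b"
      using j \<beta> ex(2) by (intro \<rho>s) (auto intro!: a'_low simp: N_def)
    then have "Lambda \<rho> \<rho>s j (a' c) \<beta> = Lambda \<rho> \<rho>s j a b"
      using j \<beta> by (simp add: Lambda_def \<rho>_a')
    then show ?thesis using zero j by simp
  qed
  have vanish: "Polynomial.coeff (f \<beta> c) i = 0" if i: "i > m" and \<beta>: "\<forall>i<k. \<beta> i = b i" for i c \<beta>
  proof (cases "i \<le> \<mu>")
    case True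
    then have "\<mu> - (\<mu> - i) = i" "\<mu> - i < k" using i ex(1) by (auto simp: m_def)
    then show ?thesis using f_coeff[of "\<mu> - i" \<beta> c] low[OF _ \<beta>, of "\<mu> - i" c] by simp
  next
    case False
    then show ?thesis using f_deg[of \<beta> c] by (intro coeff_eq_0) simp
  qed
  have a'0: "a' 0 = a" by (simp add: a'_def)
  have top: "Polynomial.coeff (f b 0) m = 0"
    using f_coeff[of k b 0] zero by (simp add: m_def a'0)
  \<comment> \<open>Raising \<open>b k\<close> by 1 leaves \<rho>s at \<open>k\<close> unchanged, so
    the coefficient at \<open>m\<close> grows by exactly \<rho>.\<close>
  have "\<rho>s k a b' = \<rho>s k a b" by (rule \<rho>s) (auto simp: b'_def)
  then have "Lambda \<rho> \<rho>s k a b' = Lambda \<rho> \<rho>s k a b + \<rho> a"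
    by (simp add: Lambda_def b'_def algebra_simps)
  then have top': "Polynomial.coeff (f b' 0) m = \<rho> a"
    using f_coeff[of k b' 0] zero by (simp add: m_def a'0)
  have cont: "coeffs_continuous (f \<beta>)" for \<beta>
    unfolding f_def a'_def by (rule coeffs_continuous_F_subst)
  have c_lim: "(c \<longlongrightarrow> 0) (at 0)"
    unfolding c_def by (rule series_tail_tendsto[OF w0 R])
  have inv: "filterlim inverse at_infinity (at (0::complex))" by (rule filterlim_inverse_at_infinity)
  have "((\<lambda>w. poly (f b (c w)) (inverse w) / inverse w ^ m) \<longlongrightarrow> Polynomial.coeff (f b 0) m) (at 0)"
    by (rule leading_coeff_perturbed[OF cont _ c_lim inv]) (simp add: vanish)
  then have lim: "((\<lambda>w. poly (f b (c w)) (inverse w) / inverse w ^ m) \<longlongrightarrow> 0) (at 0)"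
    by (simp only: top)
  have lim': "((\<lambda>w. poly (f b' (c w)) (inverse w) / inverse w ^ m) \<longlongrightarrow> \<rho> a) (at 0)"
    unfolding top'[symmetric]
    by (rule leading_coeff_perturbed[OF cont _ c_lim inv]) (simp add: vanish b'_def)
  define q where "q w = (\<Sum>i\<le>k. b i * inverse w ^ (k - i))" for w
  \<comment> \<open>The power of \<open>t ^ n\<close> from homogenization; it cancels in the final
    quotient.\<close>
  define E where "E w = ((inverse w :: complex) ^ n) ^ total_deg (f3_poly h1 h2)" for w
  have nz: "\<forall>\<^sub>F w in at (0::complex). w \<noteq> 0" by (rule eventually_neq_at_within)
  have sum_a': "(\<Sum>i\<le>n + k. a' (c w) i * inverse w ^ (n + k - i)) / inverse w ^ n = inverse w ^ k * R w"
    if "w \<noteq> 0" for w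
  proof -
    have "(\<Sum>i\<le>N. a' (c w) i * inverse w ^ (N - i)) =
        (\<Sum>i\<le>N. a i * inverse w ^ (N - i) + (if i = N then c w else 0))"
      by (intro sum.cong) (auto simp: a'_def algebra_simps)
    also have "\<dots> = inverse w ^ N * R w" by (simp add: sum.distrib c_def)
    finally show ?thesis using that by (simp add: N_def power_add)
  qed
  have sum_b': "(\<Sum>i\<le>k. b' i * inverse w ^ (k - i)) = q w + 1" for w
  proof -
    have "(\<Sum>i\<le>k. b' i * inverse w ^ (k - i)) =
        (\<Sum>i\<le>k. b i * inverse w ^ (k - i) + (if i = k then 1 else 0))"
      by (intro sum.cong) (auto simp: b'_def algebra_simps)
    then show ?thesis by (simp add: sum.distrib q_def)
  qed
  have f_b: "poly (f b (c w)) (inverse w) = E w * (q w * ceval h2 (x w) - ceval h1 (x w))"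
    and f_b': "poly (f b' (c w)) (inverse w) = E w * ((q w + 1) * ceval h2 (x w) - ceval h1 (x w))"
    if "w \<noteq> 0" for w
    unfolding f_def using that by (simp_all add: poly_F_subst sum_a' sum_b' x_def E_def q_def)
  have "((\<lambda>w. poly (f b' (c w)) (inverse w) / inverse w ^ m - poly (f b (c w)) (inverse w) / inverse w ^ m)
      \<longlongrightarrow> \<rho> a) (at 0)"
    using tendsto_diff[OF lim' lim] by simp
  moreover have "\<forall>\<^sub>F w in at 0. poly (f b' (c w)) (inverse w) / inverse w ^ m - poly (f b (c w)) (inverse w) / inverse w ^ m
      = E w * ceval h2 (x w) / inverse w ^ m"
    using nz
  proof eventually_elim
    case (elim w)
    have "poly (f b' (c w)) (inverse w) - poly (f b (c w)) (inverse w) = E w * ceval h2 (x w)"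
      unfolding f_b[OF elim] f_b'[OF elim] by (simp add: ring_distribs)
    then show ?case by (simp only: diff_divide_distrib[symmetric])
  qed
  ultimately have V: "((\<lambda>w. E w * ceval h2 (x w) / inverse w ^ m) \<longlongrightarrow> \<rho> a) (at 0)"
    by (rule Lim_transform_eventually)
  from tendsto_imp_eventually_ne[OF V ex(3)]
  have V_nz: "\<forall>\<^sub>F w in at 0. E w * ceval h2 (x w) / inverse w ^ m \<noteq> 0" .
  then show "\<forall>\<^sub>F w in at 0. ceval h2 (x w) \<noteq> 0" by (rule eventually_mono) auto
  have "((\<lambda>w. (poly (f b (c w)) (inverse w) / inverse w ^ m) / (E w * ceval h2 (x w) / inverse w ^ m))
      \<longlongrightarrow> 0 / \<rho> a) (at 0)"
    by (intro tendsto_divide lim V ex(3))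
  then have "((\<lambda>w. (poly (f b (c w)) (inverse w) / inverse w ^ m) / (E w * ceval h2 (x w) / inverse w ^ m))
      \<longlongrightarrow> 0) (at 0)" by simp
  then show "((\<lambda>w. (\<Sum>i\<le>k. b i * inverse w ^ (k - i)) - lift_function h1 h2 (x w)) \<longlongrightarrow> 0) (at 0)"
  proof (rule Lim_transform_eventually)
    show "\<forall>\<^sub>F w in at 0. (poly (f b (c w)) (inverse w) / inverse w ^ m) / (E w * ceval h2 (x w) / inverse w ^ m) =
        (\<Sum>i\<le>k. b i * inverse w ^ (k - i)) - lift_function h1 h2 (x w)"
      using nz V_nz
    proof eventually_elim
      case (elim w)
      then have "E w \<noteq> 0" "ceval h2 (x w) \<noteq> 0" "inverse w ^ m \<noteq> 0" by auto
      then have "(poly (f b (c w)) (inverse w) / inverse w ^ m) / (E w * ceval h2 (x w) / inverse w ^ m) =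
          q w - ceval h1 (x w) / ceval h2 (x w)"
        unfolding f_b[OF elim(1)] using elim(1) by (simp add: divide_simps)
      then show ?case by (simp add: q_def lift_function_def)
    qed
  qed
qed

section \<open>Holomorphy of the lift and proper parametrizations\<close>

lemma holomorphic_on_ceval:
  fixes p :: "(complex, 'n::finite) mpoly"
  assumes "\<And>i. (\<lambda>w. x w $ i) holomorphic_on S"
  shows "(\<lambda>w. ceval p (x w)) holomorphic_on S"
proof -
  have "(\<lambda>w. f (x w)) holomorphic_on S" if "polyfun f" for f
    using that by (induction rule: polyfun.induct) (auto intro!: holomorphic_intros assms)
  then show ?thesis using polyfun_ceval by blast
qed

text \<open>Dividing all exponents by their greatest common divisor makes the parametrization
  distinguish the \<open>e\<close>-th roots of unity.\<close>

lemma proper_reparametrization: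
  fixes p2 p3 :: "complex poly"
  assumes k: "k \<ge> 1" and deg: "Polynomial.degree p2 \<le> k" "Polynomial.degree p3 \<le> k"
  obtains e g :: nat and s2 s3 where "e \<ge> 1" "g \<ge> 1" "k = g * e"
    "Polynomial.degree s2 \<le> e" "Polynomial.degree s3 \<le> e"
    "\<And>t. poly p2 t = poly s2 (t ^ g)" "\<And>t. poly p3 t = poly s3 (t ^ g)"
    "\<And>w. w ^ e = 1 \<Longrightarrow> w \<noteq> 1 \<Longrightarrow> \<exists>t. poly s2 (w * t) \<noteq> poly s2 t \<or> poly s3 (w * t) \<noteq> poly s3 t"
proof -
  \<comment> \<open>Including \<open>k\<close> makes \<open>g\<close> divide the exponent of the
    first coordinate as well.\<close>
  define S where "S = insert k ({i. Polynomial.coeff p2 i \<noteq> 0} \<union> {i. Polynomial.coeff p3 i \<noteq> 0})"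
  define g where "g = Gcd S"
  have g: "g dvd i" if "i \<in> S" for i using that by (simp add: g_def)
  have "g dvd k" using g by (simp add: S_def)
  then have g1: "g \<ge> 1" using k by (cases g) auto
  define e where "e = k div g"
  have ke: "k = g * e" using \<open>g dvd k\<close> by (simp add: e_def)
  then have e1: "e \<ge> 1" using k by (cases e) auto
  define red where "red p = (\<Sum>i\<le>Polynomial.degree p. monom (Polynomial.coeff p i) (i div g))" for p :: "complex poly"
  have red_deg: "Polynomial.degree (red p) \<le> e" if "Polynomial.degree p \<le> k" for p
    unfolding red_def e_def using that
    by (intro degree_sum_le) (auto intro!: order_trans[OF degree_monom_le] div_le_mono)
  have red_poly: "poly p t = poly (red p) (t ^ g)" if "{i. Polynomial.coeff p i \<noteq> 0} \<subseteq> S" for p t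
  proof -
    have "poly (red p) (t ^ g) = (\<Sum>i\<le>Polynomial.degree p. Polynomial.coeff p i * t ^ (g * (i div g)))"
      by (simp add: red_def poly_sum poly_monom power_mult)
    also have "\<dots> = (\<Sum>i\<le>Polynomial.degree p. Polynomial.coeff p i * t ^ i)"
      using that g by (intro sum.cong) auto
    finally show ?thesis by (simp add: poly_altdef)
  qed
  have red_pow: "w ^ (i div g) = 1"
    if w: "\<And>t. poly (red p) (w * t) = poly (red p) t" and p: "{i. Polynomial.coeff p i \<noteq> 0} \<subseteq> S"
      and i: "Polynomial.coeff p i \<noteq> 0" for w p i
  proof -
    have coeff: "Polynomial.coeff (red p) (i div g) = Polynomial.coeff p i"
    proof -
      have "Polynomial.coeff (red p) (i div g) =
          (\<Sum>j\<le>Polynomial.degree p. if j div g = i div g then Polynomial.coeff p j else 0)"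
        by (simp add: red_def coeff_sum)
      also have "\<dots> = (\<Sum>j\<le>Polynomial.degree p. if j = i then Polynomial.coeff p j else 0)"
      proof (rule sum.cong[OF refl])
        fix j
        have "j = i" if "j div g = i div g" "Polynomial.coeff p j \<noteq> 0"
          using that g[of j] g[of i] p i by (metis (mono_tags, lifting) dvd_div_mult_self mem_Collect_eq subsetD)
        then show "(if j div g = i div g then Polynomial.coeff p j else 0) =
            (if j = i then Polynomial.coeff p j else 0)" by auto
      qed
      also have "\<dots> = Polynomial.coeff p i" using le_degree[OF i] by simp
      finally show ?thesis .
    qed
    have "pcompose (red p) [:0, w:] = red p"
      unfolding poly_eq_poly_eq_iff[symmetric]
      by (rule ext) (use w in \<open>simp add: poly_pcompose mult.commute\<close>)
    then have "Polynomial.coeff (pcompose (red p) [:0, w:]) (i div g) = Polynomial.coeff (red p) (i div g)"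
      by simp
    moreover have "Polynomial.coeff (pcompose q [:0, w:]) j = w ^ j * Polynomial.coeff q j" for q j
      by (rule coeff_pcompose_linear)
    ultimately show ?thesis using coeff i by simp
  qed
  show ?thesis
  proof (rule that[of e g "red p2" "red p3"])
    fix w :: complex assume w: "w ^ e = 1" "w \<noteq> 1"
    show "\<exists>t. poly (red p2) (w * t) \<noteq> poly (red p2) t \<or> poly (red p3) (w * t) \<noteq> poly (red p3) t"
    proof (rule ccontr)
      assume "\<not> ?thesis"
      then have inv: "\<And>t. poly (red p2) (w * t) = poly (red p2) t" "\<And>t. poly (red p3) (w * t) = poly (red p3) t"
        by blast+
      have pow: "w ^ (i div g) = 1" if "i \<in> S" for i
        using that w(1) red_pow[OF inv(1)] red_pow[OF inv(2)] unfolding S_def e_def by blast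
      \<comment> \<open>The order of \<open>w\<close>. It divides each reduced exponent, so
        \<open>m * g\<close> divides all of \<open>S\<close> and therefore \<open>g\<close>, which
        forces \<open>m = 1\<close>.\<close>
      define m where "m = (LEAST m. m > 0 \<and> w ^ m = 1)"
      have "m > 0 \<and> w ^ m = 1" unfolding m_def by (rule LeastI[of _ e]) (use e1 w in auto)
      have m_dvd: "m dvd j" if j: "w ^ j = 1" for j
      proof (rule ccontr)
        assume "\<not> m dvd j"
        then have "j mod m > 0" by (simp add: dvd_eq_mod_eq_0)
        have "w ^ j = w ^ (m * (j div m) + j mod m)" by simp
        also have "\<dots> = w ^ (j mod m)" unfolding power_add power_mult using \<open>m > 0 \<and> w ^ m = 1\<close> by simp
        finally have "w ^ (j mod m) = 1" using j by simp
        then have "m \<le> j mod m" unfolding m_def using \<open>j mod m > 0\<close> m_def by (intro Least_le) auto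
        then show False using \<open>m > 0 \<and> w ^ m = 1\<close> mod_less_divisor[of m j] by linarith
      qed
      have "m * g dvd i" if "i \<in> S" for i
        using m_dvd[OF pow[OF that]] g[OF that] by (metis dvd_div_mult_self dvd_refl mult_dvd_mono)
      then have "m * g dvd g" unfolding g_def by (rule Gcd_greatest)
      then have "m * g \<le> 1 * g" using g1 dvd_imp_le[of "m * g" g] by simp
      then have "m = 1" using g1 \<open>m > 0 \<and> w ^ m = 1\<close> mult_le_cancel2[of m g 1] by auto
      then show False using \<open>m > 0 \<and> w ^ m = 1\<close> w(2) by simp
    qed
  qed (use e1 g1 ke red_deg deg red_poly in \<open>auto simp: S_def\<close>)
qed

section \<open>Puiseux series at infinity\<close>

lemma norm_less_of_power_inverse:
  assumes "k \<ge> 1" "\<eta> > 0" "w ^ k = inverse z" "norm z > 1 / \<eta> ^ k"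
  shows "norm (w :: complex) < \<eta>"
proof -
  have "norm w ^ k = 1 / norm z" using assms(3) by (metis norm_power norm_inverse inverse_eq_divide)
  also have "1 / norm z < \<eta> ^ k"
  proof -
    have "\<eta> ^ k > 0" using assms(2) by simp
    then have "1 < norm z * \<eta> ^ k" "norm z > 0"
      using assms(4) less_trans[of 0 "1 / \<eta> ^ k" "norm z"] by (simp_all add: pos_divide_less_eq)
    then show ?thesis by (simp add: pos_divide_less_eq mult.commute)
  qed
  finally show ?thesis using assms(2) by (intro power_less_imp_less_base[of "norm w" k]) auto
qed

lemma principal_root_power:
  assumes "k \<ge> 1" "z \<noteq> 0" shows "(inverse z powr (1 / of_nat k)) ^ k = inverse (z :: complex)"
proof -
  have "(inverse z powr (1 / of_nat k)) ^ k = exp (1 / of_nat k * Ln (inverse z)) ^ k"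
    using assms by (simp add: powr_def)
  also have "\<dots> = exp (of_nat k * (1 / of_nat k * Ln (inverse z)))"
    by (rule exp_of_nat_mult[symmetric])
  also have "\<dots> = exp (Ln (inverse z))" using assms by simp
  also have "\<dots> = inverse z" using assms by simp
  finally show ?thesis .
qed

lemma puiseux_at_infinity_mono:
  "puiseux_at_infinity N c M f \<Longrightarrow> M \<le> M' \<Longrightarrow> (\<And>z. norm z > M' \<Longrightarrow> g z = f z) \<Longrightarrow> puiseux_at_infinity N c M' g"
  unfolding puiseux_at_infinity_def by auto

lemma puiseux_identity: "puiseux_at_infinity 1 (\<lambda>i. if i = 0 then 1 else 0) M (\<lambda>z. z)"
  unfolding puiseux_at_infinity_def
proof (intro conjI allI impI)
  fix z :: complex
  have "(\<lambda>i. if i = 0 then z else 0) sums z"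
    using sums_If_finite_set[of "{0::nat}" "\<lambda>_. z"] by simp
  then show "(\<lambda>i. z * ((if i = 0 then 1 else 0) * (inverse z powr (1 / of_nat 1)) ^ i)) sums z"
    by (rule sums_cong[THEN iffD1, rotated]) auto
qed simp

lemma puiseux_from_power_series:
  assumes k: "k \<ge> 1" and \<eta>: "\<eta> > 0" and hol: "g holomorphic_on ball 0 \<eta>"
    and M: "M \<ge> 1 / \<eta> ^ k"
    and f: "\<And>z w. norm z > M \<Longrightarrow> w = inverse z powr (1 / of_nat k) \<Longrightarrow> f z = z * g w"
  shows "\<exists>N c. puiseux_at_infinity N c M f"
proof (intro exI)
  show "puiseux_at_infinity k (\<lambda>i. (deriv ^^ i) g 0 / fact i) M f"
    unfolding puiseux_at_infinity_def
  proof (intro conjI allI impI k)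
    fix z :: complex assume z: "norm z > M"
    define w where "w = inverse z powr (1 / of_nat k)"
    have "0 < 1 / \<eta> ^ k" using \<eta> by simp
    then have "norm z > 0" using z M by linarith
    then have "z \<noteq> 0" by simp
    then have "norm w < \<eta>"
      using k \<eta> z M by (intro norm_less_of_power_inverse[of k \<eta> w z]) (auto simp: w_def principal_root_power)
    then have "(\<lambda>i. (deriv ^^ i) g 0 / fact i * (w - 0) ^ i) sums g w"
      by (intro holomorphic_power_series[OF hol]) simp
    from sums_mult[OF this, of z] f[OF z w_def]
    show "(\<lambda>i. z * ((deriv ^^ i) g 0 / fact i * (inverse z powr (1 / of_nat k)) ^ i)) sums f z"
      by (simp add: w_def)
  qed
qed

text \<open>Since \<open>t ^ g\<close> takes every complex value, the reduced parametrization has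
  the same image as the given one.\<close>

lemma parametrized_curve_perfect:
  fixes a b :: "nat \<Rightarrow> complex" and Q :: "(complex ^ 3) set"
  assumes k: "k \<ge> 1"
    and Q: "Q = zariski_closure (range (\<lambda>t. vector [t ^ k, \<Sum>i\<le>k. a i * t ^ (k - i), \<Sum>i\<le>k. b i * t ^ (k - i)]))"
  shows "perfect_curve Q"
proof -
  define p where "p a = (\<Sum>i\<le>k. monom (a i) (k - i))" for a :: "nat \<Rightarrow> complex"
  have p: "poly (p a) t = (\<Sum>i\<le>k. a i * t ^ (k - i))" for a t
    by (simp add: p_def poly_sum poly_monom)
  have p_deg: "Polynomial.degree (p a) \<le> k" for a
    unfolding p_def by (intro degree_sum_le) (auto intro: order_trans[OF degree_monom_le])
  obtain e g :: nat and s2 s3 where e: "e \<ge> 1" "g \<ge> 1" "k = g * e"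
    and deg: "Polynomial.degree s2 \<le> e" "Polynomial.degree s3 \<le> e"
    and s: "\<And>t. poly (p a) t = poly s2 (t ^ g)" "\<And>t. poly (p b) t = poly s3 (t ^ g)"
    and conj: "\<And>w. w ^ e = 1 \<Longrightarrow> w \<noteq> 1 \<Longrightarrow> \<exists>t. poly s2 (w * t) \<noteq> poly s2 t \<or> poly s3 (w * t) \<noteq> poly s3 t"
    by (rule proper_reparametrization[OF k p_deg p_deg]) (rule that)
  define \<psi> where "\<psi> u = (vector [u ^ e, poly s2 u, poly s3 u] :: complex ^ 3)" for u
  have "vector [t ^ k, \<Sum>i\<le>k. a i * t ^ (k - i), \<Sum>i\<le>k. b i * t ^ (k - i)] = \<psi> (t ^ g)" for t
    unfolding p[symmetric] s \<psi>_def by (simp add: e(3) power_mult)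
  then have "range (\<lambda>t. vector [t ^ k, \<Sum>i\<le>k. a i * t ^ (k - i), \<Sum>i\<le>k. b i * t ^ (k - i)]) = range (\<lambda>t. \<psi> (t ^ g))"
    by simp
  also have "\<dots> = \<psi> ` range (\<lambda>t. t ^ g)" by auto
  also have "range (\<lambda>t::complex. t ^ g) = UNIV"
    using complex_root_exists[OF e(2)] by (metis surjI surj_def)
  finally have "Q = zariski_closure (range \<psi>)" unfolding Q by (rule arg_cong)
  then interpret polynomial_space_curve e s2 s3 \<psi> Q
    by unfold_locales (use e deg in \<open>auto simp: \<psi>_def\<close>)
  show ?thesis by (rule perfect_Q[OF conj])
qed

theorem theorem3:
  fixes f1 f2 :: "(real, 3) mpoly"
    and fp :: "(real, 2) mpoly"
    and h1 h2 :: "(complex, 2) mpoly"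
    and C :: "(complex ^ 3) set"
    and Cp :: "(complex ^ 2) set"
    and F3 :: "(complex, 3 option) mpoly"
    and a b :: "nat \<Rightarrow> complex"
    and r2 r3 :: "complex \<Rightarrow> complex"
    and M :: real
    and k n0 n \<mu> r :: nat
    and \<rho> :: "(nat \<Rightarrow> complex) \<Rightarrow> complex"
    and \<rho>s :: "nat \<Rightarrow> (nat \<Rightarrow> complex) \<Rightarrow> (nat \<Rightarrow> complex) \<Rightarrow> complex"
    and q2 q3 :: "complex \<Rightarrow> complex"
    and Q :: "(complex ^ 3) set"
  assumes C_def: "C = {x. reval f1 x = 0 \<and> reval f2 x = 0}"
    and C_curve: "irreducible_curve C"
    and C_infinity: "\<forall>v\<in>proj_closure C. v None = 0 \<longrightarrow>
        (\<exists>c m2 m3. c \<noteq> 0 \<and> v (Some 1) = c \<and> v (Some 2) = c * m2 \<and> v (Some 3) = c * m3)"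
    and Cp_def: "Cp = {u. reval fp u = 0}"
    and fp_irreducible: "irreducible (complexify fp)"
    and Cp_curve: "irreducible_curve Cp"
    and lift: "birational_projection C Cp h1 h2"
    and F3_def: "F3 = homogenize (f3_poly h1 h2)"
    and branch_p: "infinity_branch Cp M (\<lambda>z. vector [z, r2 z])"
    and k_pos: "k \<ge> 1"
    and r2_series: "puiseux_at_infinity k a M r2"
    and r3_def: "\<forall>z. r3 z = lift_function h1 h2 (vector [z, r2 z])"
    and n0: "\<forall>n'\<ge>n0. \<exists>\<mu>' r' \<rho>' \<rho>s'. Lambda_expansion F3 k a n' \<mu>' r' \<rho>' \<rho>s'"
    and n: "n \<ge> n0"
    and expansion: "Lambda_expansion F3 k a n \<mu> r \<rho> \<rho>s"
    and Lambda_zero: "\<forall>i\<le>k. Lambda \<rho> \<rho>s i a b = 0"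
    and q2_def: "\<forall>t. q2 t = (\<Sum>i\<le>k. a i * t ^ (k - i))"
    and q3_def: "\<forall>t. q3 t = (\<Sum>i\<le>k. b i * t ^ (k - i))"
    and Q_def: "Q = zariski_closure (range (\<lambda>t. vector [t ^ k, q2 t, q3 t]))"
  shows "\<exists>M'\<ge>M. (\<forall>z. norm z > M' \<longrightarrow> ceval h2 (vector [z, r2 z]) \<noteq> 0) \<and>
           g_asymptote Q C M' (\<lambda>z. vector [z, r2 z, r3 z])"
proof -
  have M: "M > 0" using branch_p by (simp add: infinity_branch_def)
  define root where "root z = inverse z powr (1 / of_nat k)" for z :: complex
  define R where "R w = suminf (\<lambda>i. a i * w ^ i)" for w
  have root: "root z ^ k = inverse z" "root z \<noteq> 0" "inverse (root z) ^ k = z" if "z \<noteq> 0" for z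
  proof -
    show 1: "root z ^ k = inverse z" unfolding root_def using that k_pos by (intro principal_root_power)
    then show "root z \<noteq> 0" using that k_pos by (auto simp: power_0_left)
    show "inverse (root z) ^ k = z" using 1 by (simp add: power_inverse)
  qed
  have series: "(\<lambda>i. a i * root z ^ i) sums (r2 z / z)" if "norm z > M" for z
  proof -
    have "(\<lambda>i. z * (a i * root z ^ i)) sums r2 z"
      using r2_series that by (simp add: puiseux_at_infinity_def root_def)
    from sums_mult[OF this, of "inverse z"]
    have "(\<lambda>i. inverse z * (z * (a i * root z ^ i))) sums (inverse z * r2 z)" .
    moreover have "z \<noteq> 0" using that M by auto
    then have "inverse z * (z * y) = y" for y by simp
    ultimately show ?thesis by (simp add: divide_inverse mult.commute)
  qed
  have r2: "r2 z = inverse (root z) ^ k * R (root z)" if "norm z > M" for z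
  proof -
    have "z \<noteq> 0" using that M by auto
    have "r2 z / z = R (root z)" using sums_unique[OF series[OF that]] by (simp add: R_def)
    then have "r2 z = z * R (root z)" using \<open>z \<noteq> 0\<close> by (simp add: field_simps)
    then show ?thesis using root(3)[OF \<open>z \<noteq> 0\<close>] by simp
  qed
  \<comment> \<open>\<open>M + 1\<close> is a point where the Puiseux series converges for the
    principal root; as a power series it then converges in the whole disc of radius
    \<open>norm w0\<close>.\<close>
  define w0 where "w0 = root (of_real (M + 1))"
  have w0: "w0 \<noteq> 0" unfolding w0_def using M by (intro root(2)) (simp add: complex_eq_iff)
  have R: "(\<lambda>i. a i * w ^ i) sums R w" if "norm w < norm w0" for w
  proof -
    have "norm (complex_of_real (M + 1)) > M" using M by (simp del: of_real_add)
    then have "summable (\<lambda>i. a i * w0 ^ i)" unfolding w0_def by (rule sums_summable[OF series])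
    then have "summable (\<lambda>i. a i * w ^ i)" using that by (rule powser_inside)
    then show ?thesis unfolding R_def by (rule summable_sums)
  qed
  have R_hol: "R holomorphic_on ball 0 (norm w0)"
    by (rule power_series_holomorphic[of 0 "norm w0" a]) (use R in auto)
  define x where "x w = (vector [inverse w ^ k, inverse w ^ k * R w] :: complex ^ 2)" for w
  define q where "q w = (\<Sum>i\<le>k. b i * inverse w ^ (k - i))" for w
  have x_root: "x (root z) = vector [z, r2 z]" if "norm z > M" for z
  proof -
    have "z \<noteq> 0" using that M by auto
    then show ?thesis using r2[OF that] root(3)[of z] by (simp add: x_def)
  qed
  have h2_nz: "\<forall>\<^sub>F w in at 0. ceval h2 (x w) \<noteq> 0"
    and q_lim: "((\<lambda>w. q w - lift_function h1 h2 (x w)) \<longlongrightarrow> 0) (at 0)"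
    unfolding x_def q_def
    using lift_asymptotics[OF k_pos w0 R expansion[unfolded F3_def] Lambda_zero] by auto
  obtain \<eta>0 where \<eta>0: "\<eta>0 > 0" "\<And>w. w \<noteq> 0 \<Longrightarrow> norm w < \<eta>0 \<Longrightarrow> ceval h2 (x w) \<noteq> 0"
    using h2_nz unfolding eventually_at by (auto simp: dist_norm)
  define \<eta> where "\<eta> = min \<eta>0 (norm w0)"
  have \<eta>: "\<eta> > 0" using \<eta>0(1) w0 by (simp add: \<eta>_def)
  \<comment> \<open>Since \<open>root z ^ k\<close> is \<open>inverse z\<close>, the third
    coordinate is \<open>z\<close> times \<open>L\<close> at \<open>root z\<close>; holomorphy of
    \<open>L\<close> at 0 therefore yields a Puiseux series without negative exponents.\<close>
  define L where "L w = w ^ k * lift_function h1 h2 (x w)" for w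
  have L_hol: "L holomorphic_on ball 0 \<eta> - {0}"
  proof -
    have R': "R holomorphic_on ball 0 \<eta> - {0}"
      using R_hol by (rule holomorphic_on_subset) (auto simp: \<eta>_def)
    have x_hol: "(\<lambda>w. x w $ i) holomorphic_on ball 0 \<eta> - {0}" for i
      using exhaust_2[of i] by (auto simp: x_def intro!: holomorphic_intros R')
    show ?thesis unfolding L_def lift_function_def
      by (intro holomorphic_intros holomorphic_on_ceval x_hol) (use \<eta>0(2) in \<open>auto simp: \<eta>_def\<close>)
  qed
  \<comment> \<open>Multiplication by \<open>w ^ k\<close> turns \<open>q w\<close> into the
    polynomial with coefficients \<open>b i\<close> in ascending order, so the limit of
    \<open>L\<close> is \<open>b 0\<close>.\<close>
  have "((\<lambda>w. (\<Sum>i\<le>k. b i * w ^ i) - w ^ k * (q w - lift_function h1 h2 (x w))) \<longlongrightarrow>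
      (\<Sum>i\<le>k. b i * 0 ^ i) - 0 ^ k * 0) (at 0)"
    by (intro tendsto_intros q_lim)
  moreover have "\<forall>\<^sub>F w in at 0. (\<Sum>i\<le>k. b i * w ^ i) - w ^ k * (q w - lift_function h1 h2 (x w)) = L w"
    using eventually_neq_at_within[of 0 0 UNIV]
  proof eventually_elim
    case (elim w)
    have "w ^ k * q w = (\<Sum>i\<le>k. b i * w ^ i)"
      unfolding q_def sum_distrib_left
    proof (rule sum.cong[OF refl])
      fix i assume "i \<in> {..k}"
      then have "w ^ k = w ^ (k - i) * w ^ i" by (simp add: power_add[symmetric])
      then show "w ^ k * (b i * inverse w ^ (k - i)) = b i * w ^ i"
        using elim by (simp add: power_inverse field_simps)
    qed
    then show ?case by (simp add: L_def algebra_simps)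
  qed
  ultimately have L_lim: "(L \<longlongrightarrow> (\<Sum>i\<le>k. b i * 0 ^ i) - 0 ^ k * 0) (at 0)"
    by (rule Lim_transform_eventually)
  define g where "g w = (if w = 0 then (\<Sum>i\<le>k. b i * 0 ^ i) - 0 ^ k * 0 else L w)" for w
  have g_hol: "g holomorphic_on ball 0 \<eta>"
    unfolding g_def by (rule removable_singularity[OF L_hol _ L_lim]) simp
  define E where "E = sym_diff C
       {y. proj12 y \<in> Cp \<and> ceval h2 (proj12 y) \<noteq> 0 \<and> y $ 3 = lift_function h1 h2 (proj12 y)}"
  have E: "finite E" using lift unfolding birational_projection_def E_def by blast
  have "bounded ((\<lambda>y. y $ 1) ` E)" using E by (intro finite_imp_bounded finite_imageI)
  \<comment> \<open>The first coordinate of the branch point is \<open>z\<close>, so for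
    \<open>norm z > K\<close> it avoids the finitely many points where the birational correspondence
    fails.\<close>
  then obtain K where K: "\<And>y. y \<in> E \<Longrightarrow> norm (y $ 1) \<le> K" by (auto simp: bounded_iff)
  define M' where "M' = Max {M, 1 / \<eta> ^ k, K}"
  have M': "M' \<ge> M" "M' \<ge> 1 / \<eta> ^ k" "M' \<ge> K" by (auto simp: M'_def)
  have root_small: "norm (root z) < \<delta>" if "\<delta> > 0" "norm z > 1 / \<delta> ^ k" for z \<delta>
  proof -
    have "0 < 1 / \<delta> ^ k" using that(1) by simp
    then have "norm z > 0" using that(2) by linarith
    then have "z \<noteq> 0" by simp
    then show ?thesis using that k_pos by (intro norm_less_of_power_inverse[of k \<delta> "root z" z]) (auto intro: root)
  qed
  have h2_z: "ceval h2 (vector [z, r2 z]) \<noteq> 0" if z: "norm z > M'" for z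
  proof -
    have "norm (root z) < \<eta>" using root_small[OF \<eta>, of z] M'(2) z by simp
    moreover have "root z \<noteq> 0" using z M' M by (intro root) auto
    ultimately have "ceval h2 (x (root z)) \<noteq> 0" using \<eta>0(2) by (simp add: \<eta>_def)
    then show ?thesis using x_root[of z] z M'(1) by simp
  qed
  define p where "p z = (vector [z, r2 z, r3 z] :: complex ^ 3)" for z
  have p_C: "p z \<in> C" if z: "norm z > M'" for z
  proof -
    have proj: "proj12 (p z) = vector [z, r2 z]" by (simp add: proj12_def p_def)
    have "vector [z, r2 z] \<in> Cp" using branch_p z M'(1) by (simp add: infinity_branch_def)
    then have "p z \<in> {y. proj12 y \<in> Cp \<and> ceval h2 (proj12 y) \<noteq> 0 \<and> y $ 3 = lift_function h1 h2 (proj12 y)}"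
      using h2_z[OF z] r3_def by (simp add: proj) (simp add: p_def)
    moreover have "p z \<notin> E" using K[of "p z"] z M'(3) by (auto simp: p_def)
    ultimately show ?thesis unfolding E_def by blast
  qed
  have "\<exists>N c. puiseux_at_infinity N c M' (\<lambda>z. p z $ i)" for i
  proof (rule UNIV_3_coords[of _ i])
    show "\<exists>N c. puiseux_at_infinity N c M' (\<lambda>z. p z $ 1)"
      using puiseux_identity by (auto simp: p_def)
    show "\<exists>N c. puiseux_at_infinity N c M' (\<lambda>z. p z $ 2)"
      using puiseux_at_infinity_mono[OF r2_series M'(1), of r2] by (auto simp: p_def)
    have "r3 z = z * g w" if z: "norm z > M'" and w: "w = inverse z powr (1 / of_nat k)" for z w
    proof -
      have "z \<noteq> 0" using z M' M by auto
      have "w = root z" using w by (simp add: root_def)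
      then have "g w = inverse z * r3 z"
        using root[OF \<open>z \<noteq> 0\<close>] x_root[of z] z M'(1) r3_def by (simp add: g_def L_def)
      then show ?thesis using \<open>z \<noteq> 0\<close> by simp
    qed
    from puiseux_from_power_series[OF k_pos \<eta> g_hol M'(2) this]
    show "\<exists>N c. puiseux_at_infinity N c M' (\<lambda>z. p z $ 3)" by (simp add: p_def)
  qed
  then have branch: "infinity_branch C M' p"
    unfolding infinity_branch_def using p_C M M'(1) by (auto simp: p_def)
  \<comment> \<open>The branch point at \<open>z\<close> minus the point of \<open>Q\<close> with
    parameter \<open>inverse (root z)\<close>; their first coordinates coincide.\<close>
  define \<delta> where "\<delta> w = (vector [0, inverse w ^ k * R w - (\<Sum>i\<le>k. a i * inverse w ^ (k - i)),
      lift_function h1 h2 (x w) - q w] :: complex ^ 3)" for w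
  have "(\<delta> \<longlongrightarrow> 0) (at 0)"
  proof (rule vec_tendstoI)
    fix i :: 3
    have 2: "((\<lambda>w. inverse w ^ k * R w - (\<Sum>i\<le>k. a i * inverse w ^ (k - i))) \<longlongrightarrow> 0) (at 0)"
      by (rule series_tail_tendsto[OF w0 R])
    have 3: "((\<lambda>w. lift_function h1 h2 (x w) - q w) \<longlongrightarrow> 0) (at 0)"
      using tendsto_minus[OF q_lim] by simp
    show "((\<lambda>w. \<delta> w $ i) \<longlongrightarrow> 0 $ i) (at 0)"
      by (rule UNIV_3_coords[of _ i]) (use 2 3 in \<open>simp_all add: \<delta>_def\<close>)
  qed
  moreover have "filterlim root (at 0) at_infinity"
    unfolding filterlim_at
  proof
    show "\<forall>\<^sub>F z in at_infinity. root z \<in> UNIV \<and> root z \<noteq> 0"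
      unfolding eventually_at_infinity
    proof (intro exI[of _ 1] allI impI conjI UNIV_I)
      fix z :: complex assume "1 \<le> norm z"
      then have "z \<noteq> 0" by auto
      then show "root z \<noteq> 0" by (rule root(2))
    qed
    show "(root \<longlongrightarrow> 0) at_infinity"
    proof (rule tendstoI)
      fix \<epsilon> :: real assume "\<epsilon> > 0"
      then show "\<forall>\<^sub>F z in at_infinity. dist (root z) 0 < \<epsilon>"
        unfolding eventually_at_infinity by (intro exI[of _ "1 / \<epsilon> ^ k + 1"]) (auto intro!: root_small)
    qed
  qed
  ultimately have "((\<lambda>z. \<delta> (root z)) \<longlongrightarrow> 0) at_infinity" by (rule filterlim_compose)
  then have lim: "((\<lambda>z. norm (\<delta> (root z))) \<longlongrightarrow> 0) at_infinity" by (rule tendsto_norm_zero)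
  have "((\<lambda>z. infdist (p z) Q) \<longlongrightarrow> 0) at_infinity"
  proof (rule tendsto_sandwich[OF _ _ tendsto_const lim])
    show "\<forall>\<^sub>F z in at_infinity. infdist (p z) Q \<le> norm (\<delta> (root z))"
      unfolding eventually_at_infinity
    proof (intro exI allI impI)
      fix z :: complex assume "M' + 1 \<le> norm z"
      then have z: "norm z > M'" by simp
      then have "z \<noteq> 0" using M' M by auto
      let ?t = "inverse (root z)"
      let ?y = "vector [?t ^ k, q2 ?t, q3 ?t] :: complex ^ 3"
      have "?y \<in> Q"
        unfolding Q_def by (rule subsetD[OF zariski_closure_subset], rule image_eqI[of _ _ ?t]) simp_all
      then have le: "infdist (p z) Q \<le> dist (p z) ?y" by (rule infdist_le)
      have zM: "norm z > M" using z M'(1) by simp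
      have "p z - ?y = vector [0, r2 z - q2 ?t, r3 z - q3 ?t]"
        using root(3)[OF \<open>z \<noteq> 0\<close>] by (simp add: p_def vec_eq_iff forall_3)
      also have "\<dots> = \<delta> (root z)"
        using r3_def q2_def q3_def by (simp add: \<delta>_def x_root[OF zM] r2[OF zM, symmetric] q_def)
      finally show "infdist (p z) Q \<le> norm (\<delta> (root z))" using le by (simp add: dist_norm)
    qed
  qed (simp add: infdist_nonneg)
  with branch have "approaches_at Q C M' p" by (simp add: approaches_at_def)
  moreover have "perfect_curve Q"
    using Q_def q2_def q3_def by (intro parametrized_curve_perfect[OF k_pos, of Q a b]) simp
  ultimately have "g_asymptote Q C M' p" by (simp add: g_asymptote_def)
  then show ?thesis using M'(1) h2_z unfolding p_def[abs_def] by blast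
qed

end
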